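(* The following equalities hold (functions being identified when they agree almost everywhere): (i) $S_2^0(\mathbb R)=S_2(\mathbb R)=\{\Lambda\in L^\infty(\mathbb R):\ \delta_\Lambda<\infty\}$. (ii) $S_1^0(\mathbb R)=\{\Lambda:\ \Lambda=\hat F \text{ for some } F\in L^1(\mathbb R) \text{ with } \delta_F<\infty\}$.
   Context: For $1\le p<\infty$, $M_p(\mathbb R)$ denotes the space of Fourier multipliers for $L^p(\mathbb R)$, i.e. functions $m\in L^\infty(\mathbb R)$ (modulo null sets) such that $f\mapsto (m\hat f)^\vee$ extends to a bounded operator on $L^p(\mathbb R)$, with norm $\|m\|_{M_p(\mathbb R)}$ the operator norm; $M_p(\mathbb Z)$ denotes the space of Fourier multipliers (bounded sequences on $\mathbb Z$) for $L^p(\mathbb T)$, with the operator norm $\|\cdot\|_{M_p(\mathbb Z)}$. Here $\mathbb T$ is identified with $[0,1)$, and $\hat f(\xi)=\int_{\mathbb R}f(x)e^{-2\pi i\xi x}\,dx$. $S_p(\mathbb R)$ (summability kernels for $L^p(\mathbb R)$ multipliers) is the set of measurable functions $\Lambda$ on $\mathbb R$ such that for each $\phi\in M_p(\mathbb Z)$ the series $W_{\phi,\Lambda}(\xi)=\sum_{n\in\mathbb Z}\phi(n)\Lambda(\xi-n)$ converges a.e., belongs to $M_p(\mathbb R)$, and there is a constant $C_{p,\Lambda}$ (independent of $\phi$) with $\|W_{\phi,\Lambda}\|_{M_p(\mathbb R)}\le C_{p,\Lambda}\|\phi\|_{M_p(\mathbb Z)}$. $S_p^0(\mathbb R)$ is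 the set of $\Lambda\in L^\infty(\mathbb R)$ such that for each finitely supported $\phi\in M_p(\mathbb Z)$ the function $W_{\phi,\Lambda}(\xi)=\sum_{n\in\mathbb Z}\phi(n)\Lambda(\xi-n)$ belongs to $M_p(\mathbb R)$, and there is a constant $C_{p,\Lambda}$ (independent of $\phi$) with $\|W_{\phi,\Lambda}\|_{M_p(\mathbb R)}\le C_{p,\Lambda}\|\phi\|_{M_p(\mathbb Z)}$. For a measurable function $G$ on $\mathbb R$, $\delta_G=\operatorname{ess\,sup}_{\xi}\sum_{n\in\mathbb Z}|G(\xi+n)|$. *)

theory Defs
  imports "HOL-Probability.Probability"
begin

text \<open>
  Functions on the line are total functions \<^typ>\<open>real \<Rightarrow> complex\<close>, measurable with respect to
  Lebesgue measure. Since Lebesgue measure is complete, every set of functions on the line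
  introduced below (apart from the Schwartz functions) is closed under modification on null sets,
  so that equality of such sets is equality of the corresponding sets of classes modulo null sets.
\<close>

definition Lp_space :: "real \<Rightarrow> 'a measure \<Rightarrow> ('a \<Rightarrow> complex) set" where
  "Lp_space p M = {f \<in> borel_measurable M. integrable M (\<lambda>x. norm (f x) powr p)}"

definition Lp_norm :: "real \<Rightarrow> 'a measure \<Rightarrow> ('a \<Rightarrow> complex) \<Rightarrow> real" where
  "Lp_norm p M f = (LINT x|M. norm (f x) powr p) powr (1 / p)"

definition Linfty_space :: "'a measure \<Rightarrow> ('a \<Rightarrow> complex) set" where
  "Linfty_space M = {f \<in> borel_measurable M. \<exists>C. AE x in M. norm (f x) \<le> C}"

text \<open>
  Bounded linear operators on \<open>L\<^sup>p\<close>, acting on representatives. Linearity and the bound force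
  \<open>T f = T g\<close> almost everywhere whenever \<open>f = g\<close> almost everywhere.
\<close>

definition bounded_Lp_operator ::
  "real \<Rightarrow> 'a measure \<Rightarrow> (('a \<Rightarrow> complex) \<Rightarrow> ('a \<Rightarrow> complex)) \<Rightarrow> bool" where
  "bounded_Lp_operator p M T \<longleftrightarrow>
     (\<forall>f\<in>Lp_space p M. T f \<in> Lp_space p M) \<and>
     (\<forall>f\<in>Lp_space p M. \<forall>g\<in>Lp_space p M. AE x in M. T (\<lambda>y. f y + g y) x = T f x + T g x) \<and>
     (\<forall>c. \<forall>f\<in>Lp_space p M. AE x in M. T (\<lambda>y. c * f y) x = c * T f x) \<and>
     (\<exists>C. \<forall>f\<in>Lp_space p M. Lp_norm p M (T f) \<le> C * Lp_norm p M f)"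

text \<open>The quotient is \<open>0\<close> when \<open>f\<close> vanishes almost everywhere, as in \<^const>\<open>onorm\<close>.\<close>

definition Lp_onorm ::
  "real \<Rightarrow> 'a measure \<Rightarrow> (('a \<Rightarrow> complex) \<Rightarrow> ('a \<Rightarrow> complex)) \<Rightarrow> real" where
  "Lp_onorm p M T = (SUP f\<in>Lp_space p M. Lp_norm p M (T f) / Lp_norm p M f)"

definition fourier :: "(real \<Rightarrow> complex) \<Rightarrow> real \<Rightarrow> complex" where
  "fourier f \<xi> = (LINT x|lebesgue. f x * cis (- 2 * pi * \<xi> * x))"

definition inv_fourier :: "(real \<Rightarrow> complex) \<Rightarrow> real \<Rightarrow> complex" where
  "inv_fourier g x = (LINT \<xi>|lebesgue. g \<xi> * cis (2 * pi * \<xi> * x))"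

definition nth_vector_derivative :: "nat \<Rightarrow> (real \<Rightarrow> complex) \<Rightarrow> real \<Rightarrow> complex" where
  "nth_vector_derivative j = (\<lambda>f x. vector_derivative f (at x)) ^^ j"

definition schwartz :: "(real \<Rightarrow> complex) set" where
  "schwartz = {f. (\<forall>j x. nth_vector_derivative j f differentiable (at x)) \<and>
                  (\<forall>j k. \<exists>C. \<forall>x. \<bar>x\<bar> ^ k * norm (nth_vector_derivative j f x) \<le> C)}"

text \<open>
  \<open>T\<close> is a bounded operator on \<open>L\<^sup>p(\<real>)\<close> extending \<open>f \<mapsto> (m \<cdot> f^)\<^sup>\<or>\<close>, which is given on the Schwartz
  class by absolutely convergent integrals. As that class is dense in \<open>L\<^sup>p\<close> for \<open>1 \<le> p < \<infinity>\<close>, such a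
  \<open>T\<close> is unique up to null sets; the infimum in the norm below thus is the operator norm of the one
  extension.
\<close>

definition extends_multiplier_R ::
  "real \<Rightarrow> (real \<Rightarrow> complex) \<Rightarrow> ((real \<Rightarrow> complex) \<Rightarrow> (real \<Rightarrow> complex)) \<Rightarrow> bool" where
  "extends_multiplier_R p m T \<longleftrightarrow>
     bounded_Lp_operator p lebesgue T \<and>
     (\<forall>f\<in>schwartz. AE x in lebesgue. T f x = inv_fourier (\<lambda>\<xi>. m \<xi> * fourier f \<xi>) x)"

definition multipliers_R :: "real \<Rightarrow> (real \<Rightarrow> complex) set" where
  "multipliers_R p = {m \<in> Linfty_space lebesgue. \<exists>T. extends_multiplier_R p m T}"

definition multiplier_norm_R :: "real \<Rightarrow> (real \<Rightarrow> complex) \<Rightarrow> real" where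
  "multiplier_norm_R p m = (INF T\<in>{T. extends_multiplier_R p m T}. Lp_onorm p lebesgue T)"

text \<open>
  The torus is \<open>[0,1)\<close> with Lebesgue measure; the trigonometric polynomials play the role of the
  Schwartz class, so the sum over all integers in the definition of \<open>extends_multiplier_Z\<close> has only
  finitely many nonzero terms.
\<close>

abbreviation torus :: "real measure" where
  "torus \<equiv> lebesgue_on {0..<1}"

definition fourier_coeff :: "(real \<Rightarrow> complex) \<Rightarrow> int \<Rightarrow> complex" where
  "fourier_coeff f n = (LINT x|torus. f x * cis (- 2 * pi * of_int n * x))"

definition trig_polys :: "(real \<Rightarrow> complex) set" where
  "trig_polys = {f. \<exists>A a. finite A \<and> f = (\<lambda>x. \<Sum>n\<in>A. a n * cis (2 * pi * of_int n * x))}"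

definition extends_multiplier_Z ::
  "real \<Rightarrow> (int \<Rightarrow> complex) \<Rightarrow> ((real \<Rightarrow> complex) \<Rightarrow> (real \<Rightarrow> complex)) \<Rightarrow> bool" where
  "extends_multiplier_Z p \<phi> T \<longleftrightarrow>
     bounded_Lp_operator p torus T \<and>
     (\<forall>f\<in>trig_polys. AE x in torus.
        T f x = (\<Sum>\<^sub>\<infinity>n\<in>UNIV. \<phi> n * fourier_coeff f n * cis (2 * pi * of_int n * x)))"

definition multipliers_Z :: "real \<Rightarrow> (int \<Rightarrow> complex) set" where
  "multipliers_Z p = {\<phi>. bounded (range \<phi>) \<and> (\<exists>T. extends_multiplier_Z p \<phi> T)}"

definition multiplier_norm_Z :: "real \<Rightarrow> (int \<Rightarrow> complex) \<Rightarrow> real" where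
  "multiplier_norm_Z p \<phi> = (INF T\<in>{T. extends_multiplier_Z p \<phi> T}. Lp_onorm p torus T)"

text \<open>
  Two-sided series are limits of symmetric partial sums, the weakest customary mode of convergence.
\<close>

definition W_partial ::
  "(int \<Rightarrow> complex) \<Rightarrow> (real \<Rightarrow> complex) \<Rightarrow> real \<Rightarrow> nat \<Rightarrow> complex" where
  "W_partial \<phi> \<Lambda> \<xi> N = (\<Sum>n = - int N..int N. \<phi> n * \<Lambda> (\<xi> - of_int n))"

definition W :: "(int \<Rightarrow> complex) \<Rightarrow> (real \<Rightarrow> complex) \<Rightarrow> real \<Rightarrow> complex" where
  "W \<phi> \<Lambda> \<xi> = lim (W_partial \<phi> \<Lambda> \<xi>)"

definition summability_kernels :: "real \<Rightarrow> (real \<Rightarrow> complex) set" where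
  "summability_kernels p =
     {\<Lambda> \<in> borel_measurable lebesgue. \<exists>C. \<forall>\<phi>\<in>multipliers_Z p.
        (AE \<xi> in lebesgue. convergent (W_partial \<phi> \<Lambda> \<xi>)) \<and>
        W \<phi> \<Lambda> \<in> multipliers_R p \<and>
        multiplier_norm_R p (W \<phi> \<Lambda>) \<le> C * multiplier_norm_Z p \<phi>}"

definition summability_kernels0 :: "real \<Rightarrow> (real \<Rightarrow> complex) set" where
  "summability_kernels0 p =
     {\<Lambda> \<in> Linfty_space lebesgue. \<exists>C. \<forall>\<phi>\<in>multipliers_Z p. finite {n. \<phi> n \<noteq> 0} \<longrightarrow>
        W \<phi> \<Lambda> \<in> multipliers_R p \<and>
        multiplier_norm_R p (W \<phi> \<Lambda>) \<le> C * multiplier_norm_Z p \<phi>}"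

definition periodization_bound :: "(real \<Rightarrow> complex) \<Rightarrow> ennreal" where
  "periodization_bound G =
     esssup lebesgue (\<lambda>\<xi>. \<Sum>\<^sub>\<infinity>n\<in>(UNIV::int set). ennreal (norm (G (\<xi> + of_int n))))"

end

theory Submission
  imports Defs "HOL-Real_Asymp.Real_Asymp"
begin

text \<open>
  (i) By Plancherel the multiplier norm for \<open>p = 2\<close> is the essential supremum. Testing the kernel
  condition on \<open>\<phi> = \<plusminus>1\<close> on \<open>[-N, N]\<close> and choosing the signs according to \<open>\<Lambda> (\<xi> - n)\<close> bounds
  \<open>\<Sum>|\<Lambda> (\<xi> - n)|\<close>; conversely \<open>|W| \<le> \<delta> \<cdot> sup |\<phi>|\<close>.

  (ii) For \<open>\<Lambda> = F^\<close> and a trigonometric polynomial \<open>P\<close> with coefficients \<open>\<phi>\<close>, the function \<open>W\<close> is the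
  Fourier transform of \<open>F P\<close>, whose \<open>L\<^sup>1\<close> norm is at most \<open>\<delta>\<close> times that of \<open>P\<close> on the torus, and the
  latter is the multiplier norm of \<open>\<phi>\<close>. Conversely, let \<open>F\<^sub>s\<close> be the inverse Fourier transform of \<open>\<Lambda>\<close> times
  a Gaussian. The kernel condition gives \<open>\<parallel>F\<^sub>s P\<parallel> \<le> C \<parallel>P\<parallel>\<close> in \<open>L\<^sup>1\<close>, and taking for \<open>P\<close> Fejer kernels
  concentrating at \<open>b\<close> yields \<open>\<Sum>|F\<^sub>s (b + k)| \<le> C\<close>. Hence the \<open>F\<^sub>s\<close> are bounded in \<open>L\<^sup>1\<close> and in
  \<open>L\<^sup>\<infinity>\<close>, therefore in \<open>L\<^sup>2\<close>, so that \<open>\<Lambda>\<close> lies in \<open>L\<^sup>2\<close>; the \<open>F\<^sub>s\<close> converge in \<open>L\<^sup>2\<close> to the required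
  \<open>F\<close>, and the bounds pass to the limit. No weak compactness of measures is needed.
\<close>

section \<open>The Fourier transform and Gaussians\<close>

text \<open>A kernel is merely bounded, so neither \<open>\<Lambda>\<close> nor \<open>W\<close>
  need have a Fourier transform given by an integral; the kernel condition reaches them only through
  an operator applied to Schwartz functions. Gaussians serve as test functions because a Gaussian,
  its modulations and their transforms are explicit. For exponent 2 a test yields a Gaussian average
  of \<open>W\<close>, and the essential bound comes back by letting the width shrink. For exponent
  1 a test yields the inverse transform of \<open>W\<close> times a Gaussian, whereas the argument
  needs \<open>W\<close> formed from \<open>\<Lambda>\<close> times a Gaussian: only then is the
  result the product of an honest function with a Fejer kernel. The factor can be moved inside the
  sum because the Fejer kernels obey the same bound at every centre \<open>b\<close>. The
  regularized functions are moreover continuous, which is what allows the Fejer kernels to be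
  evaluated at a single point.\<close>

lemma borel_measurable_cis [measurable]: "cis \<in> borel_measurable borel"
  by (intro borel_measurable_continuous_onI continuous_intros)

lemma isCont_cis: "isCont cis x"
  using continuous_on_cis[OF continuous_on_id, of UNIV] by (simp add: continuous_on_eq_continuous_at)

lemma fourier_lborel:
  assumes "f \<in> borel_measurable borel"
  shows "fourier f \<xi> = (LINT x|lborel. f x * cis (- 2 * pi * \<xi> * x))"
  unfolding fourier_def using assms by (subst integral_completion) auto

lemma inv_fourier_eq: "inv_fourier g x = fourier g (- x)"
  by (simp add: inv_fourier_def fourier_def mult_ac)

text \<open>Kernels and operators live on Lebesgue measurable functions, while Fubini's theorem and
  affine substitution are applied on \<open>lborel\<close>. Trading a function for a Borel version
  leaves its transform unchanged at every point, see \<open>fourier_cong_AE\<close>.\<close>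

lemma lebesgue_borel_rep:
  fixes f :: "real \<Rightarrow> complex"
  assumes "f \<in> borel_measurable lebesgue"
  obtains g where "g \<in> borel_measurable borel" "AE x in lborel. f x = g x"
proof -
  have "(\<lambda>x. Re (f x)) \<in> borel_measurable lebesgue" "(\<lambda>x. Im (f x)) \<in> borel_measurable lebesgue"
    using assms by measurable
  from this[THEN completion_ex_borel_measurable_real]
  obtain a b where [measurable]: "a \<in> borel_measurable borel" "b \<in> borel_measurable borel"
    and ae: "AE x in lborel. Re (f x) = a x" "AE x in lborel. Im (f x) = b x"
    by auto
  show thesis
  proof
    show "(\<lambda>x. Complex (a x) (b x)) \<in> borel_measurable borel"
      unfolding Complex_eq by measurable
    show "AE x in lborel. f x = Complex (a x) (b x)"
      using ae by eventually_elim (simp add: complex_eq_iff)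
  qed
qed

lemma fourier_cong_AE:
  assumes "f \<in> borel_measurable lebesgue" "g \<in> borel_measurable lebesgue" "AE x in lborel. f x = g x"
  shows "fourier f = fourier g"
  unfolding fourier_def
proof (intro ext integral_cong_AE)
  have m: "(\<lambda>x. cis (- 2 * pi * \<xi> * x)) \<in> borel_measurable lebesgue" for \<xi>
    by (intro measurable_completion) measurable
  show "(\<lambda>x. f x * cis (- 2 * pi * \<xi> * x)) \<in> borel_measurable lebesgue"
    "(\<lambda>x. g x * cis (- 2 * pi * \<xi> * x)) \<in> borel_measurable lebesgue" for \<xi>
    using assms m[of \<xi>] by auto
  show "AE x in lebesgue. f x * cis (- 2 * pi * \<xi> * x) = g x * cis (- 2 * pi * \<xi> * x)" for \<xi>
    using AE_completion[OF assms(3)] by eventually_elim simp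
qed

lemma integrable_mult_cis [simp]:
  fixes f :: "real \<Rightarrow> complex"
  assumes "h \<in> borel_measurable borel" "integrable lborel f"
  shows "integrable lborel (\<lambda>x. f x * cis (h x))"
proof (rule Bochner_Integration.integrable_bound[OF assms(2)])
  have [measurable]: "f \<in> borel_measurable borel" "h \<in> borel_measurable borel"
    using assms by auto
  show "(\<lambda>x. f x * cis (h x)) \<in> borel_measurable lborel" by measurable
qed (auto simp: norm_mult)

lemma norm_fourier_le:
  assumes "integrable lborel f"
  shows "norm (fourier f \<xi>) \<le> (LINT x|lborel. norm (f x))"
proof -
  have "norm (fourier f \<xi>) \<le> (LINT x|lborel. norm (f x * cis (- 2 * pi * \<xi> * x)))"
    using assms by (subst fourier_lborel) auto
  then show ?thesis by (simp add: norm_mult)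
qed

lemma continuous_fourier:
  assumes "integrable lborel f"
  shows "continuous_on UNIV (fourier f)"
  unfolding continuous_on_sequentially
proof (intro allI ballI impI, elim conjE)
  fix u :: "nat \<Rightarrow> real" and a assume u: "u \<longlonglongrightarrow> a"
  have [measurable]: "f \<in> borel_measurable borel" using assms by auto
  have "(\<lambda>n. LINT x|lborel. f x * cis (- 2 * pi * u n * x)) \<longlonglongrightarrow> (LINT x|lborel. f x * cis (- 2 * pi * a * x))"
  proof (rule integral_dominated_convergence)
    show "integrable lborel (\<lambda>x. norm (f x))" using assms by auto
    show "AE x in lborel. (\<lambda>n. f x * cis (- 2 * pi * u n * x)) \<longlonglongrightarrow> f x * cis (- 2 * pi * a * x)"
      by (intro always_eventually allI tendsto_mult_left isCont_tendsto_compose[where g = cis]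
          tendsto_mult_right u isCont_cis)
  qed (auto simp: norm_mult)
  then show "(fourier f \<circ> u) \<longlonglongrightarrow> fourier f a"
    by (simp add: fourier_lborel o_def)
qed

lemma borel_measurable_fourier:
  assumes "integrable lborel f"
  shows "fourier f \<in> borel_measurable borel"
  by (intro borel_measurable_continuous_onI continuous_fourier assms)

lemma integrable_prod_mult:
  fixes f g :: "real \<Rightarrow> complex"
  assumes "integrable lborel f" "integrable lborel g"
  shows "integrable (lborel \<Otimes>\<^sub>M lborel) (\<lambda>(x, y). f x * g y)"
proof -
  have [measurable]: "f \<in> borel_measurable borel" "g \<in> borel_measurable borel" using assms by auto
  show ?thesis
    using assms by (intro lborel_pair.Fubini_integrable) (auto simp: norm_mult)
qed

text \<open>The multiplication formula, by Fubini's theorem. It takes the place of Parseval's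
  identity throughout: with a modulated Gaussian as second function it gives
  \<open>gauss_conv_fourier\<close>, with a translate it gives the convolution formula.\<close>

lemma integral_fourier_mult:
  assumes "integrable lborel f" "integrable lborel g"
  shows "(LINT x|lborel. fourier f x * g x) = (LINT x|lborel. f x * fourier g x)"
proof -
  have [measurable]: "f \<in> borel_measurable borel" "g \<in> borel_measurable borel" using assms by auto
  have int: "integrable (lborel \<Otimes>\<^sub>M lborel) (\<lambda>(y, x). f y * g x * cis (- 2 * pi * x * y))"
    by (rule Bochner_Integration.integrable_bound[OF integrable_prod_mult[OF assms]])
       (auto simp: norm_mult split: prod.split)
  have "(LINT x|lborel. fourier f x * g x) = (LINT x|lborel. LINT y|lborel. f y * g x * cis (- 2 * pi * x * y))"
    by (subst fourier_lborel) (auto simp add: mult_ac simp flip: integral_mult_right_zero)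
  also have "\<dots> = (LINT y|lborel. LINT x|lborel. f y * g x * cis (- 2 * pi * x * y))"
    using lborel_pair.Fubini_integral[OF int] by simp
  also have "\<dots> = (LINT x|lborel. f x * fourier g x)"
    by (simp add: fourier_lborel mult_ac flip: integral_mult_right_zero)
  finally show ?thesis .
qed

section \<open>Gaussians, their transforms and Gaussian averages\<close>

definition gauss_hat :: "real \<Rightarrow> real \<Rightarrow> real" where
  "gauss_hat s \<xi> = exp (- 2 * (pi * s * \<xi>)\<^sup>2)"

lemma gauss_hat_pos [simp]: "gauss_hat s \<xi> > 0"
  and gauss_hat_nonneg [simp]: "gauss_hat s \<xi> \<ge> 0"
  and gauss_hat_le_1 [simp]: "gauss_hat s \<xi> \<le> 1"
  by (auto simp: gauss_hat_def)

lemma borel_measurable_gauss_hat [measurable]: "gauss_hat s \<in> borel_measurable borel"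
  unfolding gauss_hat_def[abs_def] by measurable

text \<open>The bell curve on the frequency side is again a normal density of reciprocal width, up
  to a constant. Integrability and the transform of \<open>gauss_hat\<close> are inherited from that
  density.\<close>

lemma gauss_hat_eq:
  assumes "s > 0"
  shows "gauss_hat s \<xi> = sqrt (2 * pi) / (2 * pi * s) * normal_density 0 (1 / (2 * pi * s)) \<xi>"
proof -
  have "sqrt (2 * pi * (1 / (2 * pi * s))\<^sup>2) = sqrt (2 * pi) / (2 * pi * s)"
    using assms by (simp add: real_sqrt_mult real_sqrt_divide)
  moreover have "- \<xi>\<^sup>2 / (2 * (1 / (2 * pi * s))\<^sup>2) = - 2 * (pi * s * \<xi>)\<^sup>2"
    using assms by (simp add: field_simps power2_eq_square)
  ultimately show ?thesis
    using assms unfolding gauss_hat_def normal_density_def by simp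
qed

lemma integrable_gauss_hat:
  assumes "s > 0" shows "integrable lborel (gauss_hat s)"
  unfolding gauss_hat_eq[OF assms, abs_def] using assms by auto

text \<open>After scaling to unit width the integral is the characteristic function of the standard
  normal law at \<open>- 2 * pi * \<xi> * s\<close>; half the square of this argument is the
  exponent in \<open>gauss_hat\<close>.\<close>

lemma fourier_normal_density:
  assumes "s > 0"
  shows "fourier (\<lambda>x. complex_of_real (normal_density 0 s x)) \<xi> = gauss_hat s \<xi>"
proof -
  have "fourier (\<lambda>x. complex_of_real (normal_density 0 s x)) \<xi>
      = (LINT x|lborel. complex_of_real (normal_density 0 s x) * cis (- 2 * pi * \<xi> * x))"
    by (intro fourier_lborel) measurable
  also have "\<dots> = s *\<^sub>R (LINT x|lborel. complex_of_real (normal_density 0 s (0 + s * x)) * cis (- 2 * pi * \<xi> * (0 + s * x)))"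
    using assms by (subst lborel_integral_real_affine[where c = s and t = 0]) auto
  also have "\<dots> = (LINT x|lborel. std_normal_density x *\<^sub>R cis ((- 2 * pi * \<xi> * s) * x))"
    unfolding integral_scaleR_right[symmetric]
  proof (intro Bochner_Integration.integral_cong refl)
    fix x
    have "s * normal_density 0 s (s * x) = std_normal_density x"
      using assms by (simp add: normal_density_def real_sqrt_mult field_simps)
    then show "s *\<^sub>R (complex_of_real (normal_density 0 s (0 + s * x)) * cis (- 2 * pi * \<xi> * (0 + s * x))) =
         std_normal_density x *\<^sub>R cis (- 2 * pi * \<xi> * s * x)"
      by (simp add: scaleR_conv_of_real mult_ac flip: of_real_mult)
  qed
  also have "\<dots> = char std_normal_distribution (- 2 * pi * \<xi> * s)"
    unfolding char_def by (subst integral_density) (auto simp: cis_conv_exp)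
  also have "\<dots> = gauss_hat s \<xi>"
    unfolding char_std_normal_distribution gauss_hat_def by (simp add: power2_eq_square mult_ac)
  finally show ?thesis .
qed

lemma fourier_gauss_hat:
  assumes "s > 0"
  shows "fourier (\<lambda>\<xi>. complex_of_real (gauss_hat s \<xi>)) x = normal_density 0 s x"
proof -
  let ?r = "1 / (2 * pi * s)"
  have "fourier (\<lambda>\<xi>. complex_of_real (gauss_hat s \<xi>)) x
      = complex_of_real (sqrt (2 * pi) / (2 * pi * s)) * fourier (\<lambda>x. complex_of_real (normal_density 0 ?r x)) x"
    unfolding gauss_hat_eq[OF assms] fourier_def of_real_mult mult.assoc
    by (rule integral_mult_right_zero)
  also have "\<dots> = complex_of_real (sqrt (2 * pi) / (2 * pi * s) * gauss_hat ?r x)"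
    using assms by (subst fourier_normal_density) auto
  also have "sqrt (2 * pi) / (2 * pi * s) * gauss_hat ?r x = normal_density 0 s x"
  proof -
    have "- 2 * (pi * ?r * x)\<^sup>2 = - x\<^sup>2 / (2 * s\<^sup>2)"
      using assms by (simp add: field_simps power2_eq_square)
    moreover have "sqrt (2 * pi) / (2 * pi * s) = 1 / sqrt (2 * pi * s\<^sup>2)"
      using assms by (simp add: real_sqrt_mult field_simps)
    ultimately show ?thesis unfolding gauss_hat_def normal_density_def by simp
  qed
  finally show ?thesis .
qed

text \<open>The convolution is rescaled so that the Gaussian weight does not depend on \<open>s\<close>.\<close>

definition gauss_conv :: "real \<Rightarrow> (real \<Rightarrow> complex) \<Rightarrow> real \<Rightarrow> complex" where
  "gauss_conv s f x = (LINT t|lborel. std_normal_density t *\<^sub>R f (x - s * t))"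

lemma fourier_mult_cis:
  "fourier (\<lambda>\<xi>. f \<xi> * cis (2 * pi * \<xi> * a)) y = fourier f (y - a)"
  unfolding fourier_def mult.assoc cis_mult
  by (intro Bochner_Integration.integral_cong refl) (simp add: algebra_simps)

lemma gauss_conv_eq_integral:
  assumes "s > 0"
  shows "gauss_conv s f x = (LINT y|lborel. f y * normal_density 0 s (y - x))"
proof -
  have "(LINT y|lborel. f y * complex_of_real (normal_density 0 s (y - x)))
     = s *\<^sub>R (LINT t|lborel. f (x + (- s) * t) * normal_density 0 s (x + (- s) * t - x))"
    using assms by (subst lborel_integral_real_affine[where c = "- s" and t = x]) auto
  also have "\<dots> = gauss_conv s f x"
    unfolding gauss_conv_def integral_scaleR_right[symmetric]
  proof (intro Bochner_Integration.integral_cong refl)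
    fix t
    have "s * normal_density 0 s (s * t) = std_normal_density t"
      using assms by (simp add: normal_density_def real_sqrt_mult field_simps)
    moreover have "normal_density 0 s (s * t) = normal_density 0 s (- (s * t))"
      by (simp add: normal_density_def)
    ultimately show "s *\<^sub>R (f (x + - s * t) * complex_of_real (normal_density 0 s (x + - s * t - x)))
        = std_normal_density t *\<^sub>R f (x - s * t)"
      by (simp add: scaleR_conv_of_real mult_ac flip: of_real_mult)
  qed
  finally show ?thesis ..
qed

text \<open>This is the multiplication formula with a modulated \<open>gauss_hat\<close> as second
  function. The right side converges absolutely even if \<open>fourier f\<close> is not integrable,
  so it acts as a regularized inversion integral.\<close>

lemma gauss_conv_fourier:
  assumes "s > 0" "integrable lborel f"
  shows "gauss_conv s f x = (LINT \<xi>|lborel. fourier f \<xi> * (gauss_hat s \<xi> * cis (2 * pi * \<xi> * x)))"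
proof -
  have "(LINT \<xi>|lborel. fourier f \<xi> * (gauss_hat s \<xi> * cis (2 * pi * \<xi> * x)))
     = (LINT y|lborel. f y * fourier (\<lambda>\<xi>. gauss_hat s \<xi> * cis (2 * pi * \<xi> * x)) y)"
    using assms integrable_gauss_hat by (intro integral_fourier_mult) auto
  also have "\<dots> = gauss_conv s f x"
    using assms by (simp add: fourier_mult_cis fourier_gauss_hat gauss_conv_eq_integral)
  finally show ?thesis ..
qed

lemma gauss_conv_tendsto:
  assumes [measurable]: "f \<in> borel_measurable borel" and bd: "\<And>x. norm (f x) \<le> B"
    and cont: "isCont f x" and s: "s \<longlonglongrightarrow> 0"
  shows "(\<lambda>n. gauss_conv (s n) f x) \<longlonglongrightarrow> f x"
proof -
  have "(\<lambda>n. LINT t|lborel. std_normal_density t *\<^sub>R f (x - s n * t)) \<longlonglongrightarrow> (LINT t|lborel. std_normal_density t *\<^sub>R f x)"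
  proof (rule integral_dominated_convergence)
    show "integrable lborel (\<lambda>t. std_normal_density t * B)" by auto
    show "AE t in lborel. (\<lambda>n. std_normal_density t *\<^sub>R f (x - s n * t)) \<longlonglongrightarrow> std_normal_density t *\<^sub>R f x"
      by (intro always_eventually allI tendsto_intros isCont_tendsto_compose[OF cont])
         (auto intro!: tendsto_eq_intros s)
    show "AE t in lborel. norm (std_normal_density t *\<^sub>R f (x - s n * t)) \<le> std_normal_density t * B" for n
      using bd by (auto intro!: mult_left_mono)
  qed auto
  then show ?thesis by (simp add: gauss_conv_def)
qed

lemma gauss_hat_tendsto:
  assumes "s \<longlonglongrightarrow> 0"
  shows "(\<lambda>n. gauss_hat (s n) \<xi>) \<longlonglongrightarrow> 1"
proof -
  have "(\<lambda>n. exp (- 2 * (pi * s n * \<xi>)\<^sup>2)) \<longlonglongrightarrow> exp (- 2 * (pi * 0 * \<xi>)\<^sup>2)"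
    by (intro tendsto_intros assms)
  then show ?thesis by (simp add: gauss_hat_def)
qed

section \<open>Gaussian regularization and inversion\<close>

lemma borel_measurable_cnj [measurable]: "cnj \<in> borel_measurable borel"
  by (intro borel_measurable_continuous_onI continuous_intros)

lemma integrable_translate [simp]:
  fixes f :: "real \<Rightarrow> 'a :: {banach, second_countable_topology}"
  assumes "integrable lborel f"
  shows "integrable lborel (\<lambda>x. f (x - t))"
  using lborel_integrable_real_affine[OF assms, of 1 "- t"] by simp

lemma integral_translate:
  fixes f :: "real \<Rightarrow> 'a :: {banach, second_countable_topology}"
  shows "(LINT x|lborel. f (x - t)) = (LINT x|lborel. f x)"
  using lborel_integral_real_affine[of 1 f "- t"] by simp

lemma nn_integral_translate:
  fixes f :: "real \<Rightarrow> ennreal"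
  assumes "f \<in> borel_measurable borel"
  shows "(\<integral>\<^sup>+x. f (x - t) \<partial>lborel) = (\<integral>\<^sup>+x. f x \<partial>lborel)"
  using nn_integral_real_affine[OF assms, of 1 "- t"] by simp

section \<open>Continuity of translation in L1\<close>

abbreviation (input) L1_dist_translate where
  "L1_dist_translate f t \<equiv> (LINT x|lborel. norm (f (x - t) - f x))"

text \<open>The 2 pays for replacing \<open>f\<close> by \<open>g\<close> at \<open>x\<close> and at
  \<open>x - t\<close>. The error term does not involve \<open>t\<close>, so convergence to 0 is
  inherited by limits in L1.\<close>

lemma L1_dist_translate_le:
  fixes f g :: "real \<Rightarrow> 'a :: {banach, second_countable_topology}"
  assumes [simp]: "integrable lborel f" "integrable lborel g"
  shows "L1_dist_translate f t \<le> L1_dist_translate g t + 2 * (LINT x|lborel. norm (f x - g x))"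
proof -
  have int: "integrable lborel (\<lambda>x. norm (f x - g x))" by auto
  have "L1_dist_translate f t \<le> (LINT x|lborel. norm (g (x - t) - g x) + (norm (f (x - t) - g (x - t)) + norm (f x - g x)))"
  proof (rule integral_mono)
    fix x
    have "f (x - t) - f x = (g (x - t) - g x) + (f (x - t) - g (x - t)) - (f x - g x)" by simp
    also have "norm \<dots> \<le> norm (g (x - t) - g x) + norm (f (x - t) - g (x - t)) + norm (f x - g x)"
      by (intro order_trans[OF norm_triangle_ineq4] add_mono norm_triangle_ineq order_refl)
    finally show "norm (f (x - t) - f x) \<le> norm (g (x - t) - g x) + (norm (f (x - t) - g (x - t)) + norm (f x - g x))"
      by simp
  qed (auto intro!: Bochner_Integration.integrable_add integrable_norm Bochner_Integration.integrable_diff)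
  also have "\<dots> = L1_dist_translate g t + ((LINT x|lborel. norm (f (x - t) - g (x - t))) + (LINT x|lborel. norm (f x - g x)))"
    using int integrable_translate[OF int, of t]
    by (subst Bochner_Integration.integral_add) (auto intro!: Bochner_Integration.integral_add)
  finally show ?thesis using integral_translate[of "\<lambda>x. norm (f x - g x)" t] by simp
qed

lemma L1_dist_translate_approx:
  fixes f :: "real \<Rightarrow> 'a :: {banach, second_countable_topology}"
  assumes f: "integrable lborel f"
    and g: "\<And>e::real. e > 0 \<Longrightarrow> \<exists>g. integrable lborel g \<and> (LINT x|lborel. norm (f x - g x)) \<le> e \<and> (\<lambda>n. L1_dist_translate g (t n)) \<longlonglongrightarrow> 0"
  shows "(\<lambda>n::nat. L1_dist_translate f (t n)) \<longlonglongrightarrow> 0"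
proof (rule LIMSEQ_I)
  fix e :: real assume "e > 0"
  then obtain g where g: "integrable lborel g" "(LINT x|lborel. norm (f x - g x)) \<le> e / 4"
    and lim: "(\<lambda>n. L1_dist_translate g (t n)) \<longlonglongrightarrow> 0"
    using g[of "e / 4"] by auto
  obtain N where N: "\<And>n. n \<ge> N \<Longrightarrow> norm (L1_dist_translate g (t n) - 0) < e / 2"
    using LIMSEQ_D[OF lim, of "e / 2"] \<open>e > 0\<close> by auto
  show "\<exists>N. \<forall>n\<ge>N. norm (L1_dist_translate f (t n) - 0) < e"
  proof (intro exI allI impI)
    fix n assume "n \<ge> N"
    then show "norm (L1_dist_translate f (t n) - 0) < e"
      using L1_dist_translate_le[OF f g(1), of "t n"] N[of n] g(2) by simp
  qed
qed

text \<open>For open sets \<open>max (f x - f (x - t)) 0\<close> tends to \<open>0\<close> pointwise, while the part with the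
  opposite sign has the same integral by translation invariance.\<close>

lemma L1_dist_translate_open:
  fixes U :: "real set"
  assumes U: "open U" "emeasure lborel U < \<infinity>" and t: "t \<longlonglongrightarrow> 0"
  shows "(\<lambda>n. L1_dist_translate (indicator U :: real \<Rightarrow> real) (t n)) \<longlonglongrightarrow> 0"
proof -
  let ?f = "indicator U :: real \<Rightarrow> real"
  have [measurable]: "U \<in> sets borel" using U by auto
  have int [simp]: "integrable lborel ?f" using U by auto
  have "L1_dist_translate ?f (t n) = 2 * (LINT x|lborel. max (?f x - ?f (x - t n)) 0)" for n
  proof -
    have i: "integrable lborel (\<lambda>x. max (?f x - ?f (x - t n)) 0)"
      by (intro integrable_max) auto
    have "L1_dist_translate ?f (t n) = (LINT x|lborel. (?f (x - t n) - ?f x) + 2 * max (?f x - ?f (x - t n)) 0)"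
      by (intro Bochner_Integration.integral_cong) (auto simp: indicator_def)
    also have "\<dots> = (LINT x|lborel. ?f (x - t n) - ?f x) + (LINT x|lborel. 2 * max (?f x - ?f (x - t n)) 0)"
      using i by (intro Bochner_Integration.integral_add) auto
    also have "(LINT x|lborel. ?f (x - t n) - ?f x) = 0"
      using integral_translate[of ?f "t n"] by (subst Bochner_Integration.integral_diff) auto
    finally show ?thesis by simp
  qed
  moreover have "(\<lambda>n. LINT x|lborel. max (?f x - ?f (x - t n)) 0) \<longlonglongrightarrow> (LINT x|(lborel :: real measure). (0 :: real))"
  proof (rule integral_dominated_convergence)
    show "AE x in lborel. (\<lambda>n. max (?f x - ?f (x - t n)) 0) \<longlonglongrightarrow> 0"
    proof (intro always_eventually allI)
      fix x
      show "(\<lambda>n. max (?f x - ?f (x - t n)) 0) \<longlonglongrightarrow> 0"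
      proof (cases "x \<in> U")
        case True
        have "(\<lambda>n. x - t n) \<longlonglongrightarrow> x" by (auto intro!: tendsto_eq_intros t)
        then have "\<forall>\<^sub>F n in sequentially. x - t n \<in> U"
          by (rule topological_tendstoD[OF _ U(1) True])
        then have "\<forall>\<^sub>F n in sequentially. max (?f x - ?f (x - t n)) 0 = 0"
          by eventually_elim (use True in auto)
        then show ?thesis by (rule tendsto_eventually)
      qed (auto simp: max_def)
    qed
    show "integrable lborel ?f" by simp
  qed (auto simp: indicator_def)
  ultimately show ?thesis
    using tendsto_mult_right_zero[of "\<lambda>n. LINT x|lborel. max (?f x - ?f (x - t n)) 0" sequentially 2] by simp
qed

text \<open>In place of approximation by continuous functions, the induction for integrable
  functions reduces the claim to indicators, and outer regularity replaces the set by an open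
  one.\<close>

lemma L1_dist_translate_tendsto:
  fixes f :: "real \<Rightarrow> 'a :: {banach, second_countable_topology}"
  assumes "integrable lborel f" and t: "t \<longlonglongrightarrow> 0"
  shows "(\<lambda>n. L1_dist_translate f (t n)) \<longlonglongrightarrow> 0"
  using assms(1)
proof (induction rule: integrable_induct)
  case (base A c)
  let ?A = "\<lambda>x. indicator A x *\<^sub>R c"
  have [measurable]: "A \<in> sets borel" using base by auto
  have intA: "integrable lborel ?A" using base by auto
  show ?case
  proof (rule L1_dist_translate_approx[OF intA])
    fix e :: real assume "e > 0"
    \<comment> \<open>The 1 in the denominator keeps the quotient defined for \<open>c = 0\<close>
      while still giving \<open>e' * norm c \<le> e\<close>.\<close>
    define e' where "e' = e / (norm c + 1)"
    have e': "e' > 0" "e' * norm c \<le> e"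
      using \<open>e > 0\<close> add_nonneg_pos[OF norm_ge_zero[of c] zero_less_one]
      by (auto simp: e'_def divide_simps intro: mult_left_mono)
    obtain U where U: "open U" "A \<subseteq> U" "emeasure lborel (U - A) < e'"
      using outer_regular_lborel[OF _ e'(1), of A] by auto
    have [measurable]: "U \<in> sets borel" using U by auto
    have "emeasure lborel U = emeasure lborel A + emeasure lborel (U - A)"
      using U by (subst plus_emeasure) (auto intro!: arg_cong[where f = "emeasure lborel"])
    also have "\<dots> < \<infinity>" using base U(3) by (auto simp: less_top[symmetric] intro: ennreal_less_top less_trans)
    finally have Ufin: "emeasure lborel U < \<infinity>" .
    let ?U = "\<lambda>x. indicator U x *\<^sub>R c"
    have 1: "integrable lborel ?U" using Ufin by auto
    have "(LINT x|lborel. norm (?A x - ?U x)) = (LINT x|lborel. indicator (U - A) x * norm c)"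
      using U(2) by (intro Bochner_Integration.integral_cong) (auto simp: indicator_def)
    also have "\<dots> = measure lborel (U - A) * norm c" by simp
    also have "\<dots> \<le> e' * norm c"
      unfolding measure_def using U(3) e'(1)
      by (intro mult_right_mono enn2real_leI) (auto intro: less_imp_le)
    finally have 2: "(LINT x|lborel. norm (?A x - ?U x)) \<le> e" using e' by simp
    have "L1_dist_translate ?U (t n) = L1_dist_translate (indicator U :: real \<Rightarrow> real) (t n) * norm c" for n
      by (subst integral_mult_left_zero[symmetric])
         (auto simp: scaleR_diff_left[symmetric] intro!: Bochner_Integration.integral_cong)
    then have "(\<lambda>n. L1_dist_translate ?U (t n)) \<longlonglongrightarrow> 0"
      using tendsto_mult_left_zero[OF L1_dist_translate_open[OF U(1) Ufin t], of "norm c"] by simp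
    with 1 2 show "\<exists>g. integrable lborel g \<and> (LINT x|lborel. norm (?A x - g x)) \<le> e \<and> (\<lambda>n. L1_dist_translate g (t n)) \<longlonglongrightarrow> 0"
      by blast
  qed
next
  case (add f g)
  show ?case
  proof (rule tendsto_sandwich[OF _ _ tendsto_const])
    show "\<forall>\<^sub>F n in sequentially. L1_dist_translate (\<lambda>x. f x + g x) (t n) \<le> L1_dist_translate f (t n) + L1_dist_translate g (t n)"
    proof (intro always_eventually allI)
      fix n
      have "L1_dist_translate (\<lambda>x. f x + g x) (t n) \<le> (LINT x|lborel. norm (f (x - t n) - f x) + norm (g (x - t n) - g x))"
        using add by (intro integral_mono) (auto intro: order_trans[OF _ norm_triangle_ineq] simp: algebra_simps)
      also have "\<dots> = L1_dist_translate f (t n) + L1_dist_translate g (t n)"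
        using add by (intro Bochner_Integration.integral_add) auto
      finally show "L1_dist_translate (\<lambda>x. f x + g x) (t n) \<le> L1_dist_translate f (t n) + L1_dist_translate g (t n)" .
    qed
    show "(\<lambda>n. L1_dist_translate f (t n) + L1_dist_translate g (t n)) \<longlonglongrightarrow> 0"
      using tendsto_add[OF add.IH] by simp
  qed auto
next
  case (lim f s)
  have "(\<lambda>i. LINT x|lborel. norm (f x - s i x)) \<longlonglongrightarrow> (LINT x|(lborel :: real measure). (0 :: real))"
  proof (rule integral_dominated_convergence)
    \<comment> \<open>The approximants satisfy \<open>norm (s i x) \<le> 2 * norm (f x)\<close>,
      hence the factor 3.\<close>
    show "integrable lborel (\<lambda>x. 3 * norm (f x))" using lim by auto
    show "AE x in lborel. norm (norm (f x - s i x)) \<le> 3 * norm (f x)" for i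
    proof (intro always_eventually allI)
      fix x show "norm (norm (f x - s i x)) \<le> 3 * norm (f x)"
        using lim.hyps(3)[of x i] norm_triangle_ineq4[of "f x" "s i x"] by simp
    qed
    show "AE x in lborel. (\<lambda>i. norm (f x - s i x)) \<longlonglongrightarrow> 0"
    proof (intro always_eventually allI)
      fix x show "(\<lambda>i. norm (f x - s i x)) \<longlonglongrightarrow> 0"
        using tendsto_norm[OF tendsto_diff[OF tendsto_const[of "f x"] lim.hyps(2)[of x]]] by simp
    qed
  qed (use lim in auto)
  then have lim0: "(\<lambda>i. LINT x|lborel. norm (f x - s i x)) \<longlonglongrightarrow> 0" by simp
  show ?case
  proof (rule L1_dist_translate_approx[OF lim.hyps(4)])
    fix e :: real assume "e > 0"
    then obtain i where "norm ((LINT x|lborel. norm (f x - s i x)) - 0) < e"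
      using LIMSEQ_D[OF lim0, of e] by auto
    then show "\<exists>g. integrable lborel g \<and> (LINT x|lborel. norm (f x - g x)) \<le> e \<and> (\<lambda>n. L1_dist_translate g (t n)) \<longlonglongrightarrow> 0"
      using lim.hyps(1) lim.IH by (intro exI[of _ "s i"]) auto
  qed
qed

section \<open>Convergence of Gaussian averages in L1\<close>

lemma borel_measurable_gauss_conv [measurable]:
  assumes [measurable]: "f \<in> borel_measurable borel"
  shows "gauss_conv s f \<in> borel_measurable borel"
  unfolding gauss_conv_def[abs_def] by measurable

text \<open>Where the average is not integrable, the Bochner integral takes the default value 0 and
  the bound is trivial; the estimate thus holds at every point for every measurable
  \<open>f\<close>.\<close>

lemma norm_gauss_conv_le:
  assumes [measurable]: "f \<in> borel_measurable borel"
  shows "ennreal (norm (gauss_conv s f x)) \<le> (\<integral>\<^sup>+t. ennreal (std_normal_density t) * ennreal (norm (f (x - s * t))) \<partial>lborel)"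
proof (cases "integrable lborel (\<lambda>t. std_normal_density t *\<^sub>R f (x - s * t))")
  case True
  from integral_norm_bound_ennreal[OF this] show ?thesis
    by (simp add: gauss_conv_def ennreal_mult'')
qed (simp add: gauss_conv_def not_integrable_integral_eq)

lemma norm_gauss_conv_diff_le:
  assumes [measurable]: "f \<in> borel_measurable borel"
  shows "ennreal (norm (gauss_conv s f x - f x)) \<le> (\<integral>\<^sup>+t. ennreal (std_normal_density t) * ennreal (norm (f (x - s * t) - f x)) \<partial>lborel)"
proof (cases "integrable lborel (\<lambda>t. std_normal_density t *\<^sub>R (f (x - s * t) - f x))")
  case True
  have "integrable lborel (\<lambda>t. std_normal_density t *\<^sub>R (f (x - s * t) - f x) + std_normal_density t *\<^sub>R f x)"
    using True by auto
  then have "gauss_conv s f x - f x = (LINT t|lborel. std_normal_density t *\<^sub>R (f (x - s * t) - f x))"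
    by (simp add: gauss_conv_def scaleR_diff_right algebra_simps)
  with integral_norm_bound_ennreal[OF True] show ?thesis
    by (simp add: ennreal_mult'')
next
  \<comment> \<open>Here the left side rests on a default value, but the right side is
    infinite.\<close>
  case False
  then have "(\<integral>\<^sup>+t. ennreal (norm (std_normal_density t *\<^sub>R (f (x - s * t) - f x))) \<partial>lborel) = \<infinity>"
    by (auto simp: integrable_iff_bounded less_top[symmetric])
  then show ?thesis by (simp add: ennreal_mult'')
qed

text \<open>Minkowski's inequality in the form of Tonelli: the L1 error is at most the Gaussian
  average of the translation distances at \<open>s n * t\<close>. These tend to 0 for each
  \<open>t\<close> and never exceed twice the norm of \<open>f\<close>, so dominated convergence
  applies.\<close>

lemma gauss_conv_L1_tendsto:
  assumes f: "integrable lborel f" and s: "s \<longlonglongrightarrow> 0"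
  shows "(\<lambda>n. \<integral>\<^sup>+x. ennreal (norm (gauss_conv (s n) f x - f x)) \<partial>lborel) \<longlonglongrightarrow> 0"
proof -
  have [measurable]: "f \<in> borel_measurable borel" using f by auto
  let ?w = "\<lambda>n t. std_normal_density t * L1_dist_translate f (s n * t)"
  have le2: "L1_dist_translate f u \<le> 2 * (LINT x|lborel. norm (f x))" for u
    using L1_dist_translate_le[OF f integrable_zero, of u] by simp
  have int: "integrable lborel (?w n)" for n
    by (rule Bochner_Integration.integrable_bound[of _ "\<lambda>t. std_normal_density t * (2 * (LINT x|lborel. norm (f x)))"])
       (use le2 in \<open>auto intro!: mult_left_mono simp: abs_mult\<close>)
  have "(\<lambda>n. LINT t|lborel. ?w n t) \<longlonglongrightarrow> (LINT t|(lborel :: real measure). (0 :: real))"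
  proof (rule integral_dominated_convergence)
    show "integrable lborel (\<lambda>t. std_normal_density t * (2 * (LINT x|lborel. norm (f x))))" by auto
    show "AE t in lborel. norm (?w n t) \<le> std_normal_density t * (2 * (LINT x|lborel. norm (f x)))" for n
      using le2 by (auto intro!: mult_left_mono simp: abs_mult)
    show "AE t in lborel. (\<lambda>n. ?w n t) \<longlonglongrightarrow> 0"
      by (intro always_eventually allI tendsto_mult_right_zero L1_dist_translate_tendsto[OF f] tendsto_mult_left_zero s)
  qed auto
  then have lim: "(\<lambda>n. ennreal (LINT t|lborel. ?w n t)) \<longlonglongrightarrow> ennreal 0"
    by (intro tendsto_ennrealI) simp
  have le: "(\<integral>\<^sup>+x. ennreal (norm (gauss_conv (s n) f x - f x)) \<partial>lborel) \<le> ennreal (LINT t|lborel. ?w n t)" for n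
  proof -
    have "(\<integral>\<^sup>+x. ennreal (norm (gauss_conv (s n) f x - f x)) \<partial>lborel)
       \<le> (\<integral>\<^sup>+x. \<integral>\<^sup>+t. ennreal (std_normal_density t) * ennreal (norm (f (x - s n * t) - f x)) \<partial>lborel \<partial>lborel)"
      by (intro nn_integral_mono norm_gauss_conv_diff_le) measurable
    also have "\<dots> = (\<integral>\<^sup>+t. \<integral>\<^sup>+x. ennreal (std_normal_density t) * ennreal (norm (f (x - s n * t) - f x)) \<partial>lborel \<partial>lborel)"
      by (rule lborel_pair.Fubini') measurable
    also have "\<dots> = (\<integral>\<^sup>+t. ennreal (?w n t) \<partial>lborel)"
    proof (intro nn_integral_cong)
      fix t
      have "(\<integral>\<^sup>+x. ennreal (norm (f (x - s n * t) - f x)) \<partial>lborel) = ennreal (L1_dist_translate f (s n * t))"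
        using f by (intro nn_integral_eq_integral) auto
      then show "(\<integral>\<^sup>+x. ennreal (std_normal_density t) * ennreal (norm (f (x - s n * t) - f x)) \<partial>lborel) = ennreal (?w n t)"
        by (subst nn_integral_cmult) (auto simp: ennreal_mult'')
    qed
    also have "\<dots> = ennreal (LINT t|lborel. ?w n t)"
      using int by (intro nn_integral_eq_integral) auto
    finally show ?thesis .
  qed
  show ?thesis
    by (rule tendsto_sandwich[OF _ _ tendsto_const lim[unfolded ennreal_0]]) (auto intro!: always_eventually le)
qed

section \<open>Fourier inversion and the L2 contraction property\<close>

lemma inverse_Suc_tendsto: "(\<lambda>n. inverse (real (Suc n))) \<longlonglongrightarrow> 0"
  by (rule LIMSEQ_inverse_real_of_nat)

lemma gauss_conv_tendsto_fourier:
  assumes f: "integrable lborel f" "integrable lborel (fourier f)"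
  shows "(\<lambda>n. gauss_conv (inverse (real (Suc n))) f x) \<longlonglongrightarrow> fourier (fourier f) (- x)"
proof -
  have [measurable]: "fourier f \<in> borel_measurable borel" using f by auto
  have "(\<lambda>n. LINT \<xi>|lborel. fourier f \<xi> * (gauss_hat (inverse (real (Suc n))) \<xi> * cis (2 * pi * \<xi> * x)))
      \<longlonglongrightarrow> (LINT \<xi>|lborel. fourier f \<xi> * (complex_of_real 1 * cis (2 * pi * \<xi> * x)))"
  proof (rule integral_dominated_convergence)
    show "integrable lborel (\<lambda>\<xi>. norm (fourier f \<xi>))" using f by auto
    show "AE \<xi> in lborel. (\<lambda>n. fourier f \<xi> * (gauss_hat (inverse (real (Suc n))) \<xi> * cis (2 * pi * \<xi> * x)))
      \<longlonglongrightarrow> fourier f \<xi> * (complex_of_real 1 * cis (2 * pi * \<xi> * x))"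
      by (intro always_eventually allI tendsto_intros gauss_hat_tendsto inverse_Suc_tendsto)
    show "AE \<xi> in lborel. norm (fourier f \<xi> * (gauss_hat (inverse (real (Suc n))) \<xi> * cis (2 * pi * \<xi> * x))) \<le> norm (fourier f \<xi>)" for n
      by (auto simp: norm_mult intro!: mult_left_le)
  qed auto
  then show ?thesis
    using f by (simp add: gauss_conv_fourier fourier_lborel[of "fourier f"] mult_ac)
qed

text \<open>The Gaussian averages converge pointwise to the inversion integral and in L1 to
  \<open>f\<close>. Fatou's lemma identifies the two limits without extracting a
  subsequence.\<close>

lemma fourier_inversion_AE:
  assumes f: "integrable lborel f" "integrable lborel (fourier f)"
  shows "AE x in lborel. f x = fourier (fourier f) (- x)"
proof -
  have [measurable]: "f \<in> borel_measurable borel" "fourier (fourier f) \<in> borel_measurable borel"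
    using f borel_measurable_fourier by auto
  let ?g = "\<lambda>n. gauss_conv (inverse (real (Suc n))) f"
  have "(\<integral>\<^sup>+x. ennreal (norm (fourier (fourier f) (- x) - f x)) \<partial>lborel)
      = (\<integral>\<^sup>+x. liminf (\<lambda>n. ennreal (norm (?g n x - f x))) \<partial>lborel)"
  proof (intro nn_integral_cong)
    fix x
    have "(\<lambda>n. ennreal (norm (?g n x - f x))) \<longlonglongrightarrow> ennreal (norm (fourier (fourier f) (- x) - f x))"
      by (intro tendsto_ennrealI tendsto_intros gauss_conv_tendsto_fourier f)
    then show "ennreal (norm (fourier (fourier f) (- x) - f x)) = liminf (\<lambda>n. ennreal (norm (?g n x - f x)))"
      using lim_imp_Liminf[OF sequentially_bot] by metis
  qed
  also have "\<dots> \<le> liminf (\<lambda>n. \<integral>\<^sup>+x. ennreal (norm (?g n x - f x)) \<partial>lborel)"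
    by (rule nn_integral_liminf) measurable
  also have "\<dots> = 0"
    by (intro lim_imp_Liminf gauss_conv_L1_tendsto f inverse_Suc_tendsto) auto
  finally show ?thesis
    by (subst (asm) le_zero_eq, subst (asm) nn_integral_0_iff_AE) (measurable, auto elim: eventually_mono)
qed

lemma fourier_inversion:
  assumes f: "integrable lborel f" "integrable lborel (fourier f)"
    and "\<And>x. norm (f x) \<le> B" "isCont f x"
  shows "f x = fourier (fourier f) (- x)"
proof -
  have "(\<lambda>n. gauss_conv (inverse (real (Suc n))) f x) \<longlonglongrightarrow> f x"
    using assms by (intro gauss_conv_tendsto inverse_Suc_tendsto) auto
  then show ?thesis using LIMSEQ_unique gauss_conv_tendsto_fourier[OF f] by blast
qed

text \<open>The Gaussian weight makes the squared transform integrable, and the multiplication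
  formula turns its integral into a pairing of \<open>f\<close> with its own Gaussian average. That
  pairing is dominated by an average of the products
  \<open>norm (f x) * norm (f (x - s * t))\<close>, each at most half the sum of the two squares.
  The estimate runs with nonnegative integrals, so \<open>f\<close> may have infinite L2
  norm.\<close>

lemma nn_integral_norm_fourier_gauss:
  assumes f: "integrable lborel f" and s: "s > 0"
  shows "(\<integral>\<^sup>+\<xi>. ennreal ((norm (fourier f \<xi>))\<^sup>2 * gauss_hat s \<xi>) \<partial>lborel) \<le> (\<integral>\<^sup>+x. ennreal ((norm (f x))\<^sup>2) \<partial>lborel)"
proof -
  have [measurable]: "f \<in> borel_measurable borel" "fourier f \<in> borel_measurable borel"
    using f borel_measurable_fourier by auto
  let ?B = "LINT x|lborel. norm (f x)"
  \<comment> \<open>Conjugation is built into the second factor, so that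
    \<open>fourier f \<xi> * ?g \<xi>\<close> is the weighted square; the transform of
    \<open>?g\<close> is then the conjugate of a Gaussian average.\<close>
  let ?g = "\<lambda>\<xi>. cnj (fourier f \<xi>) * gauss_hat s \<xi>"
  have "integrable lborel (\<lambda>\<xi>. ?B * gauss_hat s \<xi>)"
    using integrable_gauss_hat[OF s] by auto
  then have intg: "integrable lborel ?g"
    by (rule Bochner_Integration.integrable_bound)
       (auto simp: norm_mult abs_mult intro!: mult_right_mono order_trans[OF norm_fourier_le[OF f]])
  have int: "integrable lborel (\<lambda>\<xi>. (norm (fourier f \<xi>))\<^sup>2 * gauss_hat s \<xi>)"
  proof (rule Bochner_Integration.integrable_bound)
    show "integrable lborel (\<lambda>\<xi>. ?B\<^sup>2 * gauss_hat s \<xi>)"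
      using integrable_gauss_hat[OF s] by auto
  qed (auto simp: norm_mult abs_mult intro!: mult_right_mono power_mono order_trans[OF norm_fourier_le[OF f]])
  have g: "fourier ?g x = cnj (gauss_conv s f x)" for x
  proof -
    have "fourier ?g x = (LINT \<xi>|lborel. cnj (fourier f \<xi> * (gauss_hat s \<xi> * cis (2 * pi * \<xi> * x))))"
      by (subst fourier_lborel) (auto intro!: Bochner_Integration.integral_cong simp: cis_cnj mult_ac)
    also have "\<dots> = cnj (gauss_conv s f x)"
      by (simp only: gauss_conv_fourier[OF s f] Bochner_Integration.integral_cnj)
    finally show ?thesis .
  qed
  have "(\<integral>\<^sup>+\<xi>. ennreal ((norm (fourier f \<xi>))\<^sup>2 * gauss_hat s \<xi>) \<partial>lborel)
      = ennreal (LINT \<xi>|lborel. (norm (fourier f \<xi>))\<^sup>2 * gauss_hat s \<xi>)"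
    using int by (intro nn_integral_eq_integral) auto
  also have "(LINT \<xi>|lborel. (norm (fourier f \<xi>))\<^sup>2 * gauss_hat s \<xi>)
      = norm (complex_of_real (LINT \<xi>|lborel. (norm (fourier f \<xi>))\<^sup>2 * gauss_hat s \<xi>))"
    by (simp add: integral_nonneg_AE)
  also have "complex_of_real (LINT \<xi>|lborel. (norm (fourier f \<xi>))\<^sup>2 * gauss_hat s \<xi>)
      = (LINT \<xi>|lborel. fourier f \<xi> * ?g \<xi>)"
    unfolding integral_complex_of_real[symmetric]
    by (intro Bochner_Integration.integral_cong) (auto simp: complex_norm_square mult_ac simp del: of_real_power)
  also have "\<dots> = (LINT x|lborel. f x * cnj (gauss_conv s f x))"
    by (simp only: integral_fourier_mult[OF f intg] g)
  also have "ennreal (norm \<dots>) \<le> (\<integral>\<^sup>+x. ennreal (norm (f x)) * ennreal (norm (gauss_conv s f x)) \<partial>lborel)"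
  proof -
    have "integrable lborel (\<lambda>x. f x * cnj (gauss_conv s f x))"
    proof (rule Bochner_Integration.integrable_bound)
      show "integrable lborel (\<lambda>x. norm (f x) * (LINT \<xi>|lborel. norm (?g \<xi>)))" using f by auto
      show "AE x in lborel. norm (f x * cnj (gauss_conv s f x)) \<le> norm (norm (f x) * (LINT \<xi>|lborel. norm (?g \<xi>)))"
        using norm_fourier_le[OF intg] by (auto simp: norm_mult g[symmetric] abs_mult intro!: mult_left_mono simp del: complex_cnj_mult)
    qed measurable
    from integral_norm_bound_ennreal[OF this] show ?thesis
      by (simp add: norm_mult ennreal_mult'')
  qed
  also have "\<dots> \<le> (\<integral>\<^sup>+x. ennreal (norm (f x)) * (\<integral>\<^sup>+t. ennreal (std_normal_density t) * ennreal (norm (f (x - s * t))) \<partial>lborel) \<partial>lborel)"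
    by (intro nn_integral_mono mult_left_mono norm_gauss_conv_le) auto
  also have "\<dots> = (\<integral>\<^sup>+x. \<integral>\<^sup>+t. ennreal (norm (f x)) * (ennreal (std_normal_density t) * ennreal (norm (f (x - s * t)))) \<partial>lborel \<partial>lborel)"
    by (intro nn_integral_cong nn_integral_cmult[symmetric]) measurable
  also have "\<dots> \<le> (\<integral>\<^sup>+x. \<integral>\<^sup>+t. ennreal (std_normal_density t) * ennreal ((norm (f x))\<^sup>2 / 2) + ennreal (std_normal_density t) * ennreal ((norm (f (x - s * t)))\<^sup>2 / 2) \<partial>lborel \<partial>lborel)"
  proof (intro nn_integral_mono)
    fix x t
    have "norm (f x) * norm (f (x - s * t)) \<le> (norm (f x))\<^sup>2 / 2 + (norm (f (x - s * t)))\<^sup>2 / 2"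
      using sum_squares_bound[of "norm (f x)" "norm (f (x - s * t))"] by (simp add: field_simps)
    then have "std_normal_density t * (norm (f x) * norm (f (x - s * t))) \<le> std_normal_density t * ((norm (f x))\<^sup>2 / 2 + (norm (f (x - s * t)))\<^sup>2 / 2)"
      by (intro mult_left_mono) auto
    then show "ennreal (norm (f x)) * (ennreal (std_normal_density t) * ennreal (norm (f (x - s * t))))
        \<le> ennreal (std_normal_density t) * ennreal ((norm (f x))\<^sup>2 / 2) + ennreal (std_normal_density t) * ennreal ((norm (f (x - s * t)))\<^sup>2 / 2)"
      by (simp add: ennreal_mult[symmetric] ennreal_plus[symmetric] algebra_simps del: ennreal_plus)
  qed
  also have "\<dots> = (\<integral>\<^sup>+x. \<integral>\<^sup>+t. ennreal (std_normal_density t) * ennreal ((norm (f x))\<^sup>2 / 2) \<partial>lborel \<partial>lborel)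
      + (\<integral>\<^sup>+x. \<integral>\<^sup>+t. ennreal (std_normal_density t) * ennreal ((norm (f (x - s * t)))\<^sup>2 / 2) \<partial>lborel \<partial>lborel)"
    by (simp add: nn_integral_add)
  also have "(\<integral>\<^sup>+x. \<integral>\<^sup>+t. ennreal (std_normal_density t) * ennreal ((norm (f (x - s * t)))\<^sup>2 / 2) \<partial>lborel \<partial>lborel)
      = (\<integral>\<^sup>+t. \<integral>\<^sup>+x. ennreal (std_normal_density t) * ennreal ((norm (f (x - s * t)))\<^sup>2 / 2) \<partial>lborel \<partial>lborel)"
    by (rule lborel_pair.Fubini'[symmetric]) measurable
  also have "\<dots> = (\<integral>\<^sup>+t. ennreal (std_normal_density t) * (\<integral>\<^sup>+x. ennreal ((norm (f x))\<^sup>2 / 2) \<partial>lborel) \<partial>lborel)"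
    by (intro nn_integral_cong) (subst nn_integral_cmult, measurable, subst nn_integral_translate[symmetric], auto)
  also have "\<dots> = (\<integral>\<^sup>+x. ennreal ((norm (f x))\<^sup>2 / 2) \<partial>lborel)"
    by (simp add: nn_integral_multc nn_integral_eq_integral)
  also have "(\<integral>\<^sup>+x. \<integral>\<^sup>+t. ennreal (std_normal_density t) * ennreal ((norm (f x))\<^sup>2 / 2) \<partial>lborel \<partial>lborel) = (\<integral>\<^sup>+x. ennreal ((norm (f x))\<^sup>2 / 2) \<partial>lborel)"
    by (simp add: nn_integral_multc nn_integral_eq_integral)
  also have "(\<integral>\<^sup>+x. ennreal ((norm (f x))\<^sup>2 / 2) \<partial>lborel) + (\<integral>\<^sup>+x. ennreal ((norm (f x))\<^sup>2 / 2) \<partial>lborel)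
     = (\<integral>\<^sup>+x. ennreal ((norm (f x))\<^sup>2) \<partial>lborel)"
    by (subst nn_integral_add[symmetric]) (auto simp: ennreal_plus[symmetric] simp del: ennreal_plus)
  finally show ?thesis .
qed

text \<open>Fatou's lemma removes the Gaussian weight. Where the reverse inequality is wanted, this
  one is applied to \<open>fourier f\<close> and combined with inversion.\<close>

lemma fourier_L2_le:
  assumes f: "integrable lborel f"
  shows "(\<integral>\<^sup>+\<xi>. ennreal ((norm (fourier f \<xi>))\<^sup>2) \<partial>lborel) \<le> (\<integral>\<^sup>+x. ennreal ((norm (f x))\<^sup>2) \<partial>lborel)"
proof -
  have [measurable]: "fourier f \<in> borel_measurable borel"
    using f borel_measurable_fourier by auto
  let ?s = "\<lambda>n. inverse (real (Suc n))"
  have "(\<integral>\<^sup>+\<xi>. ennreal ((norm (fourier f \<xi>))\<^sup>2) \<partial>lborel)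
      = (\<integral>\<^sup>+\<xi>. liminf (\<lambda>n. ennreal ((norm (fourier f \<xi>))\<^sup>2 * gauss_hat (?s n) \<xi>)) \<partial>lborel)"
  proof (intro nn_integral_cong)
    fix \<xi>
    have "(\<lambda>n. ennreal ((norm (fourier f \<xi>))\<^sup>2 * gauss_hat (?s n) \<xi>)) \<longlonglongrightarrow> ennreal ((norm (fourier f \<xi>))\<^sup>2 * 1)"
      by (intro tendsto_ennrealI tendsto_intros gauss_hat_tendsto inverse_Suc_tendsto)
    then show "ennreal ((norm (fourier f \<xi>))\<^sup>2) = liminf (\<lambda>n. ennreal ((norm (fourier f \<xi>))\<^sup>2 * gauss_hat (?s n) \<xi>))"
      using lim_imp_Liminf[OF sequentially_bot] by fastforce
  qed
  also have "\<dots> \<le> liminf (\<lambda>n. \<integral>\<^sup>+\<xi>. ennreal ((norm (fourier f \<xi>))\<^sup>2 * gauss_hat (?s n) \<xi>) \<partial>lborel)"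
    by (rule nn_integral_liminf) measurable
  also have "\<dots> \<le> limsup (\<lambda>n. \<integral>\<^sup>+\<xi>. ennreal ((norm (fourier f \<xi>))\<^sup>2 * gauss_hat (?s n) \<xi>) \<partial>lborel)"
    by (rule Liminf_le_Limsup) simp
  also have "\<dots> \<le> (\<integral>\<^sup>+x. ennreal ((norm (f x))\<^sup>2) \<partial>lborel)"
    by (intro Limsup_bounded always_eventually allI nn_integral_norm_fourier_gauss f) auto
  finally show ?thesis .
qed

section \<open>The Fourier transform on square integrable functions\<close>

text \<open>The square of the L2 norm with values in \<open>ennreal\<close>: it is meaningful
  without integrability, and the value infinity marks functions outside L2.\<close>

definition sqnorm :: "'a measure \<Rightarrow> ('a \<Rightarrow> complex) \<Rightarrow> ennreal" where
  "sqnorm M f = (\<integral>\<^sup>+x. ennreal ((norm (f x))\<^sup>2) \<partial>M)"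

lemma sqnorm_lebesgue [simp]: "sqnorm lebesgue f = sqnorm lborel f"
  by (simp add: sqnorm_def nn_integral_completion)

lemma sqnorm_cong_AE: "AE x in M. f x = g x \<Longrightarrow> sqnorm M f = sqnorm M g"
  unfolding sqnorm_def by (intro nn_integral_cong_AE) (auto elim: eventually_mono)

lemma sqnorm_mono_AE: "AE x in M. norm (f x) \<le> norm (g x) \<Longrightarrow> sqnorm M f \<le> sqnorm M g"
  unfolding sqnorm_def
  by (intro nn_integral_mono_AE) (auto elim!: eventually_mono intro!: ennreal_leI power_mono)

lemma sqnorm_diff_commute: "sqnorm M (\<lambda>x. f x - g x) = sqnorm M (\<lambda>x. g x - f x)"
  by (simp add: sqnorm_def norm_minus_commute)

lemma sqnorm_cmult:
  assumes [measurable]: "f \<in> borel_measurable M"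
  shows "sqnorm M (\<lambda>x. c * f x) = ennreal ((norm c)\<^sup>2) * sqnorm M f"
  unfolding sqnorm_def by (subst nn_integral_cmult[symmetric]) (auto simp: norm_mult power_mult_distrib ennreal_mult'')

lemma sqnorm_eq_0_iff:
  assumes [measurable]: "f \<in> borel_measurable M"
  shows "sqnorm M f = 0 \<longleftrightarrow> (AE x in M. f x = 0)"
  unfolding sqnorm_def by (subst nn_integral_0_iff_AE) auto

text \<open>An elementary inequality for squares replaces Minkowski's. The constant 2 is harmless,
  as the lemma serves limits, Cauchy sequences and finiteness.\<close>

lemma sqnorm_add_le:
  assumes [measurable]: "f \<in> borel_measurable M" "g \<in> borel_measurable M"
  shows "sqnorm M (\<lambda>x. f x + g x) \<le> 2 * sqnorm M f + 2 * sqnorm M g"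
proof -
  have "(norm (f x + g x))\<^sup>2 \<le> 2 * (norm (f x))\<^sup>2 + 2 * (norm (g x))\<^sup>2" for x
  proof -
    have "(norm (f x + g x))\<^sup>2 \<le> (norm (f x) + norm (g x))\<^sup>2"
      by (intro power_mono norm_triangle_ineq) auto
    also have "\<dots> \<le> 2 * (norm (f x))\<^sup>2 + 2 * (norm (g x))\<^sup>2"
      using sum_squares_bound[of "norm (f x)" "norm (g x)"] by (simp add: power2_sum)
    finally show ?thesis .
  qed
  then have "sqnorm M (\<lambda>x. f x + g x) \<le> (\<integral>\<^sup>+x. 2 * ennreal ((norm (f x))\<^sup>2) + 2 * ennreal ((norm (g x))\<^sup>2) \<partial>M)"
    unfolding sqnorm_def
    by (intro nn_integral_mono) (simp add: ennreal_mult'[symmetric] ennreal_plus[symmetric] ennreal_numeral[symmetric] del: ennreal_plus ennreal_numeral)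
  also have "\<dots> = 2 * sqnorm M f + 2 * sqnorm M g"
    unfolding sqnorm_def by (simp add: nn_integral_add nn_integral_cmult)
  finally show ?thesis .
qed

lemma sqnorm_diff_le:
  assumes [measurable]: "f \<in> borel_measurable M" "g \<in> borel_measurable M" "h \<in> borel_measurable M"
  shows "sqnorm M (\<lambda>x. f x - g x) \<le> 2 * sqnorm M (\<lambda>x. h x - f x) + 2 * sqnorm M (\<lambda>x. h x - g x)"
proof -
  have "sqnorm M (\<lambda>x. (f x - h x) + (h x - g x)) \<le> 2 * sqnorm M (\<lambda>x. f x - h x) + 2 * sqnorm M (\<lambda>x. h x - g x)"
    by (intro sqnorm_add_le) auto
  then show ?thesis by (simp add: sqnorm_diff_commute[of M f h])
qed

lemma sqnorm_limit_unique:
  assumes "\<And>n. a n \<in> borel_measurable M" "f \<in> borel_measurable M" "g \<in> borel_measurable M"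
    and f: "(\<lambda>n. sqnorm M (\<lambda>x. a n x - f x)) \<longlonglongrightarrow> 0"
    and g: "(\<lambda>n. sqnorm M (\<lambda>x. a n x - g x)) \<longlonglongrightarrow> 0"
  shows "AE x in M. f x = g x"
proof -
  have "(\<lambda>n. 2 * sqnorm M (\<lambda>x. a n x - f x) + 2 * sqnorm M (\<lambda>x. a n x - g x)) \<longlonglongrightarrow> 2 * 0 + 2 * 0"
    by (intro tendsto_add ennreal_tendsto_cmult f g) auto
  moreover have "sqnorm M (\<lambda>x. f x - g x) \<le> 2 * sqnorm M (\<lambda>x. a n x - f x) + 2 * sqnorm M (\<lambda>x. a n x - g x)" for n
    using assms by (intro sqnorm_diff_le) auto
  ultimately have "sqnorm M (\<lambda>x. f x - g x) \<le> 2 * 0 + 2 * 0"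
    by (intro tendsto_lowerbound[OF _ always_eventually]) auto
  then have "AE x in M. f x - g x = 0"
    using assms by (subst sqnorm_eq_0_iff[symmetric]) auto
  then show ?thesis by simp
qed

lemma sqnorm_tendsto_le:
  assumes [measurable]: "\<And>n. a n \<in> borel_measurable M"
    and lim: "AE x in M. (\<lambda>n. a n x) \<longlonglongrightarrow> f x" and bd: "\<And>n::nat. n \<ge> N \<Longrightarrow> sqnorm M (a n) \<le> B"
  shows "sqnorm M f \<le> B"
proof -
  have "sqnorm M f = (\<integral>\<^sup>+x. liminf (\<lambda>n. ennreal ((norm (a n x))\<^sup>2)) \<partial>M)"
    unfolding sqnorm_def
  proof (intro nn_integral_cong_AE, use lim in eventually_elim)
    case (elim x)
    then have "(\<lambda>n. ennreal ((norm (a n x))\<^sup>2)) \<longlonglongrightarrow> ennreal ((norm (f x))\<^sup>2)"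
      by (intro tendsto_ennrealI tendsto_intros)
    then show ?case using lim_imp_Liminf[OF sequentially_bot] by metis
  qed
  also have "\<dots> \<le> liminf (\<lambda>n. sqnorm M (a n))"
    unfolding sqnorm_def by (rule nn_integral_liminf) measurable
  also have "\<dots> \<le> limsup (\<lambda>n. sqnorm M (a n))"
    by (rule Liminf_le_Limsup) simp
  also have "\<dots> \<le> B"
    by (intro Limsup_bounded eventually_sequentiallyI[of N] bd)
  finally show ?thesis .
qed

text \<open>The theorem of Riesz and Fischer. The almost everywhere convergent subsequence belongs
  to the conclusion, since pointwise bounds pass to the limit along it.\<close>

lemma L2_complete:
  fixes f :: "nat \<Rightarrow> 'a \<Rightarrow> complex"
  assumes [measurable]: "\<And>n. f n \<in> borel_measurable M"
    and cauchy: "\<And>e::real. e > 0 \<Longrightarrow> \<exists>N. \<forall>m\<ge>N. \<forall>n\<ge>N. sqnorm M (\<lambda>x. f m x - f n x) \<le> ennreal e"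
  obtains g r where "g \<in> borel_measurable M" "strict_mono (r :: nat \<Rightarrow> nat)"
    "AE x in M. (\<lambda>k. f (r k) x) \<longlonglongrightarrow> g x" "(\<lambda>n. sqnorm M (\<lambda>x. f n x - g x)) \<longlonglongrightarrow> 0"
proof -
  \<comment> \<open>The rate is chosen so that the weight \<open>4 ^ k\<close> still leaves the
    summable terms \<open>(1 / 4) ^ k\<close>; finiteness of the weighted sum then forces
    \<open>norm (?d k x) \<le> (1 / 2) ^ k\<close> eventually.\<close>
  have "\<exists>N. \<forall>m\<ge>N. \<forall>n\<ge>N. sqnorm M (\<lambda>x. f m x - f n x) \<le> ennreal ((1 / 16) ^ k)" for k
    by (rule cauchy) simp
  then obtain N where N: "\<And>k m n. m \<ge> N k \<Longrightarrow> n \<ge> N k \<Longrightarrow> sqnorm M (\<lambda>x. f m x - f n x) \<le> ennreal ((1 / 16) ^ k)"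
    by metis
  \<comment> \<open>The summand \<open>k\<close> makes \<open>r\<close> strictly increasing, the sum
    makes it dominate \<open>N k\<close>.\<close>
  define r where "r k = k + (\<Sum>i\<le>k. N i)" for k
  have r: "strict_mono r" by (intro strict_monoI_Suc) (simp add: r_def)
  have rN: "r k \<ge> N k" for k
    using member_le_sum[of k "{..k}" N] by (simp add: r_def)
  let ?d = "\<lambda>k x. f (r (Suc k)) x - f (r k) x"
  have d: "sqnorm M (?d k) \<le> ennreal ((1 / 16) ^ k)" for k
    by (intro N rN order_trans[OF rN]) (use r in \<open>auto simp: strict_mono_less_eq\<close>)
  have "(\<integral>\<^sup>+x. (\<Sum>k. ennreal (4 ^ k * (norm (?d k x))\<^sup>2)) \<partial>M) = (\<Sum>k. \<integral>\<^sup>+x. ennreal (4 ^ k * (norm (?d k x))\<^sup>2) \<partial>M)"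
    by (rule nn_integral_suminf) measurable
  also have "\<dots> \<le> (\<Sum>k. ennreal ((1 / 4) ^ k))"
  proof (intro suminf_le allI)
    fix k
    have "(\<integral>\<^sup>+x. ennreal (4 ^ k * (norm (?d k x))\<^sup>2) \<partial>M) = ennreal (4 ^ k) * sqnorm M (?d k)"
      unfolding sqnorm_def by (subst nn_integral_cmult[symmetric]) (auto simp: ennreal_mult'')
    also have "\<dots> \<le> ennreal (4 ^ k) * ennreal ((1 / 16) ^ k)"
      by (intro mult_left_mono d) auto
    also have "\<dots> = ennreal ((1 / 4) ^ k)"
      by (simp add: ennreal_mult[symmetric] power_mult_distrib[symmetric])
    finally show "(\<integral>\<^sup>+x. ennreal (4 ^ k * (norm (?d k x))\<^sup>2) \<partial>M) \<le> ennreal ((1 / 4) ^ k)" .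
  qed auto
  also have "\<dots> = ennreal (\<Sum>k. (1 / 4) ^ k)"
    by (intro suminf_ennreal2) (auto intro: summable_geometric)
  also have "\<dots> < \<infinity>" by simp
  finally have "AE x in M. (\<Sum>k. ennreal (4 ^ k * (norm (?d k x))\<^sup>2)) \<noteq> \<infinity>"
    by (intro nn_integral_PInf_AE) auto
  then have conv: "AE x in M. convergent (\<lambda>k. f (r k) x)"
  proof eventually_elim
    case (elim x)
    then have "summable (\<lambda>k. 4 ^ k * (norm (?d k x))\<^sup>2)"
      by (intro summable_suminf_not_top) auto
    then have "(\<lambda>k. 4 ^ k * (norm (?d k x))\<^sup>2) \<longlonglongrightarrow> 0"
      by (rule summable_LIMSEQ_zero)
    then have "\<forall>\<^sub>F k in sequentially. 4 ^ k * (norm (?d k x))\<^sup>2 < 1"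
      by (rule order_tendstoD) simp
    then have "\<forall>\<^sub>F k in sequentially. norm (?d k x) \<le> (1 / 2) ^ k"
    proof eventually_elim
      case (elim k)
      have "(2 ^ k * norm (?d k x))\<^sup>2 < 1\<^sup>2"
        using elim by (simp add: power_mult_distrib power_mult[symmetric] mult.commute[of k 2]) (simp add: power_mult)
      then have "2 ^ k * norm (?d k x) < 1"
        by (rule power2_less_imp_less) simp
      then show ?case by (simp add: field_simps power_one_over)
    qed
    then have "summable (\<lambda>k. ?d k x)"
      by (rule summable_comparison_test_ev) (auto intro: summable_geometric)
    then have "convergent (\<lambda>n. \<Sum>k<n. ?d k x)"
      by (simp add: summable_iff_convergent)
    then have "convergent (\<lambda>n. f (r n) x - f (r 0) x)"
      by (simp add: sum_lessThan_telescope[of "\<lambda>n. f (r n) x"])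
    then have "convergent (\<lambda>n. f (r n) x - f (r 0) x + f (r 0) x)"
      by (intro convergent_add convergent_const)
    then show ?case by simp
  qed
  define g where "g x = lim (\<lambda>k. f (r k) x)" for x
  have g [measurable]: "g \<in> borel_measurable M"
    unfolding g_def[abs_def] by (rule borel_measurable_lim_metric) auto
  have lim: "AE x in M. (\<lambda>k. f (r k) x) \<longlonglongrightarrow> g x"
    using conv by eventually_elim (simp add: g_def convergent_LIMSEQ_iff)
  show thesis
  proof (rule that[OF g r lim])
    show "(\<lambda>n. sqnorm M (\<lambda>x. f n x - g x)) \<longlonglongrightarrow> 0"
    proof (rule tendsto_0_if_Limsup_eq_0_ennreal, rule antisym)
      show "limsup (\<lambda>n. sqnorm M (\<lambda>x. f n x - g x)) \<le> 0"
      proof (rule ennreal_le_epsilon)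
        fix e :: real assume "e > 0"
        then obtain K where K: "\<And>m n. m \<ge> K \<Longrightarrow> n \<ge> K \<Longrightarrow> sqnorm M (\<lambda>x. f m x - f n x) \<le> ennreal e"
          using cauchy by meson
        have "sqnorm M (\<lambda>x. f n x - g x) \<le> ennreal e" if "n \<ge> K" for n
        proof (rule sqnorm_tendsto_le)
          show "AE x in M. (\<lambda>k. f n x - f (r k) x) \<longlonglongrightarrow> f n x - g x"
            using lim by eventually_elim (intro tendsto_intros)
          show "sqnorm M (\<lambda>x. f n x - f (r k) x) \<le> ennreal e" if "k \<ge> K" for k
            using K[of n "r k"] \<open>n \<ge> K\<close> that seq_suble[OF r, of k] by simp
        qed auto
        then show "limsup (\<lambda>n. sqnorm M (\<lambda>x. f n x - g x)) \<le> 0 + ennreal e"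
          by (intro Limsup_bounded eventually_sequentiallyI[of K]) auto
      qed
    qed simp
  qed
qed

section \<open>Extension of the Fourier transform to L2 by truncation\<close>

definition truncate :: "(real \<Rightarrow> complex) \<Rightarrow> nat \<Rightarrow> real \<Rightarrow> complex" where
  "truncate f j = (\<lambda>x. indicator {- real j..real j} x * f x)"

lemma borel_measurable_lebesgueI:
  fixes f :: "real \<Rightarrow> 'a::topological_space"
  shows "f \<in> borel_measurable borel \<Longrightarrow> f \<in> borel_measurable lebesgue"
  by (rule measurable_completion) simp

lemma borel_measurable_truncate [measurable]:
  "f \<in> borel_measurable borel \<Longrightarrow> truncate f j \<in> borel_measurable borel"
  unfolding truncate_def by measurable

lemma borel_measurable_truncate_lebesgue:
  "f \<in> borel_measurable lebesgue \<Longrightarrow> truncate f j \<in> borel_measurable lebesgue"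
  unfolding truncate_def
  by (intro borel_measurable_times borel_measurable_indicator) auto

lemma fourier_truncate_cong:
  assumes "f \<in> borel_measurable lebesgue" "g \<in> borel_measurable lebesgue" "AE x in lborel. f x = g x"
  shows "fourier (truncate f j) = fourier (truncate g j)"
proof (rule fourier_cong_AE)
  show "AE x in lborel. truncate f j x = truncate g j x"
    using assms(3) by eventually_elim (simp add: truncate_def)
qed (intro borel_measurable_truncate_lebesgue assms)+

lemma integrable_truncate:
  assumes [measurable]: "f \<in> borel_measurable borel" and f: "sqnorm lborel f < \<infinity>"
  shows "integrable lborel (truncate f j)"
proof (rule integrableI_bounded)
  have "(\<integral>\<^sup>+x. ennreal (norm (truncate f j x)) \<partial>lborel) \<le> (\<integral>\<^sup>+x. indicator {- real j..real j} x + ennreal ((norm (f x))\<^sup>2) \<partial>lborel)"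
  proof (intro nn_integral_mono)
    fix x
    have "norm (f x) \<le> 1 + (norm (f x))\<^sup>2"
      using sum_squares_bound[of 1 "norm (f x)"] norm_ge_zero[of "f x"] unfolding power_one by linarith
    then have "ennreal (norm (f x)) \<le> 1 + ennreal ((norm (f x))\<^sup>2)"
      by (simp add: ennreal_plus[symmetric] ennreal_1[symmetric] del: ennreal_plus ennreal_1)
    then show "ennreal (norm (truncate f j x)) \<le> indicator {- real j..real j} x + ennreal ((norm (f x))\<^sup>2)"
      by (simp add: truncate_def indicator_def)
  qed
  also have "\<dots> = ennreal (2 * real j) + sqnorm lborel f"
    unfolding sqnorm_def by (subst nn_integral_add) auto
  also have "\<dots> < \<infinity>" using f by simp
  finally show "(\<integral>\<^sup>+x. ennreal (norm (truncate f j x)) \<partial>lborel) < \<infinity>" .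
qed measurable

lemma sqnorm_fourier_diff_le:
  assumes "integrable lborel f" "integrable lborel g"
  shows "sqnorm lborel (\<lambda>x. fourier f x - fourier g x) \<le> sqnorm lborel (\<lambda>x. f x - g x)"
proof -
  have [measurable]: "f \<in> borel_measurable borel" "g \<in> borel_measurable borel" using assms by auto
  have "fourier f x - fourier g x = fourier (\<lambda>x. f x - g x) x" for x
    using assms by (simp add: fourier_lborel left_diff_distrib)
  then show ?thesis
    using fourier_L2_le[of "\<lambda>x. f x - g x"] assms by (simp add: sqnorm_def)
qed

lemma truncate_tendsto:
  assumes [measurable]: "f \<in> borel_measurable borel" and f: "sqnorm lborel f < \<infinity>"
  shows "(\<lambda>j. sqnorm lborel (\<lambda>x. truncate f j x - f x)) \<longlonglongrightarrow> 0"
proof -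
  have "(\<lambda>j. sqnorm lborel (\<lambda>x. truncate f j x - f x)) \<longlonglongrightarrow> (\<integral>\<^sup>+x. 0 \<partial>(lborel :: real measure))"
    unfolding sqnorm_def
  proof (rule nn_integral_dominated_convergence[where w = "\<lambda>x. ennreal ((norm (f x))\<^sup>2)"])
    show "AE x in lborel. (\<lambda>j. ennreal ((norm (truncate f j x - f x))\<^sup>2)) \<longlonglongrightarrow> 0"
    proof (intro always_eventually allI, rule tendsto_eventually)
      fix x :: real
      obtain N where "\<bar>x\<bar> \<le> real N" using real_arch_simple by blast
      then have "truncate f j x - f x = 0" if "j \<ge> N" for j
        using that by (auto simp: truncate_def indicator_def abs_le_iff)
      then show "\<forall>\<^sub>F j in sequentially. ennreal ((norm (truncate f j x - f x))\<^sup>2) = 0"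
        by (auto intro!: eventually_sequentiallyI[of N])
    qed
  qed (use f in \<open>auto simp: sqnorm_def truncate_def indicator_def intro!: always_eventually\<close>)
  then show ?thesis by simp
qed

text \<open>The transform of \<open>f\<close> as L2 limit of the transforms of its truncations. The
  norm bound is part of the predicate so that any choice of \<open>h\<close> carries it.\<close>

definition is_L2_fourier :: "(real \<Rightarrow> complex) \<Rightarrow> (real \<Rightarrow> complex) \<Rightarrow> bool" where
  "is_L2_fourier f h \<longleftrightarrow> h \<in> borel_measurable borel \<and> sqnorm lborel h \<le> sqnorm lborel f \<and>
     (\<lambda>j. sqnorm lborel (\<lambda>\<xi>. fourier (truncate f j) \<xi> - h \<xi>)) \<longlonglongrightarrow> 0"

text \<open>The truncations are integrable and converge in L2; by \<open>fourier_L2_le\<close> their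
  transforms form a Cauchy sequence, and Fatou's lemma along the convergent subsequence bounds the
  limit. All this happens for a Borel version \<open>g\<close>, whose truncations have the same
  transforms.\<close>

lemma is_L2_fourier_exists:
  assumes f: "f \<in> borel_measurable lebesgue" "sqnorm lborel f < \<infinity>"
  shows "\<exists>h. is_L2_fourier f h"
proof -
  obtain g where g [measurable]: "g \<in> borel_measurable borel" and fg: "AE x in lborel. f x = g x"
    using lebesgue_borel_rep[OF f(1)] .
  have sq: "sqnorm lborel f = sqnorm lborel g" using fg by (rule sqnorm_cong_AE)
  have eq: "fourier (truncate f j) = fourier (truncate g j)" for j
    by (rule fourier_truncate_cong[OF f(1) borel_measurable_lebesgueI[OF g] fg])
  have int: "integrable lborel (truncate g j)" for j
    using f sq by (intro integrable_truncate) auto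
  have [measurable]: "fourier (truncate g j) \<in> borel_measurable borel" for j
    using int borel_measurable_fourier by auto
  have lim0: "(\<lambda>j. sqnorm lborel (\<lambda>x. truncate g j x - g x)) \<longlonglongrightarrow> 0"
    using f sq by (intro truncate_tendsto) auto
  obtain h r where h [measurable]: "h \<in> borel_measurable lborel" and r: "strict_mono (r :: nat \<Rightarrow> nat)"
    and ae: "AE x in lborel. (\<lambda>k. fourier (truncate g (r k)) x) \<longlonglongrightarrow> h x"
    and lim: "(\<lambda>j. sqnorm lborel (\<lambda>x. fourier (truncate g j) x - h x)) \<longlonglongrightarrow> 0"
  proof (rule L2_complete[of "\<lambda>j. fourier (truncate g j)" lborel])
    fix e :: real assume "e > 0"
    then have "\<forall>\<^sub>F j in sequentially. sqnorm lborel (\<lambda>x. truncate g j x - g x) < ennreal (e / 4)"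
      by (intro order_tendstoD[OF lim0]) simp
    then obtain N where N: "\<And>j. j \<ge> N \<Longrightarrow> sqnorm lborel (\<lambda>x. truncate g j x - g x) < ennreal (e / 4)"
      by (auto simp: eventually_sequentially)
    have "sqnorm lborel (\<lambda>x. fourier (truncate g m) x - fourier (truncate g n) x) \<le> ennreal e"
      if "m \<ge> N" "n \<ge> N" for m n
    proof -
      have "sqnorm lborel (\<lambda>x. fourier (truncate g m) x - fourier (truncate g n) x)
         \<le> sqnorm lborel (\<lambda>x. truncate g m x - truncate g n x)"
        by (intro sqnorm_fourier_diff_le int)
      also have "\<dots> \<le> 2 * sqnorm lborel (\<lambda>x. g x - truncate g m x) + 2 * sqnorm lborel (\<lambda>x. g x - truncate g n x)"
        by (intro sqnorm_diff_le) auto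
      also have "\<dots> \<le> 2 * ennreal (e / 4) + 2 * ennreal (e / 4)"
        using N[OF that(1)] N[OF that(2)]
        by (intro add_mono mult_left_mono) (auto simp: sqnorm_diff_commute[of _ g])
      also have "\<dots> = ennreal e"
        using \<open>e > 0\<close> by (simp add: ennreal_mult'[symmetric] ennreal_plus[symmetric] ennreal_numeral[symmetric] del: ennreal_plus ennreal_numeral)
      finally show ?thesis .
    qed
    then show "\<exists>N. \<forall>m\<ge>N. \<forall>n\<ge>N. sqnorm lborel (\<lambda>x. fourier (truncate g m) x - fourier (truncate g n) x) \<le> ennreal e"
      by blast
  qed auto
  have "sqnorm lborel h \<le> sqnorm lborel g"
  proof (rule sqnorm_tendsto_le[OF _ ae])
    show "sqnorm lborel (fourier (truncate g (r n))) \<le> sqnorm lborel g" for n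
    proof -
      have "sqnorm lborel (fourier (truncate g (r n))) \<le> sqnorm lborel (truncate g (r n))"
        using fourier_L2_le[OF int] by (simp add: sqnorm_def)
      also have "\<dots> \<le> sqnorm lborel g"
        by (intro sqnorm_mono_AE) (auto simp: truncate_def indicator_def)
      finally show ?thesis .
    qed
  qed auto
  with lim show ?thesis
    unfolding is_L2_fourier_def eq sq by (intro exI[of _ h]) auto
qed

text \<open>A representative is chosen for each \<open>f\<close> separately, so linearity holds only almost everywhere.\<close>

definition L2_fourier :: "(real \<Rightarrow> complex) \<Rightarrow> real \<Rightarrow> complex" where
  "L2_fourier f = (SOME h. is_L2_fourier f h)"

lemma L2_fourier:
  assumes "f \<in> borel_measurable lebesgue" "sqnorm lborel f < \<infinity>"
  shows "is_L2_fourier f (L2_fourier f)"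
  unfolding L2_fourier_def by (rule someI_ex[OF is_L2_fourier_exists[OF assms]])

lemma L2_fourier_measurable:
  assumes "f \<in> borel_measurable lebesgue" "sqnorm lborel f < \<infinity>"
  shows "L2_fourier f \<in> borel_measurable borel"
  using L2_fourier[OF assms] by (simp add: is_L2_fourier_def)

lemma sqnorm_L2_fourier_le:
  assumes "f \<in> borel_measurable lebesgue" "sqnorm lborel f < \<infinity>"
  shows "sqnorm lborel (L2_fourier f) \<le> sqnorm lborel f"
  using L2_fourier[OF assms] by (simp add: is_L2_fourier_def)

lemma integrable_truncate_lebesgue:
  assumes "f \<in> borel_measurable lebesgue" "sqnorm lborel f < \<infinity>"
  shows "integrable lebesgue (truncate f j)"
proof -
  obtain g where g [measurable]: "g \<in> borel_measurable borel" and fg: "AE x in lborel. f x = g x"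
    using lebesgue_borel_rep[OF assms(1)] .
  have "integrable lebesgue (truncate g j)"
    using assms(2) sqnorm_cong_AE[OF fg] by (subst integrable_completion) (auto intro!: integrable_truncate)
  moreover have "integrable lebesgue (truncate f j) \<longleftrightarrow> integrable lebesgue (truncate g j)"
  proof (rule integrable_cong_AE)
    show "AE x in lebesgue. truncate f j x = truncate g j x"
      using AE_completion[OF fg] by eventually_elim (simp add: truncate_def)
  qed (intro borel_measurable_truncate_lebesgue assms borel_measurable_lebesgueI[OF g])+
  ultimately show ?thesis by simp
qed

lemma integrable_lebesgue_mult_cis:
  fixes f :: "real \<Rightarrow> complex"
  assumes "integrable lebesgue f"
  shows "integrable lebesgue (\<lambda>x. f x * cis (a * x))"
proof (rule Bochner_Integration.integrable_bound[OF assms])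
  have "(\<lambda>x. cis (a * x)) \<in> borel_measurable lebesgue"
    by (rule borel_measurable_lebesgueI) measurable
  then show "(\<lambda>x. f x * cis (a * x)) \<in> borel_measurable lebesgue"
    using assms by (intro borel_measurable_times) auto
qed (auto simp: norm_mult)

lemma fourier_add:
  assumes "integrable lebesgue f" "integrable lebesgue g"
  shows "fourier (\<lambda>x. f x + g x) \<xi> = fourier f \<xi> + fourier g \<xi>"
  unfolding fourier_def distrib_right
  by (intro Bochner_Integration.integral_add integrable_lebesgue_mult_cis assms)

lemma fourier_cmult: "fourier (\<lambda>x. c * f x) \<xi> = c * fourier f \<xi>"
  by (simp add: fourier_def mult.assoc)

lemma fourier_truncate_measurable:
  assumes "f \<in> borel_measurable lebesgue" "sqnorm lborel f < \<infinity>"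
  shows "fourier (truncate f j) \<in> borel_measurable borel"
proof -
  obtain g where g [measurable]: "g \<in> borel_measurable borel" and fg: "AE x in lborel. f x = g x"
    using lebesgue_borel_rep[OF assms(1)] .
  have eq: "fourier (truncate f j) = fourier (truncate g j)"
    by (rule fourier_truncate_cong[OF assms(1) borel_measurable_lebesgueI[OF g] fg])
  show ?thesis unfolding eq
    using assms(2) sqnorm_cong_AE[OF fg] by (intro borel_measurable_fourier integrable_truncate) auto
qed

lemma L2_fourier_unique:
  assumes f: "f \<in> borel_measurable lebesgue" "sqnorm lborel f < \<infinity>" and [measurable]: "h \<in> borel_measurable borel"
    and lim: "(\<lambda>j. sqnorm lborel (\<lambda>\<xi>. fourier (truncate f j) \<xi> - h \<xi>)) \<longlonglongrightarrow> 0"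
  shows "AE \<xi> in lborel. L2_fourier f \<xi> = h \<xi>"
  using L2_fourier[OF f] lim fourier_truncate_measurable[OF f]
  by (intro sqnorm_limit_unique[of "\<lambda>j. fourier (truncate f j)"]) (auto simp: is_L2_fourier_def)

text \<open>Although the representative is chosen arbitrarily, the results agree everywhere: almost
  everywhere equal functions have the same truncated transforms and the same norm, hence the same
  predicate, and the choice operator returns the same function.\<close>

lemma L2_fourier_cong_AE:
  assumes "f \<in> borel_measurable lebesgue" "g \<in> borel_measurable lebesgue" "AE x in lborel. f x = g x"
  shows "L2_fourier f = L2_fourier g"
proof -
  have "fourier (truncate f j) = fourier (truncate g j)" for j
    by (rule fourier_truncate_cong[OF assms])
  then have "is_L2_fourier f = is_L2_fourier g"
    using sqnorm_cong_AE[OF assms(3)] by (simp add: is_L2_fourier_def fun_eq_iff)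
  then show ?thesis by (simp add: L2_fourier_def)
qed

lemma L2_fourier_add:
  assumes f: "f \<in> borel_measurable lebesgue" "sqnorm lborel f < \<infinity>"
    and g: "g \<in> borel_measurable lebesgue" "sqnorm lborel g < \<infinity>"
  shows "AE \<xi> in lborel. L2_fourier (\<lambda>x. f x + g x) \<xi> = L2_fourier f \<xi> + L2_fourier g \<xi>"
proof (rule L2_fourier_unique)
  note [measurable] = f(1) g(1) L2_fourier_measurable[OF f] L2_fourier_measurable[OF g]
    fourier_truncate_measurable[OF f] fourier_truncate_measurable[OF g]
  show "(\<lambda>x. f x + g x) \<in> borel_measurable lebesgue" using f(1) g(1) by (rule borel_measurable_add)
  have "sqnorm lebesgue (\<lambda>x. f x + g x) \<le> 2 * sqnorm lebesgue f + 2 * sqnorm lebesgue g"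
    using f g by (intro sqnorm_add_le) auto
  also have "\<dots> < \<infinity>" using f g by (auto simp: ennreal_mult_less_top)
  finally show "sqnorm lborel (\<lambda>x. f x + g x) < \<infinity>" by simp
  show "(\<lambda>\<xi>. L2_fourier f \<xi> + L2_fourier g \<xi>) \<in> borel_measurable borel" by measurable
  have eq: "fourier (truncate (\<lambda>x. f x + g x) j) \<xi> = fourier (truncate f j) \<xi> + fourier (truncate g j) \<xi>" for j \<xi>
    using fourier_add[OF integrable_truncate_lebesgue[OF f, of j] integrable_truncate_lebesgue[OF g, of j]]
    by (simp add: truncate_def distrib_left)
  let ?a = "\<lambda>j \<xi>. fourier (truncate f j) \<xi> - L2_fourier f \<xi>"
  let ?b = "\<lambda>j \<xi>. fourier (truncate g j) \<xi> - L2_fourier g \<xi>"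
  have le: "sqnorm lborel (\<lambda>\<xi>. fourier (truncate (\<lambda>x. f x + g x) j) \<xi> - (L2_fourier f \<xi> + L2_fourier g \<xi>))
     \<le> 2 * sqnorm lborel (?a j) + 2 * sqnorm lborel (?b j)" for j
    unfolding eq add_diff_add
    by (intro sqnorm_add_le borel_measurable_diff)
      (simp_all add: L2_fourier_measurable f g fourier_truncate_measurable)
  have "(\<lambda>j. 2 * sqnorm lborel (?a j) + 2 * sqnorm lborel (?b j)) \<longlonglongrightarrow> 2 * 0 + 2 * 0"
    using L2_fourier[OF f] L2_fourier[OF g] by (intro tendsto_add ennreal_tendsto_cmult) (auto simp: is_L2_fourier_def)
  then have lim: "(\<lambda>j. 2 * sqnorm lborel (?a j) + 2 * sqnorm lborel (?b j)) \<longlonglongrightarrow> 0" by simp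
  show "(\<lambda>j. sqnorm lborel (\<lambda>\<xi>. fourier (truncate (\<lambda>x. f x + g x) j) \<xi> - (L2_fourier f \<xi> + L2_fourier g \<xi>))) \<longlonglongrightarrow> 0"
    by (rule tendsto_sandwich[OF _ _ tendsto_const lim]) (simp_all add: le)
qed

lemma L2_fourier_cmult:
  assumes f: "f \<in> borel_measurable lebesgue" "sqnorm lborel f < \<infinity>"
  shows "AE \<xi> in lborel. L2_fourier (\<lambda>x. c * f x) \<xi> = c * L2_fourier f \<xi>"
proof (rule L2_fourier_unique)
  note [measurable] = f(1) L2_fourier_measurable[OF f] fourier_truncate_measurable[OF f]
  show "(\<lambda>x. c * f x) \<in> borel_measurable lebesgue" using f(1) by auto
  show "sqnorm lborel (\<lambda>x. c * f x) < \<infinity>"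
    using sqnorm_cmult[OF f(1), of c] f by (simp add: ennreal_mult_less_top)
  show "(\<lambda>\<xi>. c * L2_fourier f \<xi>) \<in> borel_measurable borel" by measurable
  have eq: "fourier (truncate (\<lambda>x. c * f x) j) \<xi> = c * fourier (truncate f j) \<xi>" for j \<xi>
    by (subst fourier_cmult[symmetric]) (simp add: truncate_def mult.left_commute)
  have "sqnorm lborel (\<lambda>\<xi>. fourier (truncate (\<lambda>x. c * f x) j) \<xi> - c * L2_fourier f \<xi>)
      = ennreal ((norm c)\<^sup>2) * sqnorm lborel (\<lambda>\<xi>. fourier (truncate f j) \<xi> - L2_fourier f \<xi>)" for j
    unfolding eq right_diff_distrib[symmetric] by (rule sqnorm_cmult) measurable
  moreover have "(\<lambda>j. ennreal ((norm c)\<^sup>2) * sqnorm lborel (\<lambda>\<xi>. fourier (truncate f j) \<xi> - L2_fourier f \<xi>)) \<longlonglongrightarrow> ennreal ((norm c)\<^sup>2) * 0"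
    using L2_fourier[OF f] by (intro ennreal_tendsto_cmult) (auto simp: is_L2_fourier_def)
  ultimately show "(\<lambda>j. sqnorm lborel (\<lambda>\<xi>. fourier (truncate (\<lambda>x. c * f x) j) \<xi> - c * L2_fourier f \<xi>)) \<longlonglongrightarrow> 0"
    by simp
qed

lemma L2_fourier_eq_fourier:
  assumes f: "integrable lborel f" "sqnorm lborel f < \<infinity>"
  shows "AE \<xi> in lborel. L2_fourier f \<xi> = fourier f \<xi>"
proof (rule L2_fourier_unique)
  have [measurable]: "f \<in> borel_measurable borel" using f by auto
  then show "f \<in> borel_measurable lebesgue" by (rule borel_measurable_lebesgueI)
  show "fourier f \<in> borel_measurable borel" using f by (simp add: borel_measurable_fourier)
  have "sqnorm lborel (\<lambda>\<xi>. fourier (truncate f j) \<xi> - fourier f \<xi>) \<le> sqnorm lborel (\<lambda>x. truncate f j x - f x)" for j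
    using f by (intro sqnorm_fourier_diff_le integrable_truncate) auto
  then show "(\<lambda>j. sqnorm lborel (\<lambda>\<xi>. fourier (truncate f j) \<xi> - fourier f \<xi>)) \<longlonglongrightarrow> 0"
    by (intro tendsto_sandwich[OF _ _ tendsto_const[of 0] truncate_tendsto[of f]] always_eventually allI)
       (use f in auto)
qed (use f in auto)

section \<open>Operators on Lebesgue spaces\<close>

lemma Lp_space_2: "f \<in> Lp_space 2 M \<longleftrightarrow> f \<in> borel_measurable M \<and> sqnorm M f < \<infinity>"
  unfolding Lp_space_def sqnorm_def by (auto simp: integrable_iff_bounded)

lemma Lp_norm_2:
  assumes "f \<in> borel_measurable M"
  shows "Lp_norm 2 M f = sqrt (enn2real (sqnorm M f))"
proof -
  have "(LINT x|M. (norm (f x))\<^sup>2) = enn2real (sqnorm M f)"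
    unfolding sqnorm_def using assms by (intro integral_eq_nn_integral) auto
  then show ?thesis unfolding Lp_norm_def by (simp add: powr_half_sqrt)
qed

lemma Lp_space_1: "f \<in> Lp_space 1 M \<longleftrightarrow> integrable M f"
  unfolding Lp_space_def by (auto simp: integrable_norm_iff)

lemma Lp_norm_1: "Lp_norm 1 M f = (LINT x|M. norm (f x))"
  unfolding Lp_norm_def by (simp add: integral_nonneg_AE)

lemma Lp_norm_nonneg [simp]: "0 \<le> Lp_norm p M f"
  by (simp add: Lp_norm_def)

lemma zero_in_Lp_space [simp]: "(\<lambda>x. 0) \<in> Lp_space p M"
  by (simp add: Lp_space_def)

lemma Lp_norm_zero [simp]: "Lp_norm p M (\<lambda>x. 0) = 0"
  by (simp add: Lp_norm_def)

text \<open>Functions of norm 0 contribute the quotient 0 to the supremum, which accounts for the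
  condition \<open>C \<ge> 0\<close>.\<close>

lemma Lp_onorm_le:
  assumes "\<And>f. f \<in> Lp_space p M \<Longrightarrow> Lp_norm p M (T f) \<le> C * Lp_norm p M f" "C \<ge> 0"
  shows "Lp_onorm p M T \<le> C"
  unfolding Lp_onorm_def
proof (rule cSUP_least)
  show "Lp_space p M \<noteq> {}" using zero_in_Lp_space by blast
  show "Lp_norm p M (T f) / Lp_norm p M f \<le> C" if "f \<in> Lp_space p M" for f
    using assms(1)[OF that] assms(2) Lp_norm_nonneg[of p M f]
    by (cases "Lp_norm p M f = 0") (auto simp: pos_divide_le_eq less_le)
qed

lemma bdd_above_Lp_onorm:
  assumes "bounded_Lp_operator p M T"
  shows "bdd_above ((\<lambda>f. Lp_norm p M (T f) / Lp_norm p M f) ` Lp_space p M)"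
proof -
  obtain C where C: "\<forall>f\<in>Lp_space p M. Lp_norm p M (T f) \<le> C * Lp_norm p M f"
    using assms by (auto simp: bounded_Lp_operator_def)
  show ?thesis
  proof (rule bdd_aboveI2)
    fix f assume f: "f \<in> Lp_space p M"
    \<comment> \<open>The sign of \<open>C\<close> is unknown, and the quotient is 0 for functions
      of norm 0.\<close>
    show "Lp_norm p M (T f) / Lp_norm p M f \<le> max C 0"
      using order_trans[OF bspec[OF C f] mult_right_mono[OF max.cobounded1[of C 0] Lp_norm_nonneg]] Lp_norm_nonneg[of p M f]
      by (cases "Lp_norm p M f = 0") (auto simp: pos_divide_le_eq less_le)
  qed
qed

lemma Lp_onorm_bound:
  assumes T: "bounded_Lp_operator p M T" and f: "f \<in> Lp_space p M"
  shows "Lp_norm p M (T f) \<le> Lp_onorm p M T * Lp_norm p M f"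
proof (cases "Lp_norm p M f = 0")
  \<comment> \<open>The supremum carries no information at functions of norm 0; there the
    boundedness of \<open>T\<close> itself gives norm 0 for \<open>T f\<close>.\<close>
  case True
  then show ?thesis using T f Lp_norm_nonneg[of p M "T f"] by (fastforce simp: bounded_Lp_operator_def)
next
  case False
  have "Lp_norm p M (T f) / Lp_norm p M f \<le> Lp_onorm p M T"
    unfolding Lp_onorm_def by (rule cSUP_upper[OF f bdd_above_Lp_onorm[OF T]])
  then show ?thesis using False Lp_norm_nonneg[of p M f] by (simp add: divide_simps split: if_splits)
qed

lemma Lp_onorm_nonneg:
  assumes "bounded_Lp_operator p M T"
  shows "0 \<le> Lp_onorm p M T"
  using cSUP_upper[OF zero_in_Lp_space bdd_above_Lp_onorm[OF assms]]
  by (simp add: Lp_onorm_def)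

section \<open>Multiplier norms as infima\<close>

lemma bdd_below_multiplier_norms:
  "bdd_below (Lp_onorm p lebesgue ` {T. extends_multiplier_R p m T})"
  "bdd_below (Lp_onorm p torus ` {T. extends_multiplier_Z p \<phi> T})"
  by (auto intro!: bdd_belowI2[of _ 0] Lp_onorm_nonneg simp: extends_multiplier_R_def extends_multiplier_Z_def)

lemma multiplier_norm_R_le:
  assumes "extends_multiplier_R p m T" "Lp_onorm p lebesgue T \<le> C"
  shows "multiplier_norm_R p m \<le> C"
  unfolding multiplier_norm_R_def
  using cINF_lower[OF bdd_below_multiplier_norms(1), of T p m] assms by simp

lemma multiplier_norm_Z_le:
  assumes "extends_multiplier_Z p \<phi> T" "Lp_onorm p torus T \<le> C"
  shows "multiplier_norm_Z p \<phi> \<le> C"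
  unfolding multiplier_norm_Z_def
  using cINF_lower[OF bdd_below_multiplier_norms(2), of T p \<phi>] assms by simp

lemma le_multiplier_norm_Z:
  assumes "\<phi> \<in> multipliers_Z p" "\<And>T. extends_multiplier_Z p \<phi> T \<Longrightarrow> c \<le> Lp_onorm p torus T"
  shows "c \<le> multiplier_norm_Z p \<phi>"
  unfolding multiplier_norm_Z_def
  using assms by (intro cINF_greatest) (auto simp: multipliers_Z_def)

lemma multiplier_norm_Z_nonneg:
  "\<phi> \<in> multipliers_Z p \<Longrightarrow> 0 \<le> multiplier_norm_Z p \<phi>"
  by (rule le_multiplier_norm_Z) (auto simp: extends_multiplier_Z_def Lp_onorm_nonneg)

section \<open>Schwartz functions\<close>

lemma integrable_inverse_1_plus_square': "integrable lborel (\<lambda>x::real. inverse (1 + x\<^sup>2))"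
  using integrable_inverse_1_plus_square by (simp add: set_integrable_def)

text \<open>Adding the seminorms for the powers 0 and 2 gives an integrable majorant.\<close>

lemma schwartz_bound:
  assumes "f \<in> schwartz"
  obtains C where "C \<ge> 0" "\<And>x. norm (nth_vector_derivative j f x) \<le> C * inverse (1 + x\<^sup>2)"
proof -
  from assms obtain A B where
    A: "\<And>x. \<bar>x\<bar> ^ 0 * norm (nth_vector_derivative j f x) \<le> A" and
    B: "\<And>x. \<bar>x\<bar> ^ 2 * norm (nth_vector_derivative j f x) \<le> B"
    unfolding schwartz_def by blast
  show thesis
  proof
    show "A + B \<ge> 0"
      using order_trans[OF norm_ge_zero A[of 0, simplified]] B[of 0] by simp
    show "norm (nth_vector_derivative j f x) \<le> (A + B) * inverse (1 + x\<^sup>2)" for x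
    proof -
      have "norm (nth_vector_derivative j f x) * (1 + x\<^sup>2) \<le> A + B"
        using A[of x] B[of x] by (simp add: algebra_simps)
      then show ?thesis using add_pos_nonneg[OF zero_less_one zero_le_power2[of x]] by (simp add: divide_simps)
    qed
  qed
qed

lemma schwartz_differentiable:
  assumes "f \<in> schwartz"
  shows "nth_vector_derivative j f differentiable at x"
  using assms by (auto simp: schwartz_def)

lemma schwartz_has_derivative:
  assumes "f \<in> schwartz"
  shows "(nth_vector_derivative j f has_vector_derivative nth_vector_derivative (Suc j) f x) (at x)"
  using schwartz_differentiable[OF assms, of j x]
  by (simp add: vector_derivative_works nth_vector_derivative_def)

lemma schwartz_isCont:
  assumes "f \<in> schwartz"
  shows "isCont (nth_vector_derivative j f) x"
  using schwartz_differentiable[OF assms] by (rule differentiable_imp_continuous_within)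

lemma schwartz_measurable:
  assumes "f \<in> schwartz"
  shows "nth_vector_derivative j f \<in> borel_measurable borel"
  using schwartz_isCont[OF assms]
  by (intro borel_measurable_continuous_onI continuous_at_imp_continuous_on) auto

lemma schwartz_integrable:
  assumes "f \<in> schwartz"
  shows "integrable lborel (nth_vector_derivative j f)"
proof -
  obtain C where C: "C \<ge> 0" "\<And>x. norm (nth_vector_derivative j f x) \<le> C * inverse (1 + x\<^sup>2)"
    using schwartz_bound[OF assms] by blast
  have "integrable lborel (\<lambda>x. C * inverse (1 + x\<^sup>2))"
    using integrable_inverse_1_plus_square' by auto
  then show ?thesis
    by (rule Bochner_Integration.integrable_bound) (use C schwartz_measurable[OF assms] in \<open>auto intro: order_trans[OF _ abs_ge_self]\<close>)
qed

lemma schwartz_tendsto_0: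
  assumes "f \<in> schwartz"
  shows "(nth_vector_derivative j f \<longlongrightarrow> 0) at_top" "(nth_vector_derivative j f \<longlongrightarrow> 0) at_bot"
proof -
  obtain C where C: "C \<ge> 0" "\<And>x. norm (nth_vector_derivative j f x) \<le> C * inverse (1 + x\<^sup>2)"
    using schwartz_bound[OF assms] by blast
  have "((\<lambda>x::real. C * inverse (1 + x\<^sup>2)) \<longlongrightarrow> C * 0) at_top" "((\<lambda>x::real. C * inverse (1 + x\<^sup>2)) \<longlongrightarrow> C * 0) at_bot"
    by (rule tendsto_mult_left, real_asymp)+
  then have lim: "((\<lambda>x::real. C * inverse (1 + x\<^sup>2)) \<longlongrightarrow> 0) at_top" "((\<lambda>x::real. C * inverse (1 + x\<^sup>2)) \<longlongrightarrow> 0) at_bot"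
    by simp_all
  show "(nth_vector_derivative j f \<longlongrightarrow> 0) at_top"
    by (rule Lim_null_comparison[OF _ lim(1)]) (simp add: C)
  show "(nth_vector_derivative j f \<longlongrightarrow> 0) at_bot"
    by (rule Lim_null_comparison[OF _ lim(2)]) (simp add: C)
qed

text \<open>Integration by parts, carried out as the fundamental theorem on the whole line for the
  product with the exponential. The boundary terms vanish because the exponential has modulus 1 and
  the derivatives of \<open>f\<close> tend to 0.\<close>

lemma fourier_derivative:
  assumes f: "f \<in> schwartz"
  shows "fourier (nth_vector_derivative (Suc j) f) \<xi> = 2 * pi * \<i> * \<xi> * fourier (nth_vector_derivative j f) \<xi>"
proof -
  let ?g = "nth_vector_derivative j f" and ?g' = "nth_vector_derivative (Suc j) f"
  let ?e = "\<lambda>x. cis (- 2 * pi * \<xi> * x)"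
  have [measurable]: "?g \<in> borel_measurable borel" "?g' \<in> borel_measurable borel"
    using schwartz_measurable[OF f] by auto
  have e: "(?e has_vector_derivative (- 2 * pi * \<i> * \<xi> * ?e x)) (at x)" for x
  proof -
    have "((\<lambda>x. exp (complex_of_real x * (\<i> * (- 2 * pi * \<xi>)))) has_vector_derivative
        (\<i> * (- 2 * pi * \<xi>)) * exp (complex_of_real x * (\<i> * (- 2 * pi * \<xi>)))) (at x)"
      by (rule has_vector_derivative_real_field) (auto intro!: derivative_eq_intros)
    then show ?thesis by (simp add: cis_conv_exp mult_ac)
  qed
  have "(LBINT x=-\<infinity>..\<infinity>. ?g x * (- 2 * pi * \<i> * \<xi> * ?e x) + ?g' x * ?e x) = 0 - 0"
  proof (rule interval_integral_FTC_integrable[where F = "\<lambda>x. ?g x * ?e x"])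
    show "((\<lambda>x. ?g x * ?e x) has_vector_derivative ?g x * (- 2 * pi * \<i> * \<xi> * ?e x) + ?g' x * ?e x) (at x)" for x
      by (rule has_vector_derivative_mult[OF schwartz_has_derivative[OF f] e])
    show "isCont (\<lambda>x. ?g x * (- 2 * pi * \<i> * \<xi> * ?e x) + ?g' x * ?e x) x" for x
      by (intro continuous_intros schwartz_isCont f isCont_o2[OF _ isCont_cis])
    have "integrable lborel (\<lambda>x. (- 2 * pi * \<i> * \<xi>) * (?g x * ?e x) + ?g' x * ?e x)"
      by (intro Bochner_Integration.integrable_add integrable_mult_right integrable_mult_cis schwartz_integrable f) auto
    then show "set_integrable lborel (einterval (-\<infinity>) \<infinity>) (\<lambda>x. ?g x * (- 2 * pi * \<i> * \<xi> * ?e x) + ?g' x * ?e x)"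
      by (simp add: set_integrable_def mult_ac)
    have lim: "((\<lambda>x. ?g x * ?e x) \<longlongrightarrow> 0) at_top" "((\<lambda>x. ?g x * ?e x) \<longlongrightarrow> 0) at_bot"
      using schwartz_tendsto_0[OF f, of j, THEN tendsto_norm_zero]
      by - (rule tendsto_norm_zero_cancel, simp add: norm_mult)+
    show "(((\<lambda>x. ?g x * ?e x) \<circ> real_of_ereal) \<longlongrightarrow> 0) (at_right (-\<infinity>))" "(((\<lambda>x. ?g x * ?e x) \<circ> real_of_ereal) \<longlongrightarrow> 0) (at_left \<infinity>)"
      using lim by (simp_all add: ereal_tendsto_simps)
  qed auto
  then have "(LINT x|lborel. (- 2 * pi * \<i> * \<xi>) * (?g x * ?e x) + ?g' x * ?e x) = 0"
    by (simp add: interval_lebesgue_integral_def set_lebesgue_integral_def mult_ac)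
  also have "(LINT x|lborel. (- 2 * pi * \<i> * \<xi>) * (?g x * ?e x) + ?g' x * ?e x)
      = (- 2 * pi * \<i> * \<xi>) * (LINT x|lborel. ?g x * ?e x) + (LINT x|lborel. ?g' x * ?e x)"
    by (subst Bochner_Integration.integral_add)
       (auto intro!: integrable_mult_right integrable_mult_cis schwartz_integrable f simp del: mult_minus_left of_real_mult)
  finally show ?thesis
    by (simp add: fourier_lborel add_eq_0_iff2)
qed

lemma nth_vector_derivative_0 [simp]: "nth_vector_derivative 0 f = f"
  by (simp add: nth_vector_derivative_def)

text \<open>Two derivatives suffice: the transform of the second derivative is
  \<open>- (2 * pi * \<xi>)\<^sup>2\<close> times that of \<open>f\<close>, so boundedness of both
  transforms gives decay like \<open>1 / (1 + \<xi>\<^sup>2)\<close>.\<close>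

lemma integrable_fourier_schwartz:
  assumes f: "f \<in> schwartz"
  shows "integrable lborel (fourier f)"
proof -
  let ?f2 = "nth_vector_derivative 2 f"
  let ?A = "LINT x|lborel. norm (f x)" and ?B = "LINT x|lborel. norm (?f2 x)"
  have int: "integrable lborel f" "integrable lborel ?f2"
    using schwartz_integrable[OF f, of 0] schwartz_integrable[OF f] by auto
  have "fourier ?f2 \<xi> = - ((2 * pi * \<xi>)\<^sup>2 * fourier f \<xi>)" for \<xi>
    using fourier_derivative[OF f, of 1 \<xi>] fourier_derivative[OF f, of 0 \<xi>]
    by (simp add: numeral_2_eq_2 power2_eq_square algebra_simps)
  then have sq: "(2 * pi * \<xi>)\<^sup>2 * norm (fourier f \<xi>) \<le> ?B" for \<xi>
    using norm_fourier_le[OF int(2), of \<xi>] by (simp add: norm_mult norm_power power_mult_distrib)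
  have bd: "norm (fourier f \<xi>) \<le> (?A + ?B) * inverse (1 + \<xi>\<^sup>2)" for \<xi>
  proof -
    have "1 \<le> 2 * pi" using pi_gt3 by simp
    then have "1 \<le> (2 * pi)\<^sup>2" by (rule one_le_power)
    then have "1 * (\<xi>\<^sup>2 * norm (fourier f \<xi>)) \<le> (2 * pi)\<^sup>2 * (\<xi>\<^sup>2 * norm (fourier f \<xi>))"
      by (intro mult_right_mono) auto
    also have "\<dots> \<le> ?B" using sq[of \<xi>] by (simp add: power_mult_distrib mult_ac)
    finally have "norm (fourier f \<xi>) * (1 + \<xi>\<^sup>2) \<le> ?A + ?B"
      using norm_fourier_le[OF int(1), of \<xi>] by (simp add: algebra_simps)
    then show ?thesis using add_pos_nonneg[OF zero_less_one zero_le_power2[of \<xi>]] by (simp add: divide_simps)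
  qed
  have "integrable lborel (\<lambda>x. (?A + ?B) * inverse (1 + x\<^sup>2))"
    using integrable_inverse_1_plus_square' by auto
  then show ?thesis
    by (rule Bochner_Integration.integrable_bound)
       (use bd borel_measurable_fourier[OF int(1)] in \<open>auto intro: order_trans[OF _ abs_ge_self]\<close>)
qed

lemma schwartz_bounded:
  assumes "f \<in> schwartz"
  shows "\<exists>B. \<forall>x. norm (f x) \<le> B"
proof -
  from assms have "\<exists>B. \<forall>x. \<bar>x\<bar> ^ 0 * norm (nth_vector_derivative 0 f x) \<le> B"
    unfolding schwartz_def by blast
  then show ?thesis by simp
qed

lemma schwartz_inversion:
  assumes f: "f \<in> schwartz"
  shows "f x = fourier (fourier f) (- x)"
proof -
  obtain B where "\<And>x. norm (f x) \<le> B" using schwartz_bounded[OF f] by blast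
  then show ?thesis
    using schwartz_integrable[OF f, of 0] schwartz_isCont[OF f, where j = 0] integrable_fourier_schwartz[OF f]
    by (intro fourier_inversion) auto
qed

lemma sqnorm_bounded_integrable:
  assumes f: "integrable lborel f" and B: "\<And>x. norm (f x) \<le> B"
  shows "sqnorm lborel f < \<infinity>"
proof -
  have "sqnorm lborel f \<le> (\<integral>\<^sup>+x. ennreal B * ennreal (norm (f x)) \<partial>lborel)"
    unfolding sqnorm_def
    by (intro nn_integral_mono)
       (use B order_trans[OF norm_ge_zero B] in \<open>auto simp: power2_eq_square ennreal_mult[symmetric] intro!: mult_right_mono ennreal_leI\<close>)
  also have "\<dots> = ennreal B * (\<integral>\<^sup>+x. ennreal (norm (f x)) \<partial>lborel)"
    using f by (intro nn_integral_cmult) auto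
  also have "\<dots> < \<infinity>"
    using f by (auto simp: integrable_iff_bounded ennreal_mult_less_top)
  finally show ?thesis .
qed

text \<open>The exponential series majorizes each of its terms, which handles the even power
  \<open>2 * k\<close>; the power \<open>k\<close> follows from
  \<open>\<bar>x\<bar> ^ k \<le> 1 + (x\<^sup>2) ^ k\<close>.\<close>

lemma gauss_power_bound:
  fixes a :: real assumes "a > 0"
  shows "\<exists>C. \<forall>x. \<bar>x\<bar> ^ k * exp (- (a * x\<^sup>2)) \<le> C"
proof (intro exI allI)
  fix x :: real
  have "(a * x\<^sup>2) ^ k / fact k \<le> exp (a * x\<^sup>2)"
  proof -
    have s: "(\<lambda>n. (a * x\<^sup>2) ^ n /\<^sub>R fact n) sums exp (a * x\<^sup>2)" by (rule exp_converges)
    have "(\<Sum>n\<in>{k}. (a * x\<^sup>2) ^ n /\<^sub>R fact n) \<le> (\<Sum>n. (a * x\<^sup>2) ^ n /\<^sub>R fact n)"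
      using assms by (intro sum_le_suminf sums_summable[OF s]) auto
    then show ?thesis using sums_unique[OF s] by (simp add: divide_inverse mult.commute)
  qed
  then have 1: "(x\<^sup>2) ^ k * exp (- (a * x\<^sup>2)) \<le> fact k / a ^ k"
    using assms by (simp add: exp_minus field_simps power_mult_distrib)
  have "(\<bar>x\<bar> ^ k)\<^sup>2 = (x\<^sup>2) ^ k"
    by (metis power_mult mult.commute power2_abs)
  then have "\<bar>x\<bar> ^ k \<le> 1 + (x\<^sup>2) ^ k"
    using sum_squares_bound[of 1 "\<bar>x\<bar> ^ k"] zero_le_power[OF abs_ge_zero[of x], of k] unfolding power_one by linarith
  then have "\<bar>x\<bar> ^ k * exp (- (a * x\<^sup>2)) \<le> (1 + (x\<^sup>2) ^ k) * exp (- (a * x\<^sup>2))"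
    by (intro mult_right_mono) auto
  also have "\<dots> \<le> 1 + fact k / a ^ k"
    using 1 assms by (simp add: distrib_right add_mono)
  finally show "\<bar>x\<bar> ^ k * exp (- (a * x\<^sup>2)) \<le> 1 + fact k / a ^ k" .
qed

text \<open>The polynomial factor makes the family closed under differentiation: the derivative
  replaces \<open>p\<close> by \<open>pderiv p + [:b, - 2 * of_real a:] * p\<close>. For imaginary
  \<open>b\<close> the exponential has modulus \<open>exp (- (a * x\<^sup>2))\<close>.\<close>

lemma gauss_in_schwartz:
  fixes b :: complex and a :: real
  assumes "a > 0" "Re b = 0"
  shows "(\<lambda>x. poly p (of_real x) * exp (b * of_real x - of_real a * (of_real x)\<^sup>2)) \<in> schwartz"
proof -
  let ?g = "\<lambda>p x. poly p (complex_of_real x) * exp (b * of_real x - of_real a * (of_real x)\<^sup>2)"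
  let ?D = "\<lambda>p. pderiv p + [:b, - 2 * of_real a:] * p"
  have der: "(?g p has_vector_derivative ?g (?D p) x) (at x)" for p x
    by (rule has_vector_derivative_real_field)
      (auto intro!: derivative_eq_intros poly_DERIV simp: algebra_simps)
  have nth: "nth_vector_derivative j (?g p) = ?g ((?D ^^ j) p)" for j p
  proof (induction j)
    case (Suc j)
    have "nth_vector_derivative (Suc j) (?g p) = (\<lambda>x. vector_derivative (?g ((?D ^^ j) p)) (at x))"
      using Suc by (simp add: nth_vector_derivative_def)
    also have "\<dots> = ?g ((?D ^^ Suc j) p)"
      using vector_derivative_at[OF der[of "(?D ^^ j) p"]] by (simp add: fun_eq_iff)
    finally show ?case .
  qed simp
  have nrm: "norm (exp (b * of_real x - of_real a * (of_real x)\<^sup>2)) = exp (- (a * x\<^sup>2))" for x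
    using assms(2) by (simp add: norm_exp_eq_Re power2_eq_square)
  have bd: "\<exists>C. \<forall>x. \<bar>x\<bar> ^ k * norm (?g p x) \<le> C" for p k
  \<comment> \<open>Splitting off the constant coefficient raises the power of \<open>x\<close> by
    one, hence the generalization over \<open>k\<close>.\<close>
  proof (induction p arbitrary: k)
    case (pCons c p)
    obtain C1 where C1: "\<And>x. \<bar>x\<bar> ^ k * exp (- (a * x\<^sup>2)) \<le> C1"
      using gauss_power_bound[OF assms(1), of k] by blast
    obtain C2 where C2: "\<And>x. \<bar>x\<bar> ^ Suc k * norm (?g p x) \<le> C2"
      using pCons.IH[of "Suc k"] by blast
    show ?case
    proof (intro exI allI)
      fix x
      have "norm (?g (pCons c p) x) = norm (c + of_real x * poly p (of_real x)) * exp (- (a * x\<^sup>2))"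
        using assms(2) by (simp add: norm_mult nrm)
      also have "\<dots> \<le> (norm c + \<bar>x\<bar> * norm (poly p (of_real x))) * exp (- (a * x\<^sup>2))"
        by (intro mult_right_mono order_trans[OF norm_triangle_ineq]) (auto simp: norm_mult)
      finally have "\<bar>x\<bar> ^ k * norm (?g (pCons c p) x) \<le> \<bar>x\<bar> ^ k * ((norm c + \<bar>x\<bar> * norm (poly p (of_real x))) * exp (- (a * x\<^sup>2)))"
        by (intro mult_left_mono) auto
      also have "\<dots> = norm c * (\<bar>x\<bar> ^ k * exp (- (a * x\<^sup>2))) + \<bar>x\<bar> ^ Suc k * norm (?g p x)"
        using assms(2) by (simp add: norm_mult nrm algebra_simps)
      also have "\<dots> \<le> norm c * C1 + C2"
        using C1 C2 by (intro add_mono mult_left_mono) auto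
      finally show "\<bar>x\<bar> ^ k * norm (?g (pCons c p) x) \<le> norm c * C1 + C2" .
    qed
  qed auto
  have "?g q differentiable at x" for q x
    using der[of q x] by (rule differentiableI_vector)
  then show ?thesis
    unfolding schwartz_def mem_Collect_eq nth using bd by blast
qed

section \<open>Modulated Gaussians as test functions\<close>

definition wave_packet :: "real \<Rightarrow> real \<Rightarrow> real \<Rightarrow> complex" where
  "wave_packet s \<eta> x = complex_of_real (normal_density 0 s x) * cis (2 * pi * \<eta> * x)"

lemma wave_packet_schwartz:
  assumes "s > 0"
  shows "wave_packet s \<eta> \<in> schwartz"
proof -
  let ?c = "1 / sqrt (2 * pi * s\<^sup>2)" and ?a = "1 / (2 * s\<^sup>2)"
  have "(\<lambda>x. poly [:of_real ?c:] (of_real x) * exp (\<i> * (2 * pi * \<eta>) * of_real x - of_real ?a * (of_real x)\<^sup>2)) \<in> schwartz"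
    using assms by (intro gauss_in_schwartz) auto
  moreover have "wave_packet s \<eta> = (\<lambda>x. poly [:of_real ?c:] (of_real x) * exp (\<i> * (2 * pi * \<eta>) * of_real x - of_real ?a * (of_real x)\<^sup>2))"
  proof
    fix x
    have "exp (\<i> * (2 * pi * \<eta>) * of_real x - of_real ?a * (of_real x)\<^sup>2)
        = exp (\<i> * of_real (2 * pi * \<eta> * x) + of_real (- (?a * x\<^sup>2)))"
      by (intro arg_cong[where f = exp]) (simp add: mult_ac)
    also have "\<dots> = cis (2 * pi * \<eta> * x) * of_real (exp (- (?a * x\<^sup>2)))"
      unfolding exp_add cis_conv_exp exp_of_real ..
    finally show "wave_packet s \<eta> x = poly [:of_real ?c:] (of_real x) * exp (\<i> * (2 * pi * \<eta>) * of_real x - of_real ?a * (of_real x)\<^sup>2)"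
      by (simp add: wave_packet_def normal_density_def)
  qed
  ultimately show ?thesis by (simp only:)
qed

lemma fourier_wave_packet:
  assumes "s > 0"
  shows "fourier (wave_packet s \<eta>) \<xi> = gauss_hat s (\<xi> - \<eta>)"
proof -
  have "fourier (wave_packet s \<eta>) \<xi> = fourier (\<lambda>x. complex_of_real (normal_density 0 s x) * cis (2 * pi * x * \<eta>)) \<xi>"
    by (simp add: wave_packet_def[abs_def] mult_ac)
  then show ?thesis using assms by (simp add: fourier_mult_cis fourier_normal_density)
qed

section \<open>Multipliers of square integrable functions on the line\<close>

text \<open>Since \<open>P\<close> is arbitrary, it is the Borel null set covering its failures that
  is transported by the affine map.\<close>

lemma AE_lborel_affine:
  fixes P :: "real \<Rightarrow> bool"
  assumes "AE x in lborel. P x" "c \<noteq> 0"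
  shows "AE x in lborel. P (t + c * x)"
proof -
  obtain N where N: "N \<in> null_sets lborel" "{x. \<not> P x} \<subseteq> N"
    using assms(1) by (auto simp: eventually_ae_filter)
  have [measurable]: "N \<in> sets borel" using N(1) by auto
  have "AE x in lborel. x \<notin> N" using N(1) by (rule AE_not_in)
  then have "AE x in lborel. t + c * x \<notin> N"
    using assms(2) by (intro AE_borel_affine) auto
  then show ?thesis by eventually_elim (use N(2) in auto)
qed

lemma AE_lborel_reflect:
  assumes "AE x in lborel. P (x :: real)"
  shows "AE x in lborel. P (- x)"
  using AE_lborel_affine[OF assms, of "- 1" 0] by simp

lemma AE_lborel_translate:
  assumes "AE x in lborel. P (x :: real)"
  shows "AE x in lborel. P (x + t)"
  using AE_lborel_affine[OF assms, of 1 t] by (simp add: add.commute)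

lemma sqnorm_reflect:
  fixes f :: "real \<Rightarrow> complex"
  assumes [measurable]: "f \<in> borel_measurable borel"
  shows "sqnorm lborel (\<lambda>x. f (- x)) = sqnorm lborel f"
  using nn_integral_real_affine[of "\<lambda>x. ennreal ((norm (f x))\<^sup>2)" "- 1" 0] by (simp add: sqnorm_def)

lemma Lp_norm_2_le:
  assumes "f \<in> borel_measurable M" "g \<in> borel_measurable M" "sqnorm M g < \<infinity>"
    and le: "sqnorm M f \<le> ennreal (C\<^sup>2) * sqnorm M g" and "C \<ge> 0"
  shows "Lp_norm 2 M f \<le> C * Lp_norm 2 M g"
proof -
  have "enn2real (sqnorm M f) \<le> enn2real (ennreal (C\<^sup>2) * sqnorm M g)"
    using assms(3) by (intro enn2real_mono[OF le]) (auto simp: ennreal_mult_less_top)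
  then have "sqrt (enn2real (sqnorm M f)) \<le> sqrt (C\<^sup>2 * enn2real (sqnorm M g))"
    by (simp add: enn2real_mult)
  then show ?thesis using assms by (simp add: Lp_norm_2 real_sqrt_mult)
qed

lemma Lp_norm_2_leD:
  assumes "f \<in> Lp_space 2 M" "g \<in> Lp_space 2 M"
    and le: "Lp_norm 2 M f \<le> C * Lp_norm 2 M g" and "C \<ge> 0"
  shows "sqnorm M f \<le> ennreal (C\<^sup>2) * sqnorm M g"
proof -
  let ?a = "enn2real (sqnorm M f)" and ?b = "enn2real (sqnorm M g)"
  have "sqrt ?a \<le> C * sqrt ?b"
    using assms by (simp add: Lp_norm_2 Lp_space_2)
  then have "(sqrt ?a)\<^sup>2 \<le> (C * sqrt ?b)\<^sup>2" by (intro power_mono) auto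
  then have "?a \<le> C\<^sup>2 * ?b" by (simp add: power_mult_distrib)
  moreover have "sqnorm M f = ennreal ?a" "sqnorm M g = ennreal ?b"
    using assms(1,2) by (auto simp: Lp_space_2)
  ultimately show ?thesis by (metis ennreal_leI ennreal_mult' zero_le_power2)
qed

text \<open>The operator multiplies the L2 transform by \<open>m\<close> and transforms back, the
  inverse transform being the reflected transform. Multiplication by \<open>m\<close> costs the
  factor \<open>C\<close>, the two transforms cost nothing.\<close>

lemma extends_multiplier_R_L2:
  assumes m: "m \<in> borel_measurable lebesgue" and bd: "AE \<xi> in lborel. norm (m \<xi>) \<le> C" and "C \<ge> 0"
  obtains T where "extends_multiplier_R 2 m T" "Lp_onorm 2 lebesgue T \<le> C"
proof -
  define S where "S f = (\<lambda>\<xi>. m \<xi> * L2_fourier f \<xi>)" for f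
  define T where "T f = (\<lambda>x. L2_fourier (S f) (- x))" for f
  have S_meas: "S f \<in> borel_measurable lebesgue"
    and S_sq: "sqnorm lborel (S f) \<le> ennreal (C\<^sup>2) * sqnorm lborel f"
    and S_fin: "sqnorm lborel (S f) < \<infinity>" if f: "f \<in> Lp_space 2 lebesgue" for f
  proof -
    have f': "f \<in> borel_measurable lebesgue" "sqnorm lborel f < \<infinity>" using f by (auto simp: Lp_space_2)
    have [measurable]: "L2_fourier f \<in> borel_measurable borel" using f' by (rule L2_fourier_measurable)
    show "S f \<in> borel_measurable lebesgue"
      unfolding S_def by (intro borel_measurable_times m borel_measurable_lebesgueI) measurable
    have "sqnorm lborel (S f) \<le> sqnorm lborel (\<lambda>\<xi>. complex_of_real C * L2_fourier f \<xi>)"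
      using bd by (intro sqnorm_mono_AE, eventually_elim) (use \<open>C \<ge> 0\<close> in \<open>auto simp: S_def norm_mult intro!: mult_right_mono\<close>)
    also have "\<dots> = ennreal (C\<^sup>2) * sqnorm lborel (L2_fourier f)"
      by (subst sqnorm_cmult) auto
    also have "\<dots> \<le> ennreal (C\<^sup>2) * sqnorm lborel f"
      using f' by (intro mult_left_mono sqnorm_L2_fourier_le) auto
    finally show le: "sqnorm lborel (S f) \<le> ennreal (C\<^sup>2) * sqnorm lborel f" .
    also have "\<dots> < \<infinity>" using f' by (auto simp: ennreal_mult_less_top)
    finally show "sqnorm lborel (S f) < \<infinity>" .
  qed
  have T_meas: "T f \<in> borel_measurable borel" if "f \<in> Lp_space 2 lebesgue" for f
    using L2_fourier_measurable[OF S_meas[OF that] S_fin[OF that]]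
    unfolding T_def by measurable
  have T_sq: "sqnorm lborel (T f) \<le> ennreal (C\<^sup>2) * sqnorm lborel f" if f: "f \<in> Lp_space 2 lebesgue" for f
    using sqnorm_L2_fourier_le[OF S_meas[OF f] S_fin[OF f]] S_sq[OF f]
      L2_fourier_measurable[OF S_meas[OF f] S_fin[OF f]]
    unfolding T_def by (simp add: sqnorm_reflect)
  have norm_le: "Lp_norm 2 lebesgue (T f) \<le> C * Lp_norm 2 lebesgue f" if f: "f \<in> Lp_space 2 lebesgue" for f
    using f T_sq[OF f] T_meas[OF f] \<open>C \<ge> 0\<close>
    by (intro Lp_norm_2_le) (auto simp: Lp_space_2 intro: borel_measurable_lebesgueI)
  have T_Lp: "T f \<in> Lp_space 2 lebesgue" if f: "f \<in> Lp_space 2 lebesgue" for f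
    using f order.strict_trans1[OF T_sq[OF f]] T_meas[OF f]
    by (auto simp: Lp_space_2 ennreal_mult_less_top intro: borel_measurable_lebesgueI)
  have add: "AE x in lebesgue. T (\<lambda>y. f y + g y) x = T f x + T g x"
    if f: "f \<in> Lp_space 2 lebesgue" and g: "g \<in> Lp_space 2 lebesgue" for f g
  proof -
    have f': "f \<in> borel_measurable lebesgue" "sqnorm lborel f < \<infinity>" using f by (auto simp: Lp_space_2)
    have g': "g \<in> borel_measurable lebesgue" "sqnorm lborel g < \<infinity>" using g by (auto simp: Lp_space_2)
    have fg: "(\<lambda>y. f y + g y) \<in> Lp_space 2 lebesgue"
      unfolding Lp_space_2
    proof
      show "(\<lambda>y. f y + g y) \<in> borel_measurable lebesgue" using f'(1) g'(1) by (rule borel_measurable_add)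
      show "sqnorm lebesgue (\<lambda>y. f y + g y) < \<infinity>"
        using order.strict_trans1[OF sqnorm_add_le[OF f'(1) g'(1)]] f'(2) g'(2) by (simp add: ennreal_mult_less_top)
    qed
    have "AE \<xi> in lborel. S (\<lambda>y. f y + g y) \<xi> = S f \<xi> + S g \<xi>"
      using L2_fourier_add[OF f' g'] by eventually_elim (simp add: S_def distrib_left)
    \<comment> \<open>Almost everywhere additivity of \<open>S\<close> becomes an identity of
      functions under the outer transform.\<close>
    then have "L2_fourier (S (\<lambda>y. f y + g y)) = L2_fourier (\<lambda>\<xi>. S f \<xi> + S g \<xi>)"
      by (intro L2_fourier_cong_AE S_meas fg borel_measurable_add f g)
    then have "AE x in lborel. L2_fourier (S (\<lambda>y. f y + g y)) x = L2_fourier (S f) x + L2_fourier (S g) x"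
      using L2_fourier_add[OF S_meas[OF f] S_fin[OF f] S_meas[OF g] S_fin[OF g]] by simp
    from AE_completion[OF AE_lborel_reflect[OF this]] show ?thesis by (simp add: T_def)
  qed
  have cmult: "AE x in lebesgue. T (\<lambda>y. c * f y) x = c * T f x" if f: "f \<in> Lp_space 2 lebesgue" for f c
  proof -
    have f': "f \<in> borel_measurable lebesgue" "sqnorm lborel f < \<infinity>" using f by (auto simp: Lp_space_2)
    have cf: "(\<lambda>y. c * f y) \<in> Lp_space 2 lebesgue"
      unfolding Lp_space_2 using f' sqnorm_cmult[OF f'(1), of c] by (auto simp: ennreal_mult_less_top)
    have "AE \<xi> in lborel. S (\<lambda>y. c * f y) \<xi> = c * S f \<xi>"
      using L2_fourier_cmult[OF f', of c] by eventually_elim (simp add: S_def)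
    then have "L2_fourier (S (\<lambda>y. c * f y)) = L2_fourier (\<lambda>\<xi>. c * S f \<xi>)"
      by (intro L2_fourier_cong_AE S_meas cf borel_measurable_times f) auto
    then have "AE x in lborel. L2_fourier (S (\<lambda>y. c * f y)) x = c * L2_fourier (S f) x"
      using L2_fourier_cmult[OF S_meas[OF f] S_fin[OF f], of c] by simp
    from AE_completion[OF AE_lborel_reflect[OF this]] show ?thesis by (simp add: T_def)
  qed
  have ext: "AE x in lebesgue. T f x = inv_fourier (\<lambda>\<xi>. m \<xi> * fourier f \<xi>) x" if f: "f \<in> schwartz" for f
  proof -
    have int: "integrable lborel f" using schwartz_integrable[OF f, of 0] by simp
    have [measurable]: "f \<in> borel_measurable borel" "fourier f \<in> borel_measurable borel"
      using int borel_measurable_fourier by auto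
    have fin: "sqnorm lborel f < \<infinity>"
      using schwartz_bounded[OF f] sqnorm_bounded_integrable[OF int] by auto
    obtain m' where m' [measurable]: "m' \<in> borel_measurable borel" and mm': "AE x in lborel. m x = m' x"
      using lebesgue_borel_rep[OF m] by blast
    let ?g = "\<lambda>\<xi>. m' \<xi> * fourier f \<xi>"
    have g: "?g \<in> borel_measurable borel" by measurable
    have mf: "(\<lambda>\<xi>. m \<xi> * fourier f \<xi>) \<in> borel_measurable lebesgue"
      by (intro borel_measurable_times m borel_measurable_lebesgueI) measurable
    have ae: "AE \<xi> in lborel. S f \<xi> = ?g \<xi>"
      using L2_fourier_eq_fourier[OF int fin] mm' by eventually_elim (simp add: S_def)
    have fL: "f \<in> Lp_space 2 lebesgue"
      using fin by (auto simp: Lp_space_2 intro: borel_measurable_lebesgueI)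
    have 1: "L2_fourier (S f) = L2_fourier ?g"
      using ae by (intro L2_fourier_cong_AE S_meas fL borel_measurable_lebesgueI g)
    \<comment> \<open>A bounded symbol times the integrable transform of a Schwartz function is
      integrable, so the outer L2 transform is given by the integral in
      \<open>inv_fourier\<close>.\<close>
    have "integrable lborel (\<lambda>\<xi>. C * norm (fourier f \<xi>))"
      using integrable_fourier_schwartz[OF f] by auto
    then have 2: "integrable lborel ?g"
    proof (rule Bochner_Integration.integrable_bound)
      show "AE \<xi> in lborel. norm (?g \<xi>) \<le> norm (C * norm (fourier f \<xi>))"
        using bd mm' by eventually_elim (use \<open>C \<ge> 0\<close> in \<open>auto simp: norm_mult abs_mult intro!: mult_right_mono\<close>)
    qed measurable
    have 3: "sqnorm lborel ?g < \<infinity>"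
      using sqnorm_cong_AE[OF ae] S_fin[OF fL] by simp
    have 4: "fourier ?g = fourier (\<lambda>\<xi>. m \<xi> * fourier f \<xi>)"
    proof (rule fourier_cong_AE[OF borel_measurable_lebesgueI[OF g] mf])
      show "AE x in lborel. m' x * fourier f x = m x * fourier f x"
        using mm' by eventually_elim simp
    qed
    show ?thesis
      using AE_completion[OF AE_lborel_reflect[OF L2_fourier_eq_fourier[OF 2 3]]]
      by (simp add: T_def inv_fourier_eq 1 4)
  qed
  show thesis
  proof
    show "extends_multiplier_R 2 m T"
      unfolding extends_multiplier_R_def bounded_Lp_operator_def
      using T_Lp add cmult norm_le ext by blast
    show "Lp_onorm 2 lebesgue T \<le> C"
      using norm_le \<open>C \<ge> 0\<close> by (rule Lp_onorm_le)
  qed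
qed

section \<open>Recovering an essential bound from Gaussian averages\<close>

lemma gauss_conv_add:
  assumes "integrable lborel (\<lambda>t. std_normal_density t *\<^sub>R f (x - s * t))"
    "integrable lborel (\<lambda>t. std_normal_density t *\<^sub>R g (x - s * t))"
  shows "gauss_conv s (\<lambda>x. f x + g x) x = gauss_conv s f x + gauss_conv s g x"
  using assms by (simp add: gauss_conv_def scaleR_add_right)

lemma integrable_gauss_bounded:
  assumes [measurable]: "f \<in> borel_measurable borel" and "\<And>x. norm (f x) \<le> B"
  shows "integrable lborel (\<lambda>t. std_normal_density t *\<^sub>R (f (x - s * t) :: complex))"
proof (rule Bochner_Integration.integrable_bound)
  show "integrable lborel (\<lambda>t. std_normal_density t * B)" by auto
qed (use assms(2) in \<open>auto intro!: always_eventually mult_left_mono order_trans[OF _ abs_ge_self] simp: abs_mult\<close>)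

text \<open>Inside \<open>{-R<..<R}\<close> the function cut off at \<open>\<plusminus>R\<close> has asymptotically the same Gaussian averages,
  since the remainder vanishes near the point; the cut-off function is approximated in \<open>L\<^sup>1\<close>.\<close>

lemma bounded_if_gauss_conv_bounded:
  assumes [measurable]: "f \<in> borel_measurable borel" and B: "\<And>x. norm (f x) \<le> B"
    and K: "\<And>s x. s > 0 \<Longrightarrow> norm (gauss_conv s f x) \<le> K"
  shows "AE x in lborel. norm (f x) \<le> K"
proof -
  let ?s = "\<lambda>n. inverse (real (Suc n))"
  have "AE x in lborel. \<bar>x\<bar> < real R \<longrightarrow> norm (f x) \<le> K" for R :: nat
  proof -
    let ?g = "truncate f R"
    have gB: "norm (?g x) \<le> B" and fgB: "norm (f x - ?g x) \<le> B" for x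
      using B[of x] order_trans[OF norm_ge_zero B[of x]] by (auto simp: truncate_def indicator_def)
    have g: "integrable lborel ?g"
    proof (rule Bochner_Integration.integrable_bound)
      show "integrable lborel (\<lambda>x. indicator {- real R..real R} x * B)" by simp
    qed (use B in \<open>auto simp: truncate_def indicator_def intro!: always_eventually intro: order_trans[OF _ abs_ge_self]\<close>)
    let ?D = "\<lambda>n x. ennreal (norm (gauss_conv (?s n) ?g x - ?g x))"
    \<comment> \<open>By Fatou's lemma the error has lower limit 0 almost everywhere, which is
      enough for the contradiction below.\<close>
    have "(\<integral>\<^sup>+x. liminf (\<lambda>n. ?D n x) \<partial>lborel) \<le> liminf (\<lambda>n. \<integral>\<^sup>+x. ?D n x \<partial>lborel)"
      by (rule nn_integral_liminf) measurable
    also have "\<dots> = 0"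
      by (intro lim_imp_Liminf gauss_conv_L1_tendsto g inverse_Suc_tendsto) auto
    finally have "(\<integral>\<^sup>+x. liminf (\<lambda>n. ?D n x) \<partial>lborel) = 0" by simp
    then have "AE x in lborel. liminf (\<lambda>n. ?D n x) = 0"
      by (subst (asm) nn_integral_0_iff_AE) measurable
    then show ?thesis
    proof (eventually_elim, intro impI)
      fix x assume D0: "liminf (\<lambda>n. ?D n x) = 0" and x: "\<bar>x\<bar> < real R"
      show "norm (f x) \<le> K"
      proof (rule ccontr)
        assume "\<not> norm (f x) \<le> K"
        \<comment> \<open>Half of the excess over \<open>K\<close>: one \<open>e\<close> absorbs the
          average of the remainder \<open>?h\<close>, the other persists as an error
          \<open>?D n x\<close> of at least \<open>e\<close>.\<close>
        define e where "e = (norm (f x) - K) / 2"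
        with \<open>\<not> norm (f x) \<le> K\<close> have e: "e > 0" "norm (f x) = K + 2 * e" by auto
        let ?h = "\<lambda>x. f x - ?g x"
        have ev: "\<forall>\<^sub>F y in nhds x. ?h y = 0"
        proof -
          have "\<forall>\<^sub>F y in nhds x. y \<in> {- real R<..<real R}"
            using x by (intro eventually_nhds_in_open) auto
          then show ?thesis by eventually_elim (auto simp: truncate_def)
        qed
        have "(\<lambda>n. gauss_conv (?s n) ?h x) \<longlonglongrightarrow> ?h x"
        proof (rule gauss_conv_tendsto[OF _ fgB _ inverse_Suc_tendsto])
          show "isCont ?h x"
            using ev by (subst isCont_cong[of _ "\<lambda>_. 0"]) auto
        qed measurable
        also have "?h x = 0" using x by (auto simp: truncate_def indicator_def abs_less_iff)
        finally have "\<forall>\<^sub>F n in sequentially. dist (gauss_conv (?s n) ?h x) 0 < e"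
          using e(1) by (rule tendstoD)
        then have "\<forall>\<^sub>F n in sequentially. ennreal e \<le> ?D n x"
        proof eventually_elim
          case (elim n)
          have "gauss_conv (?s n) f x = gauss_conv (?s n) (\<lambda>x. ?g x + ?h x) x" by simp
          also have "\<dots> = gauss_conv (?s n) ?g x + gauss_conv (?s n) ?h x"
            by (intro gauss_conv_add integrable_gauss_bounded[OF _ gB] integrable_gauss_bounded[OF _ fgB]) measurable
          finally have "gauss_conv (?s n) ?g x = gauss_conv (?s n) f x - gauss_conv (?s n) ?h x" by simp
          then have "norm (gauss_conv (?s n) ?g x) \<le> K + e"
            using norm_triangle_ineq4[of "gauss_conv (?s n) f x" "gauss_conv (?s n) ?h x"] K[of "?s n" x] elim by simp
          moreover have "norm (?g x) = K + 2 * e" using e x by (auto simp: truncate_def indicator_def abs_less_iff)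
          ultimately have "e \<le> norm (gauss_conv (?s n) ?g x - ?g x)"
            using norm_triangle_ineq2[of "?g x" "gauss_conv (?s n) ?g x"] by (simp add: norm_minus_commute)
          then show ?case by (rule ennreal_leI)
        qed
        then have "ennreal e \<le> liminf (\<lambda>n. ?D n x)" by (rule Liminf_bounded)
        with D0 e(1) show False by simp
      qed
    qed
  qed
  then have "AE x in lborel. \<forall>R :: nat. \<bar>x\<bar> < real R \<longrightarrow> norm (f x) \<le> K"
    by (subst AE_all_countable) blast
  then show ?thesis
    by eventually_elim (meson reals_Archimedean2)
qed

lemma gauss_hat_square: "(gauss_hat s \<xi>)\<^sup>2 = gauss_hat (sqrt 2 * s) \<xi>"
  unfolding gauss_hat_def by (simp add: power_mult_distrib flip: exp_of_nat_mult)

text \<open>Testing \<open>m\<close> against a wave packet at frequency \<open>\<eta>\<close> gives a Gaussian average of \<open>m\<close> around \<open>\<eta>\<close>.\<close>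

lemma extends_multiplier_R_L2_bound:
  assumes T: "extends_multiplier_R 2 m T" and m: "m \<in> Linfty_space lebesgue"
  shows "AE \<xi> in lborel. norm (m \<xi>) \<le> Lp_onorm 2 lebesgue T"
proof -
  define K where "K = Lp_onorm 2 lebesgue T"
  have Tb: "bounded_Lp_operator 2 lebesgue T" using T by (simp add: extends_multiplier_R_def)
  have K0: "K \<ge> 0" unfolding K_def using Tb by (rule Lp_onorm_nonneg)
  from m obtain B where mm: "m \<in> borel_measurable lebesgue" and "AE \<xi> in lebesgue. norm (m \<xi>) \<le> B"
    by (auto simp: Linfty_space_def)
  then have B: "AE \<xi> in lborel. norm (m \<xi>) \<le> B" by (simp add: AE_completion_iff)
  obtain m0 where [measurable]: "m0 \<in> borel_measurable borel" and mm0: "AE x in lborel. m x = m0 x"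
    using lebesgue_borel_rep[OF mm] by blast
  \<comment> \<open>A version bounded everywhere; with \<open>\<bar>B\<bar>\<close> rather than
    \<open>B\<close> the value 0 obeys the bound as well.\<close>
  define m' where "m' \<xi> = (if norm (m0 \<xi>) \<le> \<bar>B\<bar> then m0 \<xi> else 0)" for \<xi>
  have m' [measurable]: "m' \<in> borel_measurable borel" unfolding m'_def[abs_def] by measurable
  have m'B: "norm (m' \<xi>) \<le> \<bar>B\<bar>" for \<xi> by (auto simp: m'_def)
  have mm': "AE x in lborel. m x = m' x"
    using mm0 B by eventually_elim (auto simp: m'_def)
  have K: "norm (gauss_conv \<sigma> m' \<eta>) \<le> K" if "\<sigma> > 0" for \<sigma> \<eta>
  proof -
    \<comment> \<open>Testing squares the Gaussian, and \<open>(gauss_hat s \<xi>)\<^sup>2\<close>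
      is a multiple of the normal density of width \<open>1 / (2 * pi * (sqrt 2 * s))\<close>. This
      \<open>s\<close> makes the width equal to \<open>\<sigma>\<close>.\<close>
    define s where "s = 1 / (sqrt 2 * (2 * pi * \<sigma>))"
    have s: "s > 0" using that by (simp add: s_def)
    let ?f = "wave_packet s \<eta>" and ?g = "\<lambda>\<xi>. m' \<xi> * fourier (wave_packet s \<eta>) \<xi>"
    have f: "?f \<in> schwartz" using s by (rule wave_packet_schwartz)
    have fint: "integrable lborel ?f" using schwartz_integrable[OF f, of 0] by simp
    have [measurable]: "?f \<in> borel_measurable borel" "fourier ?f \<in> borel_measurable borel"
      using fint borel_measurable_fourier by auto
    have ffint: "integrable lborel (fourier ?f)" using f by (rule integrable_fourier_schwartz)
    have "integrable lborel (\<lambda>\<xi>. \<bar>B\<bar> * norm (fourier ?f \<xi>))" using ffint by auto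
    then have gint: "integrable lborel ?g"
      by (rule Bochner_Integration.integrable_bound) (auto simp: norm_mult abs_mult intro!: mult_right_mono m'B)
    have [measurable]: "fourier ?g \<in> borel_measurable borel" using gint by (rule borel_measurable_fourier)
    have fL: "?f \<in> Lp_space 2 lebesgue"
      using schwartz_bounded[OF f] sqnorm_bounded_integrable[OF fint]
      by (auto simp: Lp_space_2 intro: borel_measurable_lebesgueI)
    have Tf: "AE x in lborel. T ?f x = fourier ?g (- x)"
    proof -
      have "fourier (\<lambda>\<xi>. m \<xi> * fourier ?f \<xi>) = fourier ?g"
      proof (rule fourier_cong_AE)
        show "(\<lambda>\<xi>. m \<xi> * fourier ?f \<xi>) \<in> borel_measurable lebesgue"
          by (intro borel_measurable_times mm borel_measurable_lebesgueI) measurable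
        show "?g \<in> borel_measurable lebesgue"
          by (intro borel_measurable_lebesgueI) measurable
        show "AE x in lborel. m x * fourier ?f x = m' x * fourier ?f x"
          using mm' by eventually_elim simp
      qed
      then show ?thesis
        using T f by (auto simp: extends_multiplier_R_def AE_completion_iff inv_fourier_eq)
    qed
    have sqT: "sqnorm lborel (\<lambda>x. fourier ?g x) \<le> ennreal (K\<^sup>2) * sqnorm lborel ?f"
    proof -
      have "sqnorm lebesgue (T ?f) \<le> ennreal (K\<^sup>2) * sqnorm lebesgue ?f"
        using Tb fL K0 unfolding K_def
        by (intro Lp_norm_2_leD Lp_onorm_bound) (auto simp: bounded_Lp_operator_def)
      then show ?thesis
        using sqnorm_cong_AE[OF Tf] by (simp add: sqnorm_reflect)
    qed
    let ?A = "LINT \<xi>|lborel. (gauss_hat s (\<xi> - \<eta>))\<^sup>2"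
    have sqf: "sqnorm lborel ?f \<le> ennreal ?A"
    proof -
      have "?f = (\<lambda>x. fourier (fourier ?f) (- x))"
        using schwartz_inversion[OF f] by blast
      then have "sqnorm lborel ?f = sqnorm lborel (\<lambda>x. fourier (fourier ?f) (- x))" by simp
      also have "\<dots> = sqnorm lborel (fourier (fourier ?f))"
        using borel_measurable_fourier[OF ffint] by (rule sqnorm_reflect)
      also have "\<dots> \<le> sqnorm lborel (fourier ?f)"
        using fourier_L2_le[OF ffint] by (simp add: sqnorm_def)
      also have "\<dots> = (\<integral>\<^sup>+\<xi>. ennreal ((gauss_hat s (\<xi> - \<eta>))\<^sup>2) \<partial>lborel)"
        by (simp add: sqnorm_def fourier_wave_packet[OF s])
      also have "\<dots> = ennreal ?A"
        unfolding gauss_hat_square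
        using s integrable_translate[OF integrable_gauss_hat[of "sqrt 2 * s"], of \<eta>]
        by (intro nn_integral_eq_integral) auto
      finally show ?thesis .
    qed
    have A0: "?A \<ge> 0" by (intro integral_nonneg_AE) simp
    \<comment> \<open>The pairing of the reflected \<open>T ?f\<close> with \<open>?f\<close>.
      Cauchy-Schwarz bounds it by \<open>K * ?A\<close>; the multiplication formula shows that it is
      the integral of \<open>m'\<close> against a Gaussian of total mass \<open>?A\<close>. The mass
      cancels, leaving the bound \<open>K\<close> for an average of \<open>m'\<close>.\<close>
    let ?I = "LINT x|lborel. fourier ?g x * ?f x"
    have "ennreal (norm ?I) \<le> (\<integral>\<^sup>+x. ennreal (norm (fourier ?g x)) * ennreal (norm (?f x)) \<partial>lborel)"
    proof -
      define L where "L = (LINT \<xi>|lborel. norm (?g \<xi>))"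
      have "integrable lborel (\<lambda>x. L * norm (?f x))" using fint by auto
      then have "integrable lborel (\<lambda>x. fourier ?g x * ?f x)"
      proof (rule Bochner_Integration.integrable_bound)
        show "AE x in lborel. norm (fourier ?g x * ?f x) \<le> norm (L * norm (?f x))"
        proof (intro always_eventually allI)
          fix x
          have "norm (fourier ?g x) * norm (?f x) \<le> L * norm (?f x)"
            unfolding L_def by (intro mult_right_mono norm_fourier_le gint norm_ge_zero)
          then show "norm (fourier ?g x * ?f x) \<le> norm (L * norm (?f x))"
            unfolding norm_mult real_norm_def by (rule order_trans[OF _ abs_ge_self])
        qed
      qed measurable
      from integral_norm_bound_ennreal[OF this] show ?thesis by (simp add: norm_mult ennreal_mult'')
    qed
    then have "(ennreal (norm ?I))\<^sup>2 \<le> (\<integral>\<^sup>+x. ennreal (norm (fourier ?g x)) * ennreal (norm (?f x)) \<partial>lborel)\<^sup>2"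
      by (rule power_mono) simp
    also have "\<dots> \<le> sqnorm lborel (fourier ?g) * sqnorm lborel ?f"
      unfolding sqnorm_def by (rule order_trans[OF Cauchy_Schwarz_nn_integral]) (auto simp: ennreal_power)
    also have "\<dots> \<le> (ennreal (K\<^sup>2) * ennreal ?A) * ennreal ?A"
      by (intro mult_mono order_trans[OF sqT] sqf) auto
    also have "\<dots> = ennreal ((K * ?A)\<^sup>2)"
      using A0 by (simp add: ennreal_mult'[symmetric] power2_eq_square mult_ac)
    finally have "(norm ?I)\<^sup>2 \<le> (K * ?A)\<^sup>2"
      unfolding ennreal_power[OF norm_ge_zero] by (simp only: ennreal_le_iff zero_le_power2)
    then have I: "norm ?I \<le> K * ?A"
      using mult_nonneg_nonneg[OF K0 A0] by (rule power2_le_imp_le)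
    have "?I = (LINT \<xi>|lborel. ?g \<xi> * fourier ?f \<xi>)"
      by (rule integral_fourier_mult[OF gint fint])
    also have "\<dots> = (LINT \<xi>|lborel. m' \<xi> * complex_of_real ((gauss_hat s (\<xi> - \<eta>))\<^sup>2))"
      by (simp add: fourier_wave_packet[OF s] power2_eq_square mult_ac)
    finally have I2: "?I = (LINT \<xi>|lborel. m' \<xi> * complex_of_real ((gauss_hat s (\<xi> - \<eta>))\<^sup>2))" .
    define c where "c = sqrt (2 * pi) / (2 * pi * (sqrt 2 * s))"
    have c: "c > 0" using s by (simp add: c_def)
    have sig: "1 / (2 * pi * (sqrt 2 * s)) = \<sigma>" using that by (simp add: s_def)
    have sq: "(gauss_hat s (\<xi> - \<eta>))\<^sup>2 = c * normal_density 0 \<sigma> (\<xi> - \<eta>)" for \<xi>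
      unfolding gauss_hat_square using gauss_hat_eq[of "sqrt 2 * s" "\<xi> - \<eta>"] s by (simp add: sig c_def)
    have A: "?A = c * 1"
      unfolding sq using that integral_translate[of "normal_density 0 \<sigma>" \<eta>] by simp
    have I3: "?I = c * gauss_conv \<sigma> m' \<eta>"
      unfolding I2 sq gauss_conv_eq_integral[OF that] by (simp add: mult.left_commute[of "m' _"])
    have "norm (complex_of_real c * gauss_conv \<sigma> m' \<eta>) \<le> K * (c * 1)"
      using I unfolding A I3 .
    then have "c * norm (gauss_conv \<sigma> m' \<eta>) \<le> c * K"
      using c unfolding norm_mult norm_of_real by (simp add: mult.commute)
    then show ?thesis using c by (rule mult_left_le_imp_le)
  qed
  have "AE \<xi> in lborel. norm (m' \<xi>) \<le> K"
    using m' m'B K by (rule bounded_if_gauss_conv_bounded)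
  with mm' have "AE \<xi> in lborel. norm (m \<xi>) \<le> K" by eventually_elim (simp only:)
  then show ?thesis unfolding K_def .
qed

section \<open>Multipliers on the torus\<close>

definition trig_poly :: "int set \<Rightarrow> (int \<Rightarrow> complex) \<Rightarrow> real \<Rightarrow> complex" where
  "trig_poly A a x = (\<Sum>n\<in>A. a n * cis (2 * pi * of_int n * x))"

lemma trig_poly_in_trig_polys: "finite A \<Longrightarrow> trig_poly A a \<in> trig_polys"
  unfolding trig_polys_def trig_poly_def[abs_def] by blast

lemma borel_measurable_trig_poly [measurable]: "trig_poly A a \<in> borel_measurable borel"
  unfolding trig_poly_def[abs_def] by measurable

lemma norm_trig_poly_le: "norm (trig_poly A a x) \<le> (\<Sum>n\<in>A. norm (a n))"
  unfolding trig_poly_def by (rule order_trans[OF norm_sum]) (simp add: norm_mult)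

lemma trig_poly_periodic: "trig_poly A a (x + 1) = trig_poly A a x"
proof -
  have "cis (2 * pi * of_int n * (x + 1)) = cis (2 * pi * of_int n * x)" for n
    using cis_multiple_2pi[of "of_int n"] by (simp add: distrib_left mult_ac flip: cis_mult)
  then show ?thesis by (simp add: trig_poly_def)
qed

lemma trig_poly_periodic_int: "trig_poly A a (x + of_int k) = trig_poly A a x"
proof -
  have "cis (2 * pi * of_int n * (x + of_int k)) = cis (2 * pi * of_int n * x)" for n
    using cis_multiple_2pi[of "of_int n * of_int k"] by (simp add: distrib_left mult_ac flip: cis_mult)
  then show ?thesis by (simp add: trig_poly_def)
qed

section \<open>Integration and Fourier coefficients on the torus\<close>

lemma space_torus: "space torus = {0..<1}"
  by (simp add: space_restrict_space)

interpretation torus: prob_space torus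
proof
  show "emeasure torus (space torus) = 1"
    by (simp add: space_torus emeasure_restrict_space)
qed

lemma measure_torus [simp]: "measure torus {0..<1} = 1"
  using torus.prob_space by (simp add: space_torus)

lemma borel_measurable_torusI: "f \<in> borel_measurable borel \<Longrightarrow> f \<in> borel_measurable torus"
  by (intro measurable_restrict_space1 borel_measurable_lebesgueI)

lemma nn_integral_torus:
  "(\<integral>\<^sup>+x. f x \<partial>torus) = (\<integral>\<^sup>+x. f x * indicator {0..<1} x \<partial>lborel)"
  by (subst nn_integral_restrict_space) (auto simp: nn_integral_completion)

lemma integral_torus:
  fixes f :: "real \<Rightarrow> 'a :: {banach, second_countable_topology}"
  assumes "f \<in> borel_measurable borel"
  shows "(LINT x|torus. f x) = (LINT x|lborel. indicator {0..<1} x *\<^sub>R f x)"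
proof -
  have "(LINT x|torus. f x) = (LINT x|lebesgue. indicator {0..<1} x *\<^sub>R f x)"
    by (subst integral_restrict_space) (auto simp: set_lebesgue_integral_def)
  then show ?thesis using assms by (subst (asm) integral_completion) auto
qed

lemma integrable_torus_bounded:
  fixes f :: "real \<Rightarrow> 'a :: {banach, second_countable_topology}"
  assumes "f \<in> borel_measurable torus" "\<And>x. norm (f x) \<le> B"
  shows "integrable torus f"
  using assms by (intro torus.integrable_const_bound[of _ B]) auto

lemma integral_torus_cis: "(LINT x|torus. cis (2 * pi * of_int n * x)) = (if n = 0 then 1 else 0)"
proof (cases "n = 0")
  case True
  then show ?thesis by simp
next
  case False
  define w where "w = 2 * pi * \<i> * of_int n"
  have w: "w \<noteq> 0" using False by (simp add: w_def)
  have eq: "cis (2 * pi * of_int n * x) = exp (of_real x * w)" for x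
    by (simp add: cis_conv_exp w_def mult_ac)
  have "(LINT x|torus. cis (2 * pi * of_int n * x)) = (LINT x|lborel. indicator {0..<1} x *\<^sub>R cis (2 * pi * of_int n * x))"
    by (rule integral_torus) measurable
  also have "\<dots> = (LINT x|lborel. indicator {0..1} x *\<^sub>R exp (of_real x * w))"
    unfolding eq
  proof (rule integral_cong_AE)
    show "AE x in lborel. indicator {0..<1} x *\<^sub>R exp (of_real x * w) = indicator {0..1} x *\<^sub>R exp (of_real x * w)"
      using AE_lborel_singleton[of 1] by eventually_elim (auto simp: indicator_def)
  qed measurable
  also have "\<dots> = exp (of_real 1 * w) / w - exp (of_real 0 * w) / w"
  proof (rule integral_FTC_atLeastAtMost)
    show "((\<lambda>x. exp (of_real x * w) / w) has_vector_derivative exp (of_real x * w)) (at x within {0..1})" for x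
      by (rule has_vector_derivative_real_field) (use w in \<open>auto intro!: derivative_eq_intros\<close>)
    show "continuous_on {0..1} (\<lambda>x. exp (complex_of_real x * w))"
      by (intro continuous_intros)
  qed simp
  also have "exp (of_real 1 * w) = 1"
    using eq[of 1] cis_multiple_2pi[of "of_int n"] by simp
  finally show ?thesis using False by simp
qed

lemma fourier_coeff_cis_mult:
  "cis (2 * pi * of_int k * x) * cis (- 2 * pi * of_int n * x) = cis (2 * pi * of_int (k - n) * x)"
  by (simp add: cis_mult algebra_simps)

lemma integrable_torus_cis: "integrable torus (\<lambda>x. c * cis (2 * pi * of_int n * x))"
proof (rule integrable_torus_bounded[of _ "norm c"])
  show "(\<lambda>x. c * cis (2 * pi * of_int n * x)) \<in> borel_measurable torus"
    by (rule borel_measurable_torusI) measurable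
qed (simp add: norm_mult)

lemma fourier_coeff_trig_poly:
  assumes "finite A"
  shows "fourier_coeff (trig_poly A a) n = (if n \<in> A then a n else 0)"
proof -
  have "fourier_coeff (trig_poly A a) n = (LINT x|torus. (\<Sum>k\<in>A. a k * cis (2 * pi * of_int (k - n) * x)))"
    unfolding fourier_coeff_def trig_poly_def sum_distrib_right mult.assoc
    by (simp only: fourier_coeff_cis_mult[simplified mult.assoc])
  also have "\<dots> = (\<Sum>k\<in>A. LINT x|torus. a k * cis (2 * pi * of_int (k - n) * x))"
    by (intro Bochner_Integration.integral_sum integrable_torus_cis)
  also have "\<dots> = (\<Sum>k\<in>A. a k * (if k = n then 1 else 0))"
    by (simp only: integral_mult_right_zero integral_torus_cis) simp
  also have "\<dots> = (if n \<in> A then a n else 0)"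
    using assms by (simp add: sum.If_cases if_distrib[of "\<lambda>x. _ * x"] cong: if_cong)
  finally show ?thesis .
qed

lemma integrable_torus_mult_cis:
  assumes "integrable torus f"
  shows "integrable torus (\<lambda>x. f x * cis (c * x) :: complex)"
proof (rule Bochner_Integration.integrable_bound[OF assms])
  have "(\<lambda>x. cis (c * x)) \<in> borel_measurable torus"
    by (rule borel_measurable_torusI) measurable
  then show "(\<lambda>x. f x * cis (c * x)) \<in> borel_measurable torus"
    using assms by (intro borel_measurable_times) auto
qed (simp add: norm_mult)

lemma fourier_coeff_add:
  assumes "integrable torus f" "integrable torus g"
  shows "fourier_coeff (\<lambda>x. f x + g x) n = fourier_coeff f n + fourier_coeff g n"
  unfolding fourier_coeff_def distrib_right
  by (intro Bochner_Integration.integral_add integrable_torus_mult_cis assms)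

lemma fourier_coeff_cmult: "fourier_coeff (\<lambda>x. c * f x) n = c * fourier_coeff f n"
  by (simp add: fourier_coeff_def mult.assoc)

lemma fourier_coeff_pairing:
  "(LINT x|torus. f x * (c * cis (- 2 * pi * of_int n * x))) = c * fourier_coeff f n"
  unfolding fourier_coeff_def mult.left_commute[of "f _" c] by (rule integral_mult_right_zero)

section \<open>Finitely supported multipliers on the torus\<close>

lemma infsum_finite_support:
  fixes f :: "'a \<Rightarrow> complex"
  assumes "finite A" "\<And>n. n \<notin> A \<Longrightarrow> f n = 0"
  shows "(\<Sum>\<^sub>\<infinity>n\<in>UNIV. f n) = (\<Sum>n\<in>A. f n)"
proof -
  have "(\<Sum>\<^sub>\<infinity>n\<in>UNIV. f n) = (\<Sum>\<^sub>\<infinity>n\<in>A. f n)"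
    using assms(2) by (intro infsum_cong_neutral) auto
  then show ?thesis using assms(1) by simp
qed

text \<open>A finitely supported symbol acts through a trigonometric polynomial with coefficients
  \<open>\<phi> n * fourier_coeff f n\<close>, so the operator is explicit; what is specific to the
  exponent is left to \<open>int\<close> and \<open>bd\<close>.\<close>

lemma extends_multiplier_Z_finite:
  assumes A: "finite A" "\<And>n. n \<notin> A \<Longrightarrow> \<phi> n = 0" and "p \<ge> 0" and C: "C \<ge> 0"
    and int: "\<And>f. f \<in> Lp_space p torus \<Longrightarrow> integrable torus f"
    and bd: "\<And>f. f \<in> Lp_space p torus \<Longrightarrow>
      Lp_norm p torus (trig_poly A (\<lambda>n. \<phi> n * fourier_coeff f n)) \<le> C * Lp_norm p torus f"
  shows "\<phi> \<in> multipliers_Z p" "multiplier_norm_Z p \<phi> \<le> C"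
proof -
  define T where "T f = trig_poly A (\<lambda>n. \<phi> n * fourier_coeff f n)" for f
  have T_Lp: "T f \<in> Lp_space p torus" for f
  proof -
    let ?B = "\<Sum>n\<in>A. norm (\<phi> n * fourier_coeff f n)"
    have m: "T f \<in> borel_measurable torus"
      unfolding T_def by (rule borel_measurable_torusI) measurable
    moreover have "integrable torus (\<lambda>x. norm (T f x) powr p)"
    proof (rule integrable_torus_bounded[of _ "?B powr p"])
      show "(\<lambda>x. norm (T f x) powr p) \<in> borel_measurable torus" using m by auto
      show "norm (norm (T f x) powr p) \<le> ?B powr p" for x
        using norm_trig_poly_le[of A "\<lambda>n. \<phi> n * fourier_coeff f n" x] \<open>p \<ge> 0\<close>
        by (simp add: T_def powr_mono2)
    qed
    ultimately show ?thesis by (simp add: Lp_space_def)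
  qed
  have T: "extends_multiplier_Z p \<phi> T"
    unfolding extends_multiplier_Z_def bounded_Lp_operator_def
  proof (intro conjI ballI allI)
    show "T f \<in> Lp_space p torus" for f by (rule T_Lp)
    show "AE x in torus. T (\<lambda>y. f y + g y) x = T f x + T g x" if "f \<in> Lp_space p torus" "g \<in> Lp_space p torus" for f g
      using that int by (auto simp: T_def trig_poly_def fourier_coeff_add distrib_left distrib_right sum.distrib)
    show "AE x in torus. T (\<lambda>y. c * f y) x = c * T f x" for c f
      by (simp add: T_def trig_poly_def fourier_coeff_cmult sum_distrib_left mult_ac)
    show "\<exists>C. \<forall>f\<in>Lp_space p torus. Lp_norm p torus (T f) \<le> C * Lp_norm p torus f"
      using bd by (auto simp: T_def)
    show "AE x in torus. T f x = (\<Sum>\<^sub>\<infinity>n\<in>UNIV. \<phi> n * fourier_coeff f n * cis (2 * pi * of_int n * x))" for f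
      using A by (subst infsum_finite_support[of A]) (auto simp: T_def trig_poly_def)
  qed
  have "bounded (range \<phi>)"
  proof (rule finite_imp_bounded)
    have "range \<phi> \<subseteq> insert 0 (\<phi> ` A)" using A(2) by auto
    then show "finite (range \<phi>)" by (rule finite_subset) (use A(1) in auto)
  qed
  with T show "\<phi> \<in> multipliers_Z p" by (auto simp: multipliers_Z_def)
  have "Lp_onorm p torus T \<le> C"
    using bd C by (intro Lp_onorm_le) (auto simp: T_def)
  with T show "multiplier_norm_Z p \<phi> \<le> C" by (rule multiplier_norm_Z_le)
qed

lemma torus_L2_integrable:
  assumes "f \<in> Lp_space 2 torus"
  shows "integrable torus f" "integrable torus (\<lambda>x. (norm (f x))\<^sup>2)"
proof -
  show sq: "integrable torus (\<lambda>x. (norm (f x))\<^sup>2)"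
    using assms by (simp add: Lp_space_def)
  have m: "f \<in> borel_measurable torus" using assms by (simp add: Lp_space_def)
  have "integrable torus (\<lambda>x. 1 + (norm (f x))\<^sup>2)" using sq by auto
  then show "integrable torus f"
  proof (rule Bochner_Integration.integrable_bound[OF _ m])
    show "AE x in torus. norm (f x) \<le> norm (1 + (norm (f x))\<^sup>2)"
    proof (intro always_eventually allI)
      fix x show "norm (f x) \<le> norm (1 + (norm (f x))\<^sup>2)"
        using sum_squares_bound[of 1 "norm (f x)"] norm_ge_zero[of "f x"]
        unfolding power_one real_norm_def by linarith
    qed
  qed
qed

lemma integral_norm_square_trig_poly:
  assumes "finite A"
  shows "(LINT x|torus. (norm (trig_poly A a x))\<^sup>2) = (\<Sum>n\<in>A. (norm (a n))\<^sup>2)"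
proof -
  have int: "integrable torus (\<lambda>x. trig_poly A a x * (cnj (a n) * cis (- 2 * pi * of_int n * x)))" for n
    by (intro integrable_torus_bounded[of _ "(\<Sum>n\<in>A. norm (a n)) * norm (a n)"] borel_measurable_torusI)
       (auto simp: norm_mult intro!: mult_right_mono norm_trig_poly_le)
  have "complex_of_real (LINT x|torus. (norm (trig_poly A a x))\<^sup>2)
      = (LINT x|torus. (\<Sum>n\<in>A. trig_poly A a x * (cnj (a n) * cis (- 2 * pi * of_int n * x))))"
  proof -
    have "cnj (trig_poly A a x) = (\<Sum>n\<in>A. cnj (a n) * cis (- 2 * pi * of_int n * x))" for x
      by (simp add: trig_poly_def cis_cnj)
    then show ?thesis
      unfolding integral_complex_of_real[symmetric] complex_norm_square sum_distrib_left[symmetric] by (simp only:)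
  qed
  also have "\<dots> = (\<Sum>n\<in>A. LINT x|torus. trig_poly A a x * (cnj (a n) * cis (- 2 * pi * of_int n * x)))"
    by (intro Bochner_Integration.integral_sum int)
  also have "\<dots> = (\<Sum>n\<in>A. cnj (a n) * fourier_coeff (trig_poly A a) n)"
    by (simp only: fourier_coeff_pairing)
  also have "\<dots> = complex_of_real (\<Sum>n\<in>A. (norm (a n))\<^sup>2)"
    unfolding of_real_sum complex_norm_square
    by (intro sum.cong refl) (simp add: fourier_coeff_trig_poly assms mult.commute)
  finally show ?thesis unfolding of_real_eq_iff .
qed

text \<open>Expand the nonnegative squared distance from \<open>f\<close> to its partial Fourier sum
  \<open>?P\<close>: the mixed integral and the squared norm of \<open>?P\<close> both equal
  \<open>?S\<close>, leaving the difference of the two sides.\<close>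

lemma bessel_torus:
  assumes A: "finite A" and f: "f \<in> Lp_space 2 torus"
  shows "(\<Sum>n\<in>A. (norm (fourier_coeff f n))\<^sup>2) \<le> (LINT x|torus. (norm (f x))\<^sup>2)"
proof -
  let ?P = "trig_poly A (fourier_coeff f)" and ?S = "\<Sum>n\<in>A. (norm (fourier_coeff f n))\<^sup>2"
  note fi = torus_L2_integrable[OF f]
  have cross: "integrable torus (\<lambda>x. f x * (cnj (fourier_coeff f n) * cis (- 2 * pi * of_int n * x)))" for n
    using integrable_mult_right[OF integrable_torus_mult_cis[OF fi(1), of "- 2 * pi * of_int n"], of "cnj (fourier_coeff f n)"]
    by (simp add: mult.left_commute)
  have Pc: "f x * cnj (?P x) = (\<Sum>n\<in>A. f x * (cnj (fourier_coeff f n) * cis (- 2 * pi * of_int n * x)))" for x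
    by (simp add: trig_poly_def cis_cnj sum_distrib_left)
  have "(LINT x|torus. f x * cnj (?P x)) = (\<Sum>n\<in>A. LINT x|torus. f x * (cnj (fourier_coeff f n) * cis (- 2 * pi * of_int n * x)))"
    unfolding Pc by (intro Bochner_Integration.integral_sum cross)
  also have "\<dots> = (\<Sum>n\<in>A. cnj (fourier_coeff f n) * fourier_coeff f n)"
    by (simp only: fourier_coeff_pairing)
  also have "\<dots> = complex_of_real ?S"
    unfolding of_real_sum complex_norm_square by (intro sum.cong refl mult.commute)
  finally have c1: "(LINT x|torus. f x * cnj (?P x)) = complex_of_real ?S" .
  have c2: "integrable torus (\<lambda>x. f x * cnj (?P x))"
    unfolding Pc by (intro Bochner_Integration.integrable_sum cross)
  have re: "(LINT x|torus. Re (f x * cnj (?P x))) = ?S"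
    using c1 c2 by (simp only: integral_Re Re_complex_of_real)
  have Pi: "integrable torus (\<lambda>x. (norm (?P x))\<^sup>2)"
    by (intro integrable_torus_bounded[of _ "(\<Sum>n\<in>A. norm (fourier_coeff f n))\<^sup>2"] borel_measurable_torusI)
       (auto intro!: power_mono norm_trig_poly_le)
  have "0 \<le> (LINT x|torus. (norm (f x - ?P x))\<^sup>2)" by simp
  also have "(\<lambda>x. (norm (f x - ?P x))\<^sup>2) = (\<lambda>x. ((norm (f x))\<^sup>2 + (norm (?P x))\<^sup>2) - 2 * Re (f x * cnj (?P x)))"
    by (simp add: fun_eq_iff cmod_power2 power2_diff algebra_simps)
  also have "(LINT x|torus. ((norm (f x))\<^sup>2 + (norm (?P x))\<^sup>2) - 2 * Re (f x * cnj (?P x)))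
     = (LINT x|torus. (norm (f x))\<^sup>2) + (LINT x|torus. (norm (?P x))\<^sup>2) - 2 * (LINT x|torus. Re (f x * cnj (?P x)))"
    using fi(2) Pi integrable_Re[OF c2]
    by (simp only: Bochner_Integration.integral_diff Bochner_Integration.integral_add
        Bochner_Integration.integrable_add integrable_mult_right integral_mult_right_zero)
  finally show ?thesis unfolding re integral_norm_square_trig_poly[OF A] by simp
qed

lemma multipliers_Z_L2_finite:
  assumes A: "finite {n. \<phi> n \<noteq> 0}" and B: "\<And>n. norm (\<phi> n) \<le> B"
  shows "\<phi> \<in> multipliers_Z 2" "multiplier_norm_Z 2 \<phi> \<le> B"
proof -
  let ?A = "{n. \<phi> n \<noteq> 0}"
  have B0: "B \<ge> 0" using order_trans[OF norm_ge_zero B] .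
  have bd: "Lp_norm 2 torus (trig_poly ?A (\<lambda>n. \<phi> n * fourier_coeff f n)) \<le> B * Lp_norm 2 torus f"
    if f: "f \<in> Lp_space 2 torus" for f
  proof -
    have "(LINT x|torus. (norm (trig_poly ?A (\<lambda>n. \<phi> n * fourier_coeff f n) x))\<^sup>2)
        = (\<Sum>n\<in>?A. (norm (\<phi> n))\<^sup>2 * (norm (fourier_coeff f n))\<^sup>2)"
      using A by (simp add: integral_norm_square_trig_poly norm_mult power_mult_distrib)
    also have "\<dots> \<le> (\<Sum>n\<in>?A. B\<^sup>2 * (norm (fourier_coeff f n))\<^sup>2)"
      by (intro sum_mono mult_right_mono power_mono B) auto
    also have "\<dots> \<le> B\<^sup>2 * (LINT x|torus. (norm (f x))\<^sup>2)"
      unfolding sum_distrib_left[symmetric] by (intro mult_left_mono bessel_torus A f) auto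
    finally have "sqrt (LINT x|torus. (norm (trig_poly ?A (\<lambda>n. \<phi> n * fourier_coeff f n) x))\<^sup>2) \<le> sqrt (B\<^sup>2 * (LINT x|torus. (norm (f x))\<^sup>2))"
      by (rule real_sqrt_le_mono)
    then show ?thesis using B0 by (simp add: Lp_norm_def powr_half_sqrt real_sqrt_mult)
  qed
  show "\<phi> \<in> multipliers_Z 2" "multiplier_norm_Z 2 \<phi> \<le> B"
    using extends_multiplier_Z_finite[OF A _ _ B0 torus_L2_integrable(1) bd] by auto
qed

text \<open>The exponential with frequency \<open>n\<close> has norm 1 and is an eigenfunction with
  eigenvalue \<open>\<phi> n\<close> of every operator extending the multiplier.\<close>

lemma multiplier_norm_Z_L2_ge:
  assumes "\<phi> \<in> multipliers_Z 2"
  shows "norm (\<phi> n) \<le> multiplier_norm_Z 2 \<phi>"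
proof (rule le_multiplier_norm_Z[OF assms])
  fix T assume T: "extends_multiplier_Z 2 \<phi> T"
  let ?e = "trig_poly {n} (\<lambda>_. 1)"
  have norm_e: "norm (?e x) = 1" for x by (simp add: trig_poly_def)
  have e: "?e \<in> Lp_space 2 torus"
    unfolding Lp_space_def by (auto simp: norm_e intro!: borel_measurable_torusI)
  have "AE x in torus. T ?e x = (\<Sum>\<^sub>\<infinity>k\<in>UNIV. \<phi> k * fourier_coeff ?e k * cis (2 * pi * of_int k * x))"
    using T trig_poly_in_trig_polys[of "{n}"] by (auto simp: extends_multiplier_Z_def)
  then have "AE x in torus. norm (T ?e x) = norm (\<phi> n)"
  proof eventually_elim
    case (elim x)
    have "T ?e x = \<phi> n * cis (2 * pi * of_int n * x)"
      unfolding elim by (subst infsum_finite_support[of "{n}"]) (auto simp: fourier_coeff_trig_poly)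
    then show ?case by (simp add: norm_mult)
  qed
  moreover have "T ?e \<in> borel_measurable torus"
    using T e by (auto simp: extends_multiplier_Z_def bounded_Lp_operator_def Lp_space_def)
  ultimately have "(LINT x|torus. (norm (T ?e x))\<^sup>2) = (LINT x|torus. (norm (\<phi> n))\<^sup>2)"
    by (intro integral_cong_AE) auto
  then have "Lp_norm 2 torus (T ?e) = norm (\<phi> n)"
    by (simp add: Lp_norm_def powr_half_sqrt)
  moreover have "Lp_norm 2 torus ?e = 1"
    by (simp add: Lp_norm_def norm_e)
  ultimately show "norm (\<phi> n) \<le> Lp_onorm 2 torus T"
    using Lp_onorm_bound[OF _ e, of T] T by (simp add: extends_multiplier_Z_def)
qed

section \<open>Summability kernels for exponent 2\<close>

text \<open>Links unordered sums to \<open>W\<close>: a sum in the sense of \<open>has_sum\<close>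
  is the limit of the symmetric partial sums because these intervals eventually contain every finite
  set of integers.\<close>

lemma symmetric_intervals_finite_subsets:
  "filterlim (\<lambda>N. {- int N..int N}) (finite_subsets_at_top UNIV) sequentially"
  unfolding filterlim_finite_subsets_at_top
proof (intro allI impI)
  fix X :: "int set" assume X: "finite X \<and> X \<subseteq> UNIV"
  obtain N where N: "\<And>n. n \<in> X \<Longrightarrow> \<bar>n\<bar> \<le> int N"
  proof
    fix n assume "n \<in> X"
    then have "\<bar>n\<bar> \<le> Max (insert 0 (abs ` X))" using X by (intro Max_ge) auto
    moreover have "0 \<le> Max (insert 0 (abs ` X))" using X by (intro Max_ge) auto
    ultimately show "\<bar>n\<bar> \<le> int (nat (Max (insert 0 (abs ` X))))" by simp
  qed
  show "\<forall>\<^sub>F N in sequentially. finite {- int N..int N} \<and> X \<subseteq> {- int N..int N} \<and> {- int N..int N} \<subseteq> UNIV"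
    using eventually_ge_at_top[of N] by eventually_elim (use N in force)
qed

text \<open>The partial sums are eventually constant, so the value holds at every
  \<open>\<xi>\<close>, not merely almost everywhere.\<close>

lemma W_finite:
  assumes "finite A" "\<And>n. n \<notin> A \<Longrightarrow> \<phi> n = 0"
  shows "W \<phi> \<Lambda> \<xi> = (\<Sum>n\<in>A. \<phi> n * \<Lambda> (\<xi> - of_int n))"
  unfolding W_def
proof (rule limI)
  have "\<forall>\<^sub>F N in sequentially. A \<subseteq> {- int N..int N}"
    using symmetric_intervals_finite_subsets assms(1)
    unfolding filterlim_finite_subsets_at_top by (auto elim: eventually_mono)
  then have "\<forall>\<^sub>F N in sequentially. W_partial \<phi> \<Lambda> \<xi> N = (\<Sum>n\<in>A. \<phi> n * \<Lambda> (\<xi> - of_int n))"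
    by eventually_elim (use assms(2) in \<open>auto simp: W_partial_def intro!: sum.mono_neutral_right\<close>)
  then show "W_partial \<phi> \<Lambda> \<xi> \<longlonglongrightarrow> (\<Sum>n\<in>A. \<phi> n * \<Lambda> (\<xi> - of_int n))"
    by (rule tendsto_eventually)
qed

lemma infsum_int_ennreal:
  fixes f :: "int \<Rightarrow> ennreal"
  shows "(\<Sum>\<^sub>\<infinity>n\<in>UNIV. f n) = (SUP N. \<Sum>n = - int N..int N. f n)"
proof (rule tendsto_unique[OF sequentially_bot])
  have "(f has_sum (\<Sum>\<^sub>\<infinity>n\<in>UNIV. f n)) UNIV" by (intro has_sum_infsum nonneg_summable_on_complete) simp
  then show "(\<lambda>N. \<Sum>n = - int N..int N. f n) \<longlonglongrightarrow> (\<Sum>\<^sub>\<infinity>n\<in>UNIV. f n)"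
    unfolding has_sum_def by (rule filterlim_compose) (rule symmetric_intervals_finite_subsets)
  show "(\<lambda>N. \<Sum>n = - int N..int N. f n) \<longlonglongrightarrow> (SUP N. \<Sum>n = - int N..int N. f n)"
    by (intro LIMSEQ_SUP incseq_SucI sum_mono2) auto
qed

lemma lebesgue_measurable_translate:
  assumes "f \<in> borel_measurable lebesgue"
  shows "(\<lambda>x::real. f (x + t)) \<in> borel_measurable lebesgue"
proof -
  have "(\<lambda>x::real. t + x) \<in> lebesgue \<rightarrow>\<^sub>M lebesgue"
    using lebesgue_affine_measurable[of "\<lambda>_. 1 :: real" t] by simp
  from measurable_compose[OF this assms] show ?thesis by (simp add: add.commute)
qed

lemma borel_measurable_infsum_int:
  fixes f :: "int \<Rightarrow> 'a \<Rightarrow> ennreal"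
  assumes "\<And>n. f n \<in> borel_measurable M"
  shows "(\<lambda>x. \<Sum>\<^sub>\<infinity>n\<in>UNIV. f n x) \<in> borel_measurable M"
  unfolding infsum_int_ennreal using assms by (intro borel_measurable_SUP borel_measurable_sum) auto

lemma sum_int_reflect: "(\<Sum>n = - int N..int N. f (- n)) = (\<Sum>n = - int N..int N. f n)"
  by (rule sum.reindex_bij_witness[of _ uminus uminus]) auto

text \<open>Finite real sums at \<open>\<xi> - of_int n\<close> are the form that occurs in
  \<open>W_partial\<close>; as the index intervals are symmetric, the sign of \<open>n\<close> is
  immaterial.\<close>

lemma periodization_bound_finite_iff:
  assumes G: "G \<in> borel_measurable lebesgue"
  shows "periodization_bound G < \<infinity> \<longleftrightarrow>
    (\<exists>C\<ge>0. AE \<xi> in lborel. \<forall>N. (\<Sum>n = - int N..int N. norm (G (\<xi> - of_int n))) \<le> C)"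
proof -
  let ?S = "\<lambda>\<xi>. \<Sum>\<^sub>\<infinity>n\<in>UNIV. ennreal (norm (G (\<xi> + of_int n)))"
  have S: "?S \<in> borel_measurable lebesgue"
    using lebesgue_measurable_translate[OF G] by (intro borel_measurable_infsum_int) auto
  have le: "?S \<xi> \<le> ennreal C \<longleftrightarrow> (\<forall>N. (\<Sum>n = - int N..int N. norm (G (\<xi> - of_int n))) \<le> C)" if "C \<ge> 0" for \<xi> C
  proof -
    have "(\<Sum>n = - int N..int N. ennreal (norm (G (\<xi> + of_int n)))) = ennreal (\<Sum>n = - int N..int N. norm (G (\<xi> - of_int n)))" for N
      using sum_int_reflect[of "\<lambda>n. norm (G (\<xi> - of_int n))" N] by (simp add: sum_ennreal)
    then show ?thesis
      unfolding infsum_int_ennreal using that by (simp add: SUP_le_iff ennreal_le_iff)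
  qed
  show ?thesis
  proof
    assume fin: "periodization_bound G < \<infinity>"
    define C where "C = enn2real (periodization_bound G)"
    have C: "C \<ge> 0" "ennreal C = periodization_bound G" using fin by (auto simp: C_def)
    have "AE \<xi> in lebesgue. ?S \<xi> \<le> ennreal C"
      unfolding C periodization_bound_def by (rule esssup_AE)
    then show "\<exists>C\<ge>0. AE \<xi> in lborel. \<forall>N. (\<Sum>n = - int N..int N. norm (G (\<xi> - of_int n))) \<le> C"
      using C(1) by (auto simp: AE_completion_iff le)
  next
    assume "\<exists>C\<ge>0. AE \<xi> in lborel. \<forall>N. (\<Sum>n = - int N..int N. norm (G (\<xi> - of_int n))) \<le> C"
    then obtain C where "C \<ge> 0" "AE \<xi> in lebesgue. ?S \<xi> \<le> ennreal C"
      by (auto simp: AE_completion_iff le)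
    then have "periodization_bound G \<le> ennreal C"
      unfolding periodization_bound_def by (intro esssup_I S)
    also have "\<dots> < \<infinity>" by simp
    finally show "periodization_bound G < \<infinity>" .
  qed
qed

section \<open>Pointwise size of \<open>W\<close> and the equalities for exponent 2\<close>

lemma borel_measurable_W_partial:
  assumes "\<Lambda> \<in> borel_measurable lebesgue"
  shows "(\<lambda>\<xi>. W_partial \<phi> \<Lambda> \<xi> N) \<in> borel_measurable lebesgue"
  unfolding W_partial_def
  using lebesgue_measurable_translate[OF assms, of "- of_int n" for n]
  by (intro borel_measurable_sum borel_measurable_times) auto

lemma borel_measurable_W:
  assumes "\<Lambda> \<in> borel_measurable lebesgue"
  shows "W \<phi> \<Lambda> \<in> borel_measurable lebesgue"
  unfolding W_def[abs_def] by (rule borel_measurable_lim_metric) (rule borel_measurable_W_partial[OF assms])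

lemma W_partial_convergent:
  assumes C: "\<And>N. (\<Sum>n = - int N..int N. norm (\<Lambda> (\<xi> - of_int n))) \<le> C" and B: "\<And>n. norm (\<phi> n) \<le> B"
  shows "convergent (W_partial \<phi> \<Lambda> \<xi>)" "norm (W \<phi> \<Lambda> \<xi>) \<le> C * B"
proof -
  let ?a = "\<lambda>n. \<phi> n * \<Lambda> (\<xi> - of_int n)"
  have B0: "B \<ge> 0" using order_trans[OF norm_ge_zero B] .
  have bd: "(\<Sum>n = - int N..int N. norm (?a n)) \<le> C * B" for N
  proof -
    have "(\<Sum>n = - int N..int N. norm (?a n)) \<le> (\<Sum>n = - int N..int N. B * norm (\<Lambda> (\<xi> - of_int n)))"
      using B by (intro sum_mono) (simp add: norm_mult mult_right_mono)
    also have "\<dots> \<le> C * B"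
      unfolding sum_distrib_left[symmetric] using mult_left_mono[OF C[of N] B0] by (simp add: mult.commute)
    finally show ?thesis .
  qed
  have "(\<lambda>n. norm (?a n)) summable_on UNIV"
  proof (rule nonneg_bdd_above_summable_on)
    show "bdd_above (sum (\<lambda>n. norm (?a n)) ` {F. F \<subseteq> UNIV \<and> finite F})"
    proof (rule bdd_aboveI2)
      fix F :: "int set" assume F: "F \<in> {F. F \<subseteq> UNIV \<and> finite F}"
      have "\<forall>\<^sub>F N in sequentially. F \<subseteq> {- int N..int N}"
        using symmetric_intervals_finite_subsets F
        unfolding filterlim_finite_subsets_at_top by (auto elim: eventually_mono)
      then obtain N where "F \<subseteq> {- int N..int N}" by (auto simp: eventually_sequentially)
      then have "(\<Sum>n\<in>F. norm (?a n)) \<le> (\<Sum>n = - int N..int N. norm (?a n))"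
        by (intro sum_mono2) auto
      also note bd
      finally show "(\<Sum>n\<in>F. norm (?a n)) \<le> C * B" .
    qed
  qed simp
  then have "?a summable_on UNIV" by (rule abs_summable_summable)
  then have "(?a has_sum (\<Sum>\<^sub>\<infinity>n\<in>UNIV. ?a n)) UNIV" by (rule has_sum_infsum)
  then have lim: "W_partial \<phi> \<Lambda> \<xi> \<longlonglongrightarrow> (\<Sum>\<^sub>\<infinity>n\<in>UNIV. ?a n)"
    unfolding has_sum_def W_partial_def[abs_def] by (rule filterlim_compose) (rule symmetric_intervals_finite_subsets)
  then show "convergent (W_partial \<phi> \<Lambda> \<xi>)" by (rule convergentI)
  have "norm (\<Sum>\<^sub>\<infinity>n\<in>UNIV. ?a n) \<le> C * B"
  proof (rule tendsto_upperbound[OF tendsto_norm[OF lim]])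
    show "\<forall>\<^sub>F N in sequentially. norm (W_partial \<phi> \<Lambda> \<xi> N) \<le> C * B"
      unfolding W_partial_def by (intro always_eventually allI order_trans[OF norm_sum bd])
  qed simp
  then show "norm (W \<phi> \<Lambda> \<xi>) \<le> C * B" using limI[OF lim] by (simp add: W_def)
qed

lemma summability_kernels_2_if_periodization_bound:
  assumes L: "\<Lambda> \<in> borel_measurable lebesgue" and "periodization_bound \<Lambda> < \<infinity>"
  shows "\<Lambda> \<in> summability_kernels 2"
proof -
  obtain C where C: "C \<ge> 0" "AE \<xi> in lborel. \<forall>N. (\<Sum>n = - int N..int N. norm (\<Lambda> (\<xi> - of_int n))) \<le> C"
    using iffD1[OF periodization_bound_finite_iff[OF L] assms(2)] by blast
  have "(AE \<xi> in lebesgue. convergent (W_partial \<phi> \<Lambda> \<xi>)) \<and> W \<phi> \<Lambda> \<in> multipliers_R 2 \<and>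
      multiplier_norm_R 2 (W \<phi> \<Lambda>) \<le> C * multiplier_norm_Z 2 \<phi>" if \<phi>: "\<phi> \<in> multipliers_Z 2" for \<phi>
  proof -
    let ?B = "multiplier_norm_Z 2 \<phi>"
    have B: "norm (\<phi> n) \<le> ?B" for n using \<phi> by (rule multiplier_norm_Z_L2_ge)
    have B0: "?B \<ge> 0" using order_trans[OF norm_ge_zero B] .
    have conv: "AE \<xi> in lborel. convergent (W_partial \<phi> \<Lambda> \<xi>)"
      using C(2) by eventually_elim (rule W_partial_convergent(1)[OF _ B], blast)
    have bd: "AE \<xi> in lborel. norm (W \<phi> \<Lambda> \<xi>) \<le> C * ?B"
      using C(2) by eventually_elim (rule W_partial_convergent(2)[OF _ B], blast)
    have meas: "W \<phi> \<Lambda> \<in> borel_measurable lebesgue" using L by (rule borel_measurable_W)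
    obtain T where T: "extends_multiplier_R 2 (W \<phi> \<Lambda>) T" "Lp_onorm 2 lebesgue T \<le> C * ?B"
      using extends_multiplier_R_L2[OF meas bd] C(1) B0 by auto
    have "W \<phi> \<Lambda> \<in> multipliers_R 2"
      using T(1) meas AE_completion[OF bd] by (auto simp: multipliers_R_def Linfty_space_def)
    with AE_completion[OF conv] multiplier_norm_R_le[OF T] show ?thesis by blast
  qed
  with L show ?thesis unfolding summability_kernels_def by blast
qed

text \<open>Essential boundedness of \<open>\<Lambda>\<close> is the point: the sequence with value
  1 at 0 and 0 elsewhere has \<open>W\<close> equal to \<open>\<Lambda>\<close>, and multipliers are
  essentially bounded.\<close>

lemma summability_kernels_2_subset: "summability_kernels 2 \<subseteq> summability_kernels0 2"
proof
  fix \<Lambda> assume L: "\<Lambda> \<in> summability_kernels 2"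
  then obtain C where C: "\<And>\<phi>. \<phi> \<in> multipliers_Z 2 \<Longrightarrow> W \<phi> \<Lambda> \<in> multipliers_R 2 \<and>
      multiplier_norm_R 2 (W \<phi> \<Lambda>) \<le> C * multiplier_norm_Z 2 \<phi>"
    unfolding summability_kernels_def by blast
  let ?\<delta> = "\<lambda>n::int. if n = 0 then 1 else 0 :: complex"
  have "?\<delta> \<in> multipliers_Z 2" by (rule multipliers_Z_L2_finite[of _ 1]) auto
  then have "W ?\<delta> \<Lambda> \<in> multipliers_R 2" using C by blast
  moreover have "W ?\<delta> \<Lambda> = \<Lambda>"
    by (rule ext, subst W_finite[of "{0}"]) auto
  ultimately have "\<Lambda> \<in> Linfty_space lebesgue" by (simp add: multipliers_R_def)
  with C show "\<Lambda> \<in> summability_kernels0 2" unfolding summability_kernels0_def by blast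
qed

text \<open>Real signs are chosen once to align the real parts and once to align the imaginary
  parts, which accounts for the factor 2.\<close>

lemma sum_norm_le_of_signs:
  fixes a :: "'i \<Rightarrow> complex"
  assumes "finite A" and C: "\<And>S. S \<subseteq> A \<Longrightarrow> norm (\<Sum>n\<in>A. (if n \<in> S then 1 else - 1) * a n) \<le> C"
  shows "(\<Sum>n\<in>A. norm (a n)) \<le> 2 * C"
proof -
  let ?s = "\<lambda>S. \<Sum>n\<in>A. (if n \<in> S then 1 else - 1) * a n"
  have "(\<Sum>n\<in>A. \<bar>Re (a n)\<bar>) = Re (?s {n \<in> A. Re (a n) \<ge> 0})"
    unfolding Re_sum by (intro sum.cong) auto
  also have "\<dots> \<le> C" using C[of "{n \<in> A. Re (a n) \<ge> 0}"] by (intro order_trans[OF complex_Re_le_cmod]) auto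
  finally have re: "(\<Sum>n\<in>A. \<bar>Re (a n)\<bar>) \<le> C" .
  have "(\<Sum>n\<in>A. \<bar>Im (a n)\<bar>) = Im (?s {n \<in> A. Im (a n) \<ge> 0})"
    unfolding Im_sum by (intro sum.cong) auto
  also have "\<dots> \<le> C"
    using C[of "{n \<in> A. Im (a n) \<ge> 0}"] by (intro order_trans[OF abs_ge_self order_trans[OF abs_Im_le_cmod]]) auto
  finally have im: "(\<Sum>n\<in>A. \<bar>Im (a n)\<bar>) \<le> C" .
  have "(\<Sum>n\<in>A. norm (a n)) \<le> (\<Sum>n\<in>A. \<bar>Re (a n)\<bar> + \<bar>Im (a n)\<bar>)"
    by (intro sum_mono cmod_le)
  then show ?thesis using re im by (simp add: sum.distrib)
qed

lemma periodization_bound_if_summability_kernels0_2: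
  assumes "\<Lambda> \<in> summability_kernels0 2"
  shows "periodization_bound \<Lambda> < \<infinity>"
proof -
  from assms obtain C where L: "\<Lambda> \<in> Linfty_space lebesgue"
    and C: "\<And>\<phi>. \<phi> \<in> multipliers_Z 2 \<Longrightarrow> finite {n. \<phi> n \<noteq> 0} \<Longrightarrow> W \<phi> \<Lambda> \<in> multipliers_R 2 \<and>
        multiplier_norm_R 2 (W \<phi> \<Lambda>) \<le> C * multiplier_norm_Z 2 \<phi>"
    unfolding summability_kernels0_def by blast
  \<comment> \<open>Adding 1 makes the bound strict, so that an operator of norm below
    \<open>D\<close> can be picked from the infimum defining the multiplier norm.\<close>
  define D where "D = \<bar>C\<bar> + 1"
  have *: "AE \<xi> in lborel. (\<Sum>n = - int N..int N. norm (\<Lambda> (\<xi> - of_int n))) \<le> 2 * D" for N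
  proof -
    let ?A = "{- int N..int N}"
    have "AE \<xi> in lborel. norm (\<Sum>n\<in>?A. (if n \<in> S then 1 else - 1) * \<Lambda> (\<xi> - of_int n)) \<le> D" if "S \<in> Pow ?A" for S
    proof -
      let ?\<phi> = "\<lambda>n. if n \<in> ?A then (if n \<in> S then 1 else - 1) else 0 :: complex"
      have fin: "finite {n. ?\<phi> n \<noteq> 0}" by (rule finite_subset[of _ ?A]) auto
      have "?\<phi> \<in> multipliers_Z 2" "multiplier_norm_Z 2 ?\<phi> \<le> 1"
        by (rule multipliers_Z_L2_finite[OF fin, where B = 1], simp)+
      moreover from this have "C * multiplier_norm_Z 2 ?\<phi> \<le> \<bar>C\<bar> * 1"
        using multiplier_norm_Z_nonneg[of ?\<phi> 2] by (intro mult_mono) auto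
      ultimately have W: "W ?\<phi> \<Lambda> \<in> multipliers_R 2" "multiplier_norm_R 2 (W ?\<phi> \<Lambda>) < D"
        using C[OF _ fin] unfolding D_def by fastforce+
      from W(1) have ne: "{T. extends_multiplier_R 2 (W ?\<phi> \<Lambda>) T} \<noteq> {}" by (auto simp: multipliers_R_def)
      obtain T where T: "extends_multiplier_R 2 (W ?\<phi> \<Lambda>) T" "Lp_onorm 2 lebesgue T < D"
        using W(2) unfolding multiplier_norm_R_def cINF_less_iff[OF ne bdd_below_multiplier_norms(1)] by blast
      have "AE \<xi> in lborel. norm (W ?\<phi> \<Lambda> \<xi>) \<le> Lp_onorm 2 lebesgue T"
        using W(1) by (intro extends_multiplier_R_L2_bound T) (simp add: multipliers_R_def)
      then show ?thesis
      proof eventually_elim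
        case (elim \<xi>)
        have "W ?\<phi> \<Lambda> \<xi> = (\<Sum>n\<in>?A. ?\<phi> n * \<Lambda> (\<xi> - of_int n))" by (rule W_finite) auto
        also have "\<dots> = (\<Sum>n\<in>?A. (if n \<in> S then 1 else - 1) * \<Lambda> (\<xi> - of_int n))"
          by (intro sum.cong) auto
        finally show ?case using elim T(2) by simp
      qed
    qed
    \<comment> \<open>The best signs depend on \<open>\<xi>\<close>; as there are finitely many
      patterns for fixed \<open>N\<close>, the exceptional null sets can be united before
      choosing.\<close>
    then have "AE \<xi> in lborel. \<forall>S\<in>Pow ?A. norm (\<Sum>n\<in>?A. (if n \<in> S then 1 else - 1) * \<Lambda> (\<xi> - of_int n)) \<le> D"
      by (intro AE_finite_allI) auto
    then show ?thesis
      by eventually_elim (rule sum_norm_le_of_signs, auto)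
  qed
  then have "AE \<xi> in lborel. \<forall>N. (\<Sum>n = - int N..int N. norm (\<Lambda> (\<xi> - of_int n))) \<le> 2 * D"
    unfolding AE_all_countable by blast
  moreover have "2 * D \<ge> 0" by (simp add: D_def)
  ultimately have "\<exists>C\<ge>0. AE \<xi> in lborel. \<forall>N. (\<Sum>n = - int N..int N. norm (\<Lambda> (\<xi> - of_int n))) \<le> C"
    by blast
  moreover have "\<Lambda> \<in> borel_measurable lebesgue" using L by (simp add: Linfty_space_def)
  ultimately show ?thesis using periodization_bound_finite_iff by blast
qed

lemma summability_kernels_2_eq:
  "summability_kernels0 2 = summability_kernels 2 \<and>
   summability_kernels 2 = {\<Lambda> \<in> Linfty_space lebesgue. periodization_bound \<Lambda> < \<infinity>}"
proof -
  have "summability_kernels0 2 \<subseteq> {\<Lambda> \<in> Linfty_space lebesgue. periodization_bound \<Lambda> < \<infinity>}"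
    using periodization_bound_if_summability_kernels0_2 by (auto simp: summability_kernels0_def)
  moreover have "{\<Lambda> \<in> Linfty_space lebesgue. periodization_bound \<Lambda> < \<infinity>} \<subseteq> summability_kernels 2"
    using summability_kernels_2_if_periodization_bound by (auto simp: Linfty_space_def)
  ultimately show ?thesis using summability_kernels_2_subset by blast
qed

section \<open>Periodization and the Fejer kernel\<close>

text \<open>The line is cut into unit intervals starting at integers, each translated to the torus;
  monotone convergence passes from the block \<open>{- real N..<real N + 1}\<close> to the whole
  line.\<close>

lemma nn_integral_periodize:
  fixes h :: "real \<Rightarrow> ennreal"
  assumes [measurable]: "h \<in> borel_measurable borel"
  shows "(\<integral>\<^sup>+x. h x \<partial>lborel) = (\<integral>\<^sup>+x. (\<Sum>\<^sub>\<infinity>n\<in>UNIV. h (x + of_int n)) \<partial>torus)"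
proof -
  have piece: "(\<integral>\<^sup>+x. h (x + of_int n) \<partial>torus) = (\<integral>\<^sup>+x. h x * indicator {of_int n..<of_int n + 1} x \<partial>lborel)" for n
  proof -
    have "(\<integral>\<^sup>+x. h x * indicator {of_int n..<of_int n + 1} x \<partial>lborel)
        = (\<integral>\<^sup>+x. h (x - (- of_int n)) * indicator {of_int n..<of_int n + 1} (x - (- of_int n)) \<partial>lborel)"
      by (rule nn_integral_translate[symmetric]) measurable
    also have "\<dots> = (\<integral>\<^sup>+x. h (x + of_int n) * indicator {0..<1} x \<partial>lborel)"
      by (intro nn_integral_cong) (auto simp: indicator_def)
    finally show ?thesis by (simp add: nn_integral_torus)
  qed
  have union: "(\<Sum>n = - int N..int N. indicator {of_int n..<of_int n + 1} x) = (indicator {- real N..<real N + 1} x :: ennreal)" for N and x :: real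
  proof -
    \<comment> \<open>Each \<open>x\<close> lies in exactly one of these intervals, the one indexed
      by its floor.\<close>
    have "(\<Sum>n = - int N..int N. indicator {of_int n..<of_int n + 1} x :: ennreal) = (\<Sum>n = - int N..int N. if n = \<lfloor>x\<rfloor> then 1 else 0)"
      by (intro sum.cong refl) (auto simp: indicator_def floor_eq_iff; linarith)
    also have "\<dots> = indicator {- real N..<real N + 1} x"
    proof -
      have "- int N \<le> \<lfloor>x\<rfloor> \<longleftrightarrow> - real N \<le> x" "\<lfloor>x\<rfloor> \<le> int N \<longleftrightarrow> x < real N + 1"
        by (simp_all add: le_floor_iff floor_le_iff)
      then show ?thesis by (auto simp: indicator_def)
    qed
    finally show ?thesis .
  qed
  have "(\<integral>\<^sup>+x. (\<Sum>\<^sub>\<infinity>n\<in>UNIV. h (x + of_int n)) \<partial>torus) = (SUP N. \<integral>\<^sup>+x. (\<Sum>n = - int N..int N. h (x + of_int n)) \<partial>torus)"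
    unfolding infsum_int_ennreal
  proof (rule nn_integral_monotone_convergence_SUP)
    show "incseq (\<lambda>N x. \<Sum>n = - int N..int N. h (x + of_int n))"
      by (intro incseq_SucI le_funI sum_mono2) auto
    show "(\<lambda>x. \<Sum>n = - int N..int N. h (x + of_int n)) \<in> borel_measurable torus" for N
      by (rule borel_measurable_torusI) measurable
  qed
  also have "\<dots> = (SUP N. \<integral>\<^sup>+x. h x * indicator {- real N..<real N + 1} x \<partial>lborel)"
  proof (intro SUP_cong refl)
    fix N
    have "(\<integral>\<^sup>+x. (\<Sum>n = - int N..int N. h (x + of_int n)) \<partial>torus) = (\<Sum>n = - int N..int N. \<integral>\<^sup>+x. h (x + of_int n) \<partial>torus)"
      by (intro nn_integral_sum borel_measurable_torusI) measurable
    also have "\<dots> = (\<integral>\<^sup>+x. (\<Sum>n = - int N..int N. h x * indicator {of_int n..<of_int n + 1} x) \<partial>lborel)"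
      unfolding piece by (intro nn_integral_sum[symmetric]) measurable
    finally show "(\<integral>\<^sup>+x. (\<Sum>n = - int N..int N. h (x + of_int n)) \<partial>torus) = (\<integral>\<^sup>+x. h x * indicator {- real N..<real N + 1} x \<partial>lborel)"
      by (simp add: sum_distrib_left[symmetric] union)
  qed
  also have "\<dots> = (\<integral>\<^sup>+x. (SUP N. h x * indicator {- real N..<real N + 1} x) \<partial>lborel)"
  proof (rule nn_integral_monotone_convergence_SUP[symmetric])
    show "incseq (\<lambda>N x. h x * indicator {- real N..<real N + 1} x)"
      by (intro incseq_SucI le_funI mult_left_mono) (auto simp: indicator_def)
  qed measurable
  also have "\<dots> = (\<integral>\<^sup>+x. h x \<partial>lborel)"
  proof (intro nn_integral_cong antisym SUP_least)
    fix x :: real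
    show "h x * indicator {- real N..<real N + 1} x \<le> h x" for N
      by (auto simp: indicator_def)
    obtain N where "\<bar>x\<bar> \<le> real N" using real_arch_simple by blast
    then have "h x = h x * indicator {- real N..<real N + 1} x" by (auto simp: indicator_def)
    also have "\<dots> \<le> (SUP N. h x * indicator {- real N..<real N + 1} x)" by (rule SUP_upper) simp
    finally show "h x \<le> (SUP N. h x * indicator {- real N..<real N + 1} x)" .
  qed
  finally show ?thesis ..
qed

lemma infsum_cmult_ennreal:
  fixes f :: "int \<Rightarrow> ennreal"
  shows "(\<Sum>\<^sub>\<infinity>n\<in>UNIV. c * f n) = c * (\<Sum>\<^sub>\<infinity>n\<in>UNIV. f n)"
  unfolding infsum_int_ennreal sum_distrib_left[symmetric] by (rule SUP_mult_left_ennreal[symmetric])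

lemma nn_integral_mult_periodic:
  fixes h :: "real \<Rightarrow> ennreal"
  assumes [measurable]: "h \<in> borel_measurable borel"
  shows "(\<integral>\<^sup>+x. ennreal (norm (trig_poly A a x)) * h x \<partial>lborel)
    = (\<integral>\<^sup>+x. ennreal (norm (trig_poly A a x)) * (\<Sum>\<^sub>\<infinity>n\<in>UNIV. h (x + of_int n)) \<partial>torus)"
  by (subst nn_integral_periodize) (auto simp: trig_poly_periodic_int infsum_cmult_ennreal)

section \<open>The Fejer kernel and multiplier norms for exponent 1\<close>

definition fejer :: "nat \<Rightarrow> int \<Rightarrow> real" where
  "fejer N n = 1 - \<bar>of_int n\<bar> / real N"

text \<open>The phase moves the centre of the kernel to \<open>b\<close>. The weights are not cut
  off: for positive \<open>N\<close> they vanish at the indices \<open>N\<close> and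
  \<open>- N\<close> and are negative beyond, so the range of \<open>n\<close> is restricted
  separately.\<close>

definition fejer_coeff :: "nat \<Rightarrow> real \<Rightarrow> int \<Rightarrow> complex" where
  "fejer_coeff N b n = complex_of_real (fejer N n) * cis (- 2 * pi * of_int n * b)"

abbreviation fejer_poly :: "nat \<Rightarrow> real \<Rightarrow> real \<Rightarrow> complex" where
  "fejer_poly N b \<equiv> trig_poly {- int N..int N} (fejer_coeff N b)"

lemma sum_symmetric_Suc:
  fixes f :: "int \<Rightarrow> 'a :: comm_monoid_add"
  shows "(\<Sum>n = - int (Suc N)..int (Suc N). f n) = (\<Sum>n = - int N..int N. f n) + (f (int (Suc N)) + f (- int (Suc N)))"
proof -
  have "{- int (Suc N)..int (Suc N)} = insert (int (Suc N)) (insert (- int (Suc N)) {- int N..int N})" by auto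
  then show ?thesis by (simp add: add_ac)
qed

lemma dirichlet_sum: "(\<Sum>n = - int N..int N. cis (of_int n * \<theta>)) = complex_of_real (1 + 2 * (\<Sum>n = 1..N. cos (real n * \<theta>)))"
proof (induction N)
  case (Suc N)
  have "cis (of_int (int (Suc N)) * \<theta>) + cis (of_int (- int (Suc N)) * \<theta>) = complex_of_real (2 * cos (real (Suc N) * \<theta>))"
  proof -
    have "cis a + cis (- a) = complex_of_real (2 * cos a)" for a by (simp add: complex_eq_iff)
    from this[of "real (Suc N) * \<theta>"] show ?thesis
      by (simp only: of_int_minus of_int_of_nat_eq mult_minus_left)
  qed
  then show ?case unfolding sum_symmetric_Suc Suc by simp
qed simp

text \<open>The reason for the nonnegativity of the Fejer kernel. From \<open>N\<close> to
  \<open>Suc N\<close> every weight grows by 1, which adds a Dirichlet sum; on the right the square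
  grows by 1 plus twice the real part of a mixed product, which is the same cosine sum.\<close>

lemma fejer_sum:
  "(\<Sum>n = - int N..int N. complex_of_real (real N - \<bar>of_int n\<bar>) * cis (of_int n * \<theta>))
    = complex_of_real ((norm (\<Sum>j<N. cis (real j * \<theta>)))\<^sup>2)"
proof (induction N)
  case (Suc N)
  let ?D = "\<Sum>j<N. cis (real j * \<theta>)"
  \<comment> \<open>The two outermost terms of the longer sum have weight 0.\<close>
  have "(\<Sum>n = - int (Suc N)..int (Suc N). complex_of_real (real (Suc N) - \<bar>of_int n\<bar>) * cis (of_int n * \<theta>))
      = (\<Sum>n = - int N..int N. complex_of_real (real (Suc N) - \<bar>of_int n\<bar>) * cis (of_int n * \<theta>))"
    unfolding sum_symmetric_Suc by simp
  also have "\<dots> = (\<Sum>n = - int N..int N. complex_of_real (real N - \<bar>of_int n\<bar>) * cis (of_int n * \<theta>) + cis (of_int n * \<theta>))"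
    by (intro sum.cong refl) (simp add: algebra_simps)
  also have "\<dots> = complex_of_real ((norm ?D)\<^sup>2 + (1 + 2 * (\<Sum>n = 1..N. cos (real n * \<theta>))))"
    unfolding sum.distrib Suc dirichlet_sum by simp
  also have "(\<Sum>n = 1..N. cos (real n * \<theta>)) = (\<Sum>j<N. cos (real j * \<theta> - real N * \<theta>))"
    by (rule sum.reindex_bij_witness[of _ "\<lambda>j. N - j" "\<lambda>n. N - n"])
       (auto simp: of_nat_diff left_diff_distrib[symmetric] intro: arg_cong[where f = cos])
  also have "\<dots> = Re (?D * cnj (cis (real N * \<theta>)))"
    by (simp add: sum_distrib_right cos_diff)
  also have "(norm ?D)\<^sup>2 + (1 + 2 * Re (?D * cnj (cis (real N * \<theta>)))) = (norm (?D + cis (real N * \<theta>)))\<^sup>2"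
  proof -
    have "(norm (?D + z))\<^sup>2 = (norm ?D)\<^sup>2 + (norm z)\<^sup>2 + 2 * Re (?D * cnj z)" for z
      by (simp add: cmod_power2 power2_sum algebra_simps)
    then show ?thesis by simp
  qed
  finally show ?case by simp
qed simp

lemma trig_poly_fejer:
  assumes "N > 0"
  shows "fejer_poly N b x
    = complex_of_real ((norm (\<Sum>j<N. cis (real j * (2 * pi * (x - b)))))\<^sup>2 / real N)"
proof -
  have "fejer_poly N b x
     = (\<Sum>n = - int N..int N. complex_of_real (real N - \<bar>of_int n\<bar>) * cis (of_int n * (2 * pi * (x - b))) / real N)"
    unfolding trig_poly_def fejer_coeff_def
  proof (intro sum.cong refl)
    fix n
    have "cis (- 2 * pi * of_int n * b) * cis (2 * pi * of_int n * x) = cis (of_int n * (2 * pi * (x - b)))"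
      by (simp add: cis_mult algebra_simps)
    moreover have "fejer N n = (real N - \<bar>of_int n\<bar>) / real N"
      using assms by (simp add: fejer_def field_simps)
    ultimately show "complex_of_real (fejer N n) * cis (- 2 * pi * of_int n * b) * cis (2 * pi * of_int n * x)
      = complex_of_real (real N - \<bar>of_int n\<bar>) * cis (of_int n * (2 * pi * (x - b))) / real N"
      by (simp add: mult.assoc)
  qed
  then show ?thesis unfolding sum_divide_distrib[symmetric] fejer_sum by simp
qed

lemma integral_trig_poly:
  assumes "finite A" "0 \<in> A"
  shows "(LINT x|torus. trig_poly A a x) = a 0"
  using fourier_coeff_trig_poly[OF assms(1), of a 0] assms(2) by (simp add: fourier_coeff_def)

text \<open>A nonnegative kernel has its zeroth coefficient as L1 norm. The value does not depend on
  \<open>b\<close>, which later allows the centre to be moved freely.\<close>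

lemma integral_norm_fejer:
  assumes "N > 0"
  shows "(LINT x|torus. norm (fejer_poly N b x)) = 1"
proof -
  let ?P = "fejer_poly N b"
  have "complex_of_real (norm (?P x)) = ?P x" for x
  proof -
    have r: "complex_of_real (norm (complex_of_real r)) = complex_of_real r" if "r \<ge> 0" for r
      using that by simp
    show ?thesis unfolding trig_poly_fejer[OF assms] by (rule r) simp
  qed
  then have "complex_of_real (LINT x|torus. norm (?P x)) = (LINT x|torus. ?P x)"
    unfolding integral_complex_of_real[symmetric] by simp
  also have "\<dots> = 1" by (subst integral_trig_poly) (auto simp: fejer_def fejer_coeff_def)
  finally show ?thesis by simp
qed

lemma fejer_tendsto: "(\<lambda>N. fejer (Suc N) n) \<longlonglongrightarrow> 1"
proof -
  have "(\<lambda>N. 1 - \<bar>of_int n\<bar> * inverse (real (Suc N))) \<longlonglongrightarrow> 1 - \<bar>of_int n\<bar> * 0"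
    by (intro tendsto_intros inverse_Suc_tendsto)
  then show ?thesis by (simp add: fejer_def divide_inverse)
qed

lemma fejer_bounds: "\<bar>n\<bar> \<le> int N \<Longrightarrow> 0 \<le> fejer N n" "fejer N n \<le> 1"
proof -
  assume "\<bar>n\<bar> \<le> int N"
  then have "\<bar>of_int n\<bar> \<le> real N" by linarith
  then show "0 \<le> fejer N n" by (cases "N = 0") (auto simp: fejer_def field_simps)
qed (simp add: fejer_def)

text \<open>Fejer kernels at 0 have norm 1 and stand in for a point mass: an operator extending the
  multiplier sends them to Fejer means of the polynomial with coefficients \<open>\<phi>\<close>,
  and these converge to that polynomial.\<close>

lemma integral_norm_trig_poly_le_multiplier_norm:
  assumes A: "finite A" "\<And>n. n \<notin> A \<Longrightarrow> \<phi> n = 0" and \<phi>: "\<phi> \<in> multipliers_Z 1"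
  shows "(LINT x|torus. norm (trig_poly A \<phi> x)) \<le> multiplier_norm_Z 1 \<phi>"
proof (rule le_multiplier_norm_Z[OF \<phi>])
  fix T assume T: "extends_multiplier_Z 1 \<phi> T"
  then have Tb: "bounded_Lp_operator 1 torus T" by (simp add: extends_multiplier_Z_def)
  \<comment> \<open>The coefficients of the kernel vanish beyond its order, while
    \<open>fejer\<close> does not; the case distinction restores the cut-off.\<close>
  let ?a = "\<lambda>N n. if \<bar>n\<bar> \<le> int (Suc N) then fejer (Suc N) n else 0"
  let ?S = "\<lambda>N. trig_poly A (\<lambda>n. \<phi> n * complex_of_real (?a N n))"
  have a: "\<bar>?a N n\<bar> \<le> 1" for N n
    using fejer_bounds[where N = "Suc N" and n = n] by auto
  have le: "(LINT x|torus. norm (?S N x)) \<le> Lp_onorm 1 torus T" for N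
  proof -
    let ?I = "{- int (Suc N)..int (Suc N)}"
    let ?K = "fejer_poly (Suc N) 0"
    have K: "?K \<in> Lp_space 1 torus"
      unfolding Lp_space_1
      by (rule integrable_torus_bounded[OF borel_measurable_torusI norm_trig_poly_le]) measurable
    have "AE x in torus. T ?K x = (\<Sum>\<^sub>\<infinity>n\<in>UNIV. \<phi> n * fourier_coeff ?K n * cis (2 * pi * of_int n * x))"
      using T trig_poly_in_trig_polys[of ?I] by (auto simp: extends_multiplier_Z_def)
    then have "AE x in torus. norm (T ?K x) = norm (?S N x)"
    proof eventually_elim
      case (elim x)
      have "T ?K x = (\<Sum>n\<in>A. \<phi> n * fourier_coeff ?K n * cis (2 * pi * of_int n * x))"
        unfolding elim by (rule infsum_finite_support) (use A in auto)
      also have "\<dots> = ?S N x"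
        unfolding trig_poly_def[of A] by (intro sum.cong refl) (auto simp: fourier_coeff_trig_poly fejer_coeff_def)
      finally show ?case by simp
    qed
    moreover have "T ?K \<in> borel_measurable torus"
      using Tb K by (auto simp: bounded_Lp_operator_def Lp_space_def)
    ultimately have "(LINT x|torus. norm (T ?K x)) = (LINT x|torus. norm (?S N x))"
      by (intro integral_cong_AE) (auto intro: borel_measurable_torusI)
    moreover have "(LINT x|torus. norm (T ?K x)) \<le> Lp_onorm 1 torus T * (LINT x|torus. norm (?K x))"
      using Lp_onorm_bound[OF Tb K] by (simp add: Lp_norm_1)
    ultimately show ?thesis by (subst (asm) integral_norm_fejer) auto
  qed
  have "(\<lambda>N. LINT x|torus. norm (?S N x)) \<longlonglongrightarrow> (LINT x|torus. norm (trig_poly A \<phi> x))"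
  proof (rule integral_dominated_convergence[where w = "\<lambda>_. \<Sum>n\<in>A. norm (\<phi> n)"])
    show "(\<lambda>x. norm (trig_poly A \<phi> x)) \<in> borel_measurable torus" "(\<lambda>x. norm (?S N x)) \<in> borel_measurable torus" for N
      by (auto intro: borel_measurable_torusI)
    show "AE x in torus. norm (norm (?S N x)) \<le> (\<Sum>n\<in>A. norm (\<phi> n))" for N
    proof (intro always_eventually allI)
      fix x
      have "norm (?S N x) \<le> (\<Sum>n\<in>A. norm (\<phi> n * complex_of_real (?a N n)))" by (rule norm_trig_poly_le)
      also have "\<dots> \<le> (\<Sum>n\<in>A. norm (\<phi> n))"
        by (intro sum_mono) (simp only: norm_mult norm_of_real, intro mult_left_le a norm_ge_zero)
      finally show "norm (norm (?S N x)) \<le> (\<Sum>n\<in>A. norm (\<phi> n))" by simp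
    qed
    show "AE x in torus. (\<lambda>N. norm (?S N x)) \<longlonglongrightarrow> norm (trig_poly A \<phi> x)"
    proof (intro always_eventually allI tendsto_norm)
      fix x
      have "(\<lambda>N. ?a N n) \<longlonglongrightarrow> 1" for n
      proof (rule Lim_transform_eventually[OF fejer_tendsto])
        show "\<forall>\<^sub>F N in sequentially. fejer (Suc N) n = ?a N n"
          using eventually_ge_at_top[of "nat \<bar>n\<bar>"] by eventually_elim auto
      qed
      then have "(\<lambda>N. ?S N x) \<longlonglongrightarrow> (\<Sum>n\<in>A. \<phi> n * complex_of_real 1 * cis (2 * pi * of_int n * x))"
        unfolding trig_poly_def by (intro tendsto_intros)
      then show "(\<lambda>N. ?S N x) \<longlonglongrightarrow> trig_poly A \<phi> x" by (simp add: trig_poly_def)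
    qed
  qed simp
  then show "(LINT x|torus. norm (trig_poly A \<phi> x)) \<le> Lp_onorm 1 torus T"
    by (rule tendsto_upperbound[OF _ always_eventually[OF allI[OF le]]]) simp
qed

section \<open>Convolution operators\<close>

lemma integrable_lebesgue_iff_borel_rep:
  fixes f g :: "real \<Rightarrow> complex"
  assumes "f \<in> borel_measurable lebesgue" "g \<in> borel_measurable borel" "AE x in lborel. f x = g x"
  shows "integrable lebesgue f \<longleftrightarrow> integrable lborel g"
proof -
  have "integrable lebesgue f \<longleftrightarrow> integrable lebesgue g"
    by (rule integrable_cong_AE[OF assms(1) borel_measurable_lebesgueI[OF assms(2)] AE_completion[OF assms(3)]])
  then show ?thesis using assms(2) by (simp add: integrable_completion)
qed

lemma integrable_convolution_pair:
  fixes f g :: "real \<Rightarrow> complex"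
  assumes f: "integrable lborel f" and g: "integrable lborel g"
  shows "integrable (lborel \<Otimes>\<^sub>M lborel) (\<lambda>(x, y). f y * g (x - y))"
    and "(\<integral>\<^sup>+x. \<integral>\<^sup>+y. ennreal (norm (f y * g (x - y))) \<partial>lborel \<partial>lborel)
      = ennreal ((LINT x|lborel. norm (g x)) * (LINT x|lborel. norm (f x)))"
proof -
  have [measurable]: "f \<in> borel_measurable borel" "g \<in> borel_measurable borel" using f g by auto
  have nf: "(\<integral>\<^sup>+x. ennreal (norm (f x)) \<partial>lborel) = ennreal (LINT x|lborel. norm (f x))"
    using f by (intro nn_integral_eq_integral) auto
  have ng: "(\<integral>\<^sup>+x. ennreal (norm (g x)) \<partial>lborel) = ennreal (LINT x|lborel. norm (g x))"
    using g by (intro nn_integral_eq_integral) auto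
  have "(\<integral>\<^sup>+x. \<integral>\<^sup>+y. ennreal (norm (f y * g (x - y))) \<partial>lborel \<partial>lborel)
      = (\<integral>\<^sup>+y. \<integral>\<^sup>+x. ennreal (norm (f y * g (x - y))) \<partial>lborel \<partial>lborel)"
    by (rule lborel_pair.Fubini'[symmetric]) measurable
  also have "\<dots> = (\<integral>\<^sup>+y. ennreal (norm (f y)) * ennreal (LINT x|lborel. norm (g x)) \<partial>lborel)"
  proof (intro nn_integral_cong)
    fix y
    have "(\<integral>\<^sup>+x. ennreal (norm (f y * g (x - y))) \<partial>lborel) = ennreal (norm (f y)) * (\<integral>\<^sup>+x. ennreal (norm (g (x - y))) \<partial>lborel)"
      by (subst nn_integral_cmult[symmetric]) (auto simp: norm_mult ennreal_mult'')
    then show "(\<integral>\<^sup>+x. ennreal (norm (f y * g (x - y))) \<partial>lborel) = ennreal (norm (f y)) * ennreal (LINT x|lborel. norm (g x))"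
      using nn_integral_translate[of "\<lambda>x. ennreal (norm (g x))" y] ng by simp
  qed
  also have "\<dots> = ennreal (LINT x|lborel. norm (f x)) * ennreal (LINT x|lborel. norm (g x))"
    unfolding nf[symmetric] by (rule nn_integral_multc) measurable
  also have "\<dots> = ennreal ((LINT x|lborel. norm (g x)) * (LINT x|lborel. norm (f x)))"
    by (simp add: ennreal_mult[symmetric] mult.commute)
  finally show eq: "(\<integral>\<^sup>+x. \<integral>\<^sup>+y. ennreal (norm (f y * g (x - y))) \<partial>lborel \<partial>lborel)
      = ennreal ((LINT x|lborel. norm (g x)) * (LINT x|lborel. norm (f x)))" .
  have meas: "(\<lambda>(x, y). f y * g (x - y)) \<in> borel_measurable (lborel \<Otimes>\<^sub>M lborel)" by measurable
  show "integrable (lborel \<Otimes>\<^sub>M lborel) (\<lambda>(x, y). f y * g (x - y))"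
  proof (rule integrableI_bounded[OF meas])
    have "(\<integral>\<^sup>+z. ennreal (norm (case z of (x, y) \<Rightarrow> f y * g (x - y))) \<partial>(lborel \<Otimes>\<^sub>M lborel))
      = (\<integral>\<^sup>+x. \<integral>\<^sup>+y. ennreal (norm (f y * g (x - y))) \<partial>lborel \<partial>lborel)"
      by (subst lborel.nn_integral_fst[symmetric]) auto
    then show "(\<integral>\<^sup>+z. ennreal (norm (case z of (x, y) \<Rightarrow> f y * g (x - y))) \<partial>(lborel \<Otimes>\<^sub>M lborel)) < \<infinity>"
      unfolding eq by simp
  qed
qed

lemma convolution_integrable:
  fixes f g :: "real \<Rightarrow> complex"
  assumes f: "integrable lborel f" and g: "integrable lborel g"
  shows "AE x in lborel. integrable lborel (\<lambda>y. f y * g (x - y))"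
    and "integrable lborel (\<lambda>x. LINT y|lborel. f y * g (x - y))"
    and "(LINT x|lborel. norm (LINT y|lborel. f y * g (x - y))) \<le> (LINT x|lborel. norm (g x)) * (LINT x|lborel. norm (f x))"
proof -
  note int = integrable_convolution_pair(1)[OF f g]
  show ae: "AE x in lborel. integrable lborel (\<lambda>y. f y * g (x - y))"
    using lborel_pair.AE_integrable_fst'[OF int] by simp
  show int2: "integrable lborel (\<lambda>x. LINT y|lborel. f y * g (x - y))"
    using lborel_pair.integrable_fst'[OF int] by simp
  have "ennreal (LINT x|lborel. norm (LINT y|lborel. f y * g (x - y))) = (\<integral>\<^sup>+x. ennreal (norm (LINT y|lborel. f y * g (x - y))) \<partial>lborel)"
    using int2 by (intro nn_integral_eq_integral[symmetric]) auto
  also have "\<dots> \<le> (\<integral>\<^sup>+x. \<integral>\<^sup>+y. ennreal (norm (f y * g (x - y))) \<partial>lborel \<partial>lborel)"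
    using ae by (intro nn_integral_mono_AE, eventually_elim) (rule integral_norm_bound_ennreal)
  also have "\<dots> = ennreal ((LINT x|lborel. norm (g x)) * (LINT x|lborel. norm (f x)))"
    by (rule integrable_convolution_pair(2)[OF f g])
  finally show "(LINT x|lborel. norm (LINT y|lborel. f y * g (x - y))) \<le> (LINT x|lborel. norm (g x)) * (LINT x|lborel. norm (f x))"
    by (subst (asm) ennreal_le_iff) (auto intro!: mult_nonneg_nonneg integral_nonneg_AE)
qed

lemma fourier_reflect_translate:
  assumes g: "integrable lborel g"
  shows "fourier (\<lambda>y. g (x + y)) \<xi> = fourier g \<xi> * cis (2 * pi * \<xi> * x)"
proof -
  have [measurable]: "g \<in> borel_measurable borel" using g by auto
  have "fourier (\<lambda>y. g (x + y)) \<xi> = (LINT y|lborel. g (x + y) * cis (- 2 * pi * \<xi> * y))"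
    by (rule fourier_lborel) measurable
  also have "\<dots> = (LINT y|lborel. g (x + (y - x)) * cis (- 2 * pi * \<xi> * (y - x)))"
    by (rule integral_translate[symmetric])
  also have "\<dots> = (LINT y|lborel. (g y * cis (- 2 * pi * \<xi> * y)) * cis (2 * pi * \<xi> * x))"
    by (intro Bochner_Integration.integral_cong refl) (simp add: mult.assoc cis_mult algebra_simps)
  also have "\<dots> = fourier g \<xi> * cis (2 * pi * \<xi> * x)"
    by (simp add: fourier_lborel)
  finally show ?thesis .
qed

text \<open>The operator is convolution with \<open>g\<close>, bounded by Young's inequality. On
  Schwartz functions inversion and the multiplication formula give the required identity at every
  point.\<close>

lemma extends_multiplier_R_L1:
  assumes g: "integrable lborel g" and m: "m \<in> borel_measurable lebesgue" "AE \<xi> in lborel. m \<xi> = fourier g \<xi>"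
  obtains T where "extends_multiplier_R 1 m T" "Lp_onorm 1 lebesgue T \<le> (LINT x|lborel. norm (g x))"
proof -
  have [measurable]: "g \<in> borel_measurable borel" using g by auto
  let ?C = "LINT x|lborel. norm (g x)"
  \<comment> \<open>Where the integrand is not integrable the value is 0 by default, so additivity
    is obtained only at the points supplied by \<open>T_ae\<close>.\<close>
  define T where "T f x = (LINT y|lebesgue. f y * g (x - y))" for f x
  have rep: "\<exists>f'. integrable lborel f' \<and> (\<forall>x. T f x = (LINT y|lborel. f' y * g (x - y))) \<and>
      (LINT x|lborel. norm (f' x)) = (LINT x|lebesgue. norm (f x))
      \<and> (AE x in lborel. f x = f' x)"
    if f: "f \<in> Lp_space 1 lebesgue" for f
  proof -
    have fi: "integrable lebesgue f" using f by (simp add: Lp_space_1)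
    then have fm: "f \<in> borel_measurable lebesgue" by auto
    obtain f' where f' [measurable]: "f' \<in> borel_measurable borel" and ae: "AE x in lborel. f x = f' x"
      using lebesgue_borel_rep[OF fm] by blast
    have "T f x = (LINT y|lborel. f' y * g (x - y))" for x
    proof -
      have gm: "(\<lambda>y. g (x - y)) \<in> borel_measurable lebesgue" by (rule borel_measurable_lebesgueI) measurable
      have "T f x = (LINT y|lebesgue. f' y * g (x - y))"
        unfolding T_def
        using AE_completion[OF ae] fm borel_measurable_lebesgueI[OF f'] gm
        by (intro integral_cong_AE borel_measurable_times) (auto elim: eventually_mono)
      then show ?thesis by (simp add: integral_completion)
    qed
    moreover have "(LINT x|lebesgue. norm (f x)) = (LINT x|lebesgue. norm (f' x))"
      using AE_completion[OF ae] fm borel_measurable_lebesgueI[OF f']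
      by (intro integral_cong_AE borel_measurable_norm) (auto elim: eventually_mono)
    then have "(LINT x|lborel. norm (f' x)) = (LINT x|lebesgue. norm (f x))" by (simp add: integral_completion)
    moreover have "integrable lborel f'" using integrable_lebesgue_iff_borel_rep[OF fm f' ae] fi by simp
    ultimately show ?thesis using ae by blast
  qed
  have T_Lp: "T f \<in> Lp_space 1 lebesgue"
    and T_norm: "Lp_norm 1 lebesgue (T f) \<le> ?C * Lp_norm 1 lebesgue f"
    and T_ae: "AE x in lborel. integrable lebesgue (\<lambda>y. f y * g (x - y))" if f: "f \<in> Lp_space 1 lebesgue" for f
  proof -
    obtain f' where f': "integrable lborel f'" and eq: "\<And>x. T f x = (LINT y|lborel. f' y * g (x - y))"
      and nrm: "(LINT x|lborel. norm (f' x)) = (LINT x|lebesgue. norm (f x))" and ae: "AE x in lborel. f x = f' x"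
      using rep[OF f] by blast
    have [measurable]: "f' \<in> borel_measurable borel" using f' by auto
    have Tf: "T f = (\<lambda>x. LINT y|lborel. f' y * g (x - y))" using eq by auto
    have int: "integrable lborel (T f)" unfolding Tf using convolution_integrable(2)[OF f' g] .
    then have [measurable]: "T f \<in> borel_measurable borel" by auto
    show "T f \<in> Lp_space 1 lebesgue" using int by (simp add: Lp_space_1 integrable_completion)
    have "(LINT x|lebesgue. norm (T f x)) = (LINT x|lborel. norm (T f x))" by (rule integral_completion) measurable
    then show "Lp_norm 1 lebesgue (T f) \<le> ?C * Lp_norm 1 lebesgue f"
      using convolution_integrable(3)[OF f' g] by (simp add: Lp_norm_1 eq nrm)
    show "AE x in lborel. integrable lebesgue (\<lambda>y. f y * g (x - y))"
      using convolution_integrable(1)[OF f' g]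
    proof eventually_elim
      case (elim x)
      have "f \<in> borel_measurable lebesgue" using f by (simp add: Lp_space_def)
      moreover have "(\<lambda>y. g (x - y)) \<in> borel_measurable lebesgue" by (rule borel_measurable_lebesgueI) measurable
      ultimately have "(\<lambda>y. f y * g (x - y)) \<in> borel_measurable lebesgue" by (rule borel_measurable_times)
      moreover have "AE y in lborel. f y * g (x - y) = f' y * g (x - y)"
        using ae by eventually_elim simp
      ultimately show ?case
        using elim by (subst integrable_lebesgue_iff_borel_rep[of _ "\<lambda>y. f' y * g (x - y)"]) auto
    qed
  qed
  have ext: "AE x in lebesgue. T f x = inv_fourier (\<lambda>\<xi>. m \<xi> * fourier f \<xi>) x" if f: "f \<in> schwartz" for f
  proof (intro always_eventually allI)
    fix x
    have fi: "integrable lborel f" "integrable lborel (fourier f)"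
      using schwartz_integrable[OF f, of 0] integrable_fourier_schwartz[OF f] by auto
    then have [measurable]: "f \<in> borel_measurable borel" "fourier f \<in> borel_measurable borel" by auto
    have [measurable]: "fourier g \<in> borel_measurable borel" using g by (rule borel_measurable_fourier)
    have gx: "integrable lborel (\<lambda>y. g (x + y))"
      using lborel_integrable_real_affine[OF g, of 1 x] by simp
    have "T f x = (LINT y|lborel. f y * g (x - y))"
      unfolding T_def by (rule integral_completion) measurable
    also have "\<dots> = (LINT y|lborel. f (- y) * g (x + y))"
      using lborel_integral_real_affine[of "- 1" "\<lambda>y. f y * g (x - y)" 0] by simp
    also have "\<dots> = (LINT y|lborel. fourier (fourier f) y * g (x + y))"
      using schwartz_inversion[OF f] by simp
    also have "\<dots> = (LINT \<xi>|lborel. fourier f \<xi> * fourier (\<lambda>y. g (x + y)) \<xi>)"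
      by (rule integral_fourier_mult[OF fi(2) gx])
    also have "\<dots> = (LINT \<xi>|lborel. (fourier g \<xi> * fourier f \<xi>) * cis (- 2 * pi * (- x) * \<xi>))"
      by (simp add: fourier_reflect_translate[OF g] mult_ac)
    also have "\<dots> = fourier (\<lambda>\<xi>. fourier g \<xi> * fourier f \<xi>) (- x)"
      by (rule fourier_lborel[symmetric]) measurable
    also have "fourier (\<lambda>\<xi>. fourier g \<xi> * fourier f \<xi>) = fourier (\<lambda>\<xi>. m \<xi> * fourier f \<xi>)"
    proof (rule fourier_cong_AE)
      show "(\<lambda>\<xi>. fourier g \<xi> * fourier f \<xi>) \<in> borel_measurable lebesgue"
        by (rule borel_measurable_lebesgueI) measurable
      show "(\<lambda>\<xi>. m \<xi> * fourier f \<xi>) \<in> borel_measurable lebesgue"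
        by (intro borel_measurable_times m borel_measurable_lebesgueI) measurable
      show "AE \<xi> in lborel. fourier g \<xi> * fourier f \<xi> = m \<xi> * fourier f \<xi>"
        using m(2) by eventually_elim simp
    qed
    finally show "T f x = inv_fourier (\<lambda>\<xi>. m \<xi> * fourier f \<xi>) x" by (simp add: inv_fourier_eq)
  qed
  show thesis
  proof
    have C0: "?C \<ge> 0" by (intro integral_nonneg_AE) simp
    show "Lp_onorm 1 lebesgue T \<le> ?C" using T_norm C0 by (rule Lp_onorm_le)
    show "extends_multiplier_R 1 m T"
      unfolding extends_multiplier_R_def bounded_Lp_operator_def
    proof (intro conjI ballI allI)
      show "AE x in lebesgue. T (\<lambda>y. f y + g y) x = T f x + T g x"
        if "f \<in> Lp_space 1 lebesgue" "g \<in> Lp_space 1 lebesgue" for f g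
        using AE_completion[OF T_ae[OF that(1)]] AE_completion[OF T_ae[OF that(2)]]
        by eventually_elim (simp add: T_def distrib_right)
      show "AE x in lebesgue. T (\<lambda>y. c * f y) x = c * T f x" for c f
        by (simp add: T_def mult.assoc)
    qed (use T_Lp T_norm ext in blast)+
  qed
qed

text \<open>The operator is convolution with the polynomial on the torus, so this is Young's
  inequality again. Together with \<open>integral_norm_trig_poly_le_multiplier_norm\<close> it makes
  the multiplier norm equal to the L1 norm of the polynomial.\<close>

lemma trig_poly_L1_multiplier:
  assumes A: "finite A" "\<And>n. n \<notin> A \<Longrightarrow> \<phi> n = 0"
  shows "\<phi> \<in> multipliers_Z 1" "multiplier_norm_Z 1 \<phi> \<le> (LINT x|torus. norm (trig_poly A \<phi> x))"
proof -
  let ?C = "LINT x|torus. norm (trig_poly A \<phi> x)"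
  have C0: "?C \<ge> 0" by (intro integral_nonneg_AE) simp
  have Pint: "(\<integral>\<^sup>+x. ennreal (norm (trig_poly A \<phi> x)) \<partial>torus) = ennreal ?C"
    by (intro nn_integral_eq_integral integrable_norm integrable_torus_bounded[OF _ norm_trig_poly_le] borel_measurable_torusI)
       auto
  \<comment> \<open>The interval representing the torus is not invariant under translation: the part
    \<open>{- y..<0}\<close> sticks out and is moved by one period to
    \<open>{1 - y..<1}\<close>.\<close>
  have shift: "(\<integral>\<^sup>+x. ennreal (norm (trig_poly A \<phi> (x - y))) \<partial>torus) = ennreal ?C" if y: "0 \<le> y" "y < 1" for y
  proof -
    let ?h = "\<lambda>x. ennreal (norm (trig_poly A \<phi> x))"
    have "(\<integral>\<^sup>+x. ?h (x - y) \<partial>torus) = (\<integral>\<^sup>+x. ?h (x - y) * indicator {0..<1} x \<partial>lborel)"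
      by (rule nn_integral_torus)
    also have "\<dots> = (\<integral>\<^sup>+x. ?h ((x - (- y)) - y) * indicator {0..<1} (x - (- y)) \<partial>lborel)"
      by (rule nn_integral_translate[symmetric]) measurable
    also have "\<dots> = (\<integral>\<^sup>+x. ?h x * indicator {- y..<0} x + ?h x * indicator {0..<1 - y} x \<partial>lborel)"
      using y by (intro nn_integral_cong) (auto simp: indicator_def)
    also have "\<dots> = (\<integral>\<^sup>+x. ?h x * indicator {- y..<0} x \<partial>lborel) + (\<integral>\<^sup>+x. ?h x * indicator {0..<1 - y} x \<partial>lborel)"
      by (rule nn_integral_add) measurable
    also have "(\<integral>\<^sup>+x. ?h x * indicator {- y..<0} x \<partial>lborel) = (\<integral>\<^sup>+x. ?h (x - 1) * indicator {- y..<0} (x - 1) \<partial>lborel)"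
      by (rule nn_integral_translate[symmetric]) measurable
    also have "\<dots> = (\<integral>\<^sup>+x. ?h x * indicator {1 - y..<1} x \<partial>lborel)"
      using trig_poly_periodic[of A \<phi> "_ - 1"] by (intro nn_integral_cong) (auto simp: indicator_def)
    also have "\<dots> + (\<integral>\<^sup>+x. ?h x * indicator {0..<1 - y} x \<partial>lborel)
       = (\<integral>\<^sup>+x. ?h x * indicator {1 - y..<1} x + ?h x * indicator {0..<1 - y} x \<partial>lborel)"
      by (rule nn_integral_add[symmetric]) measurable
    also have "\<dots> = (\<integral>\<^sup>+x. ?h x * indicator {0..<1} x \<partial>lborel)"
      using y by (intro nn_integral_cong) (auto simp: indicator_def)
    finally show ?thesis using Pint by (simp add: nn_integral_torus)
  qed
  have bd: "Lp_norm 1 torus (trig_poly A (\<lambda>n. \<phi> n * fourier_coeff f n)) \<le> ?C * Lp_norm 1 torus f"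
    if f: "f \<in> Lp_space 1 torus" for f
  proof -
    have fi: "integrable torus f" using f by (simp add: Lp_space_1)
    then have [measurable]: "f \<in> borel_measurable torus" by auto
    have [measurable]: "(\<lambda>x. x) \<in> torus \<rightarrow>\<^sub>M borel" by (rule borel_measurable_torusI) simp
    have conv: "trig_poly A (\<lambda>n. \<phi> n * fourier_coeff f n) x = (LINT y|torus. f y * trig_poly A \<phi> (x - y))" for x
    proof -
      have "(LINT y|torus. f y * trig_poly A \<phi> (x - y))
          = (LINT y|torus. (\<Sum>n\<in>A. (\<phi> n * cis (2 * pi * of_int n * x)) * (f y * cis (- 2 * pi * of_int n * y))))"
      proof (intro Bochner_Integration.integral_cong refl)
        fix y
        have "cis (2 * pi * of_int n * (x - y)) = cis (2 * pi * of_int n * x) * cis (- 2 * pi * of_int n * y)" for n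
          by (simp add: cis_mult algebra_simps)
        then show "f y * trig_poly A \<phi> (x - y) = (\<Sum>n\<in>A. (\<phi> n * cis (2 * pi * of_int n * x)) * (f y * cis (- 2 * pi * of_int n * y)))"
          by (simp add: trig_poly_def sum_distrib_left mult_ac)
      qed
      also have "\<dots> = (\<Sum>n\<in>A. LINT y|torus. (\<phi> n * cis (2 * pi * of_int n * x)) * (f y * cis (- 2 * pi * of_int n * y)))"
        by (intro Bochner_Integration.integral_sum integrable_mult_right integrable_torus_mult_cis fi)
      also have "\<dots> = (\<Sum>n\<in>A. (\<phi> n * cis (2 * pi * of_int n * x)) * fourier_coeff f n)"
        unfolding fourier_coeff_def by (intro sum.cong refl integral_mult_right_zero)
      finally show ?thesis by (simp add: trig_poly_def mult_ac)
    qed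
    interpret pair: pair_sigma_finite torus torus ..
    have "ennreal (LINT x|torus. norm (trig_poly A (\<lambda>n. \<phi> n * fourier_coeff f n) x))
       = (\<integral>\<^sup>+x. ennreal (norm (trig_poly A (\<lambda>n. \<phi> n * fourier_coeff f n) x)) \<partial>torus)"
      by (intro nn_integral_eq_integral[symmetric] integrable_norm integrable_torus_bounded[OF _ norm_trig_poly_le] borel_measurable_torusI)
         auto
    also have "\<dots> \<le> (\<integral>\<^sup>+x. \<integral>\<^sup>+y. ennreal (norm (f y * trig_poly A \<phi> (x - y))) \<partial>torus \<partial>torus)"
    proof (intro nn_integral_mono)
      fix x
      have "integrable torus (\<lambda>y. (\<Sum>n\<in>A. norm (\<phi> n)) * norm (f y))" using fi by auto
      then have "integrable torus (\<lambda>y. f y * trig_poly A \<phi> (x - y))"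
      proof (rule Bochner_Integration.integrable_bound)
        have "(\<lambda>y. trig_poly A \<phi> (x - y)) \<in> borel_measurable torus" by (rule borel_measurable_torusI) measurable
        then show "(\<lambda>y. f y * trig_poly A \<phi> (x - y)) \<in> borel_measurable torus" by measurable
        show "AE y in torus. norm (f y * trig_poly A \<phi> (x - y)) \<le> norm ((\<Sum>n\<in>A. norm (\<phi> n)) * norm (f y))"
        proof (intro always_eventually allI)
          fix y
          have "norm (f y * trig_poly A \<phi> (x - y)) \<le> (\<Sum>n\<in>A. norm (\<phi> n)) * norm (f y)"
            unfolding norm_mult by (subst mult.commute) (intro mult_right_mono norm_trig_poly_le norm_ge_zero)
          then show "norm (f y * trig_poly A \<phi> (x - y)) \<le> norm ((\<Sum>n\<in>A. norm (\<phi> n)) * norm (f y))"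
            unfolding real_norm_def by (rule order_trans[OF _ abs_ge_self])
        qed
      qed
      then show "ennreal (norm (trig_poly A (\<lambda>n. \<phi> n * fourier_coeff f n) x)) \<le> (\<integral>\<^sup>+y. ennreal (norm (f y * trig_poly A \<phi> (x - y))) \<partial>torus)"
        unfolding conv by (rule integral_norm_bound_ennreal)
    qed
    also have "\<dots> = (\<integral>\<^sup>+y. \<integral>\<^sup>+x. ennreal (norm (f y * trig_poly A \<phi> (x - y))) \<partial>torus \<partial>torus)"
      by (rule pair.Fubini'[symmetric]) measurable
    also have "\<dots> = (\<integral>\<^sup>+y. ennreal (norm (f y)) * ennreal ?C \<partial>torus)"
    proof (intro nn_integral_cong)
      fix y assume "y \<in> space torus"
      then have y: "0 \<le> y" "y < 1" by (auto simp: space_torus)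
      have "(\<lambda>x. trig_poly A \<phi> (x - y)) \<in> borel_measurable torus" by (rule borel_measurable_torusI) measurable
      then have "(\<integral>\<^sup>+x. ennreal (norm (f y)) * ennreal (norm (trig_poly A \<phi> (x - y))) \<partial>torus) = ennreal (norm (f y)) * ennreal ?C"
        unfolding shift[OF y, symmetric] by (intro nn_integral_cmult) auto
      then show "(\<integral>\<^sup>+x. ennreal (norm (f y * trig_poly A \<phi> (x - y))) \<partial>torus) = ennreal (norm (f y)) * ennreal ?C"
        by (simp add: norm_mult ennreal_mult)
    qed
    also have "\<dots> = (\<integral>\<^sup>+y. ennreal (norm (f y)) \<partial>torus) * ennreal ?C"
      by (rule nn_integral_multc) measurable
    also have "(\<integral>\<^sup>+y. ennreal (norm (f y)) \<partial>torus) = ennreal (LINT y|torus. norm (f y))"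
      using fi by (intro nn_integral_eq_integral) auto
    also have "\<dots> * ennreal ?C = ennreal (?C * (LINT y|torus. norm (f y)))"
      unfolding mult.commute[of ?C] using C0 by (rule ennreal_mult''[symmetric])
    finally have "(LINT x|torus. norm (trig_poly A (\<lambda>n. \<phi> n * fourier_coeff f n) x)) \<le> ?C * (LINT y|torus. norm (f y))"
      by (subst (asm) ennreal_le_iff) (intro mult_nonneg_nonneg C0 integral_nonneg_AE, simp)
    then show ?thesis unfolding Lp_norm_1 .
  qed
  show "\<phi> \<in> multipliers_Z 1" "multiplier_norm_Z 1 \<phi> \<le> ?C"
    using extends_multiplier_Z_finite[OF A _ C0 _ bd] by (auto simp: Lp_space_1)
qed

lemma fourier_sum_mult_cis:
  assumes "finite A" "integrable lborel f"
  shows "fourier (\<lambda>x. f x * trig_poly A a x) \<xi> = (\<Sum>n\<in>A. a n * fourier f (\<xi> - of_int n))"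
proof -
  have [measurable]: "f \<in> borel_measurable borel" using assms(2) by auto
  have "fourier (\<lambda>x. f x * trig_poly A a x) \<xi> = (LINT x|lborel. f x * trig_poly A a x * cis (- 2 * pi * \<xi> * x))"
    by (rule fourier_lborel) measurable
  also have "\<dots> = (LINT x|lborel. (\<Sum>n\<in>A. a n * (f x * cis (- 2 * pi * (\<xi> - of_int n) * x))))"
  proof (intro Bochner_Integration.integral_cong refl)
    fix x
    have "cis (2 * pi * of_int n * x) * cis (- 2 * pi * \<xi> * x) = cis (- 2 * pi * (\<xi> - of_int n) * x)" for n
      by (simp add: cis_mult algebra_simps)
    then show "f x * trig_poly A a x * cis (- 2 * pi * \<xi> * x) = (\<Sum>n\<in>A. a n * (f x * cis (- 2 * pi * (\<xi> - of_int n) * x)))"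
      unfolding trig_poly_def sum_distrib_left sum_distrib_right
      by (intro sum.cong refl) (simp add: mult.assoc mult.left_commute[of "f x"])
  qed
  also have "\<dots> = (\<Sum>n\<in>A. LINT x|lborel. a n * (f x * cis (- 2 * pi * (\<xi> - of_int n) * x)))"
    by (intro Bochner_Integration.integral_sum integrable_mult_right integrable_mult_cis assms(2)) measurable
  also have "\<dots> = (\<Sum>n\<in>A. a n * fourier f (\<xi> - of_int n))"
    by (simp add: fourier_lborel)
  finally show ?thesis .
qed

lemma nn_integral_mult_trig_poly_le:
  assumes [measurable]: "f \<in> borel_measurable borel" and "C \<ge> 0"
    and C: "AE \<xi> in lborel. \<forall>N. (\<Sum>n = - int N..int N. norm (f (\<xi> - of_int n))) \<le> C"
  shows "(\<integral>\<^sup>+x. ennreal (norm (f x * trig_poly A a x)) \<partial>lborel) \<le> ennreal (C * (LINT x|torus. norm (trig_poly A a x)))"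
proof -
  let ?P = "\<lambda>x. ennreal (norm (trig_poly A a x))"
  have "(\<integral>\<^sup>+x. ennreal (norm (f x * trig_poly A a x)) \<partial>lborel) = (\<integral>\<^sup>+x. ?P x * ennreal (norm (f x)) \<partial>lborel)"
    by (simp add: norm_mult ennreal_mult'' mult.commute)
  also have "\<dots> = (\<integral>\<^sup>+x. ?P x * (\<Sum>\<^sub>\<infinity>n\<in>UNIV. ennreal (norm (f (x + of_int n)))) \<partial>torus)"
    by (rule nn_integral_mult_periodic) measurable
  also have "\<dots> \<le> (\<integral>\<^sup>+x. ?P x * ennreal C \<partial>torus)"
    unfolding nn_integral_torus
  proof (rule nn_integral_mono_AE)
    show "AE x in lborel. ?P x * (\<Sum>\<^sub>\<infinity>n\<in>UNIV. ennreal (norm (f (x + of_int n)))) * indicator {0..<1} x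
        \<le> ?P x * ennreal C * indicator {0..<1} x"
      using C
    proof eventually_elim
      case (elim x)
      have "(\<Sum>\<^sub>\<infinity>n\<in>UNIV. ennreal (norm (f (x + of_int n)))) \<le> ennreal C"
        unfolding infsum_int_ennreal
      proof (rule SUP_least)
        fix N
        have "(\<Sum>n = - int N..int N. norm (f (x + of_int n))) \<le> C"
          using elim[rule_format, of N] sum_int_reflect[of "\<lambda>n. norm (f (x + of_int n))" N] by simp
        then show "(\<Sum>n = - int N..int N. ennreal (norm (f (x + of_int n)))) \<le> ennreal C"
          by (simp add: sum_ennreal ennreal_leI)
      qed
      then show ?case by (intro mult_right_mono mult_left_mono) auto
    qed
  qed
  also have "\<dots> = (\<integral>\<^sup>+x. ?P x \<partial>torus) * ennreal C"
    by (rule nn_integral_multc) (auto intro: borel_measurable_torusI)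
  also have "(\<integral>\<^sup>+x. ?P x \<partial>torus) = ennreal (LINT x|torus. norm (trig_poly A a x))"
    by (intro nn_integral_eq_integral integrable_norm integrable_torus_bounded[OF _ norm_trig_poly_le] borel_measurable_torusI) auto
  also have "\<dots> * ennreal C = ennreal (C * (LINT x|torus. norm (trig_poly A a x)))"
    unfolding mult.commute[of C] using \<open>C \<ge> 0\<close> by (rule ennreal_mult''[symmetric])
  finally show ?thesis .
qed

lemma summability_kernels0_1_if_fourier:
  assumes F: "F \<in> Lp_space 1 lebesgue" and fin: "periodization_bound F < \<infinity>"
    and \<Lambda>: "AE \<xi> in lebesgue. \<Lambda> \<xi> = fourier F \<xi>"
  shows "\<Lambda> \<in> summability_kernels0 1"
proof -
  have Fm: "F \<in> borel_measurable lebesgue" and Fi: "integrable lebesgue F"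
    using F by (auto simp: Lp_space_1)
  obtain f where f [measurable]: "f \<in> borel_measurable borel" and Ff: "AE x in lborel. F x = f x"
    using lebesgue_borel_rep[OF Fm] by blast
  have fi: "integrable lborel f" using integrable_lebesgue_iff_borel_rep[OF Fm f Ff] Fi by simp
  have four: "fourier F = fourier f" by (rule fourier_cong_AE[OF Fm borel_measurable_lebesgueI[OF f] Ff])
  have \<Lambda>f: "AE \<xi> in lborel. \<Lambda> \<xi> = fourier f \<xi>" using \<Lambda> by (simp add: AE_completion_iff four)
  have Am: "\<Lambda> \<in> borel_measurable lebesgue"
  proof (rule borel_measurable_AE)
    show "fourier f \<in> borel_measurable lebesgue"
      by (intro borel_measurable_lebesgueI borel_measurable_fourier fi)
    show "AE \<xi> in lebesgue. fourier f \<xi> = \<Lambda> \<xi>"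
      using AE_completion[OF \<Lambda>f] by eventually_elim simp
  qed
  have Linf: "\<Lambda> \<in> Linfty_space lebesgue"
  proof -
    have "AE \<xi> in lebesgue. norm (\<Lambda> \<xi>) \<le> (LINT x|lborel. norm (f x))"
      using AE_completion[OF \<Lambda>f] by eventually_elim (simp add: norm_fourier_le fi)
    with Am show ?thesis by (auto simp: Linfty_space_def)
  qed
  obtain C where C0: "C \<ge> 0" and CF: "AE \<xi> in lborel. \<forall>N. (\<Sum>n = - int N..int N. norm (F (\<xi> - of_int n))) \<le> C"
    using iffD1[OF periodization_bound_finite_iff[OF Fm] fin] by blast
  \<comment> \<open>One null set serves all integer translates, so \<open>F\<close> may be replaced
    by \<open>f\<close> in every partial sum at once.\<close>
  have "AE \<xi> in lborel. \<forall>n::int. F (\<xi> - of_int n) = f (\<xi> - of_int n)"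
    unfolding AE_all_countable using AE_lborel_translate[OF Ff, of "- of_int n" for n] by simp
  with CF have C: "AE \<xi> in lborel. \<forall>N. (\<Sum>n = - int N..int N. norm (f (\<xi> - of_int n))) \<le> C"
    by eventually_elim simp
  have "W \<phi> \<Lambda> \<in> multipliers_R 1 \<and> multiplier_norm_R 1 (W \<phi> \<Lambda>) \<le> C * multiplier_norm_Z 1 \<phi>"
    if \<phi>: "\<phi> \<in> multipliers_Z 1" and A: "finite {n. \<phi> n \<noteq> 0}" for \<phi>
  proof -
    let ?A = "{n. \<phi> n \<noteq> 0}"
    let ?g = "\<lambda>x. f x * trig_poly ?A \<phi> x"
    let ?p = "LINT x|torus. norm (trig_poly ?A \<phi> x)"
    have p: "?p \<le> multiplier_norm_Z 1 \<phi>"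
      using A \<phi> by (intro integral_norm_trig_poly_le_multiplier_norm) auto
    note bd = nn_integral_mult_trig_poly_le[OF f C0 C, of ?A \<phi>]
    have gi: "integrable lborel ?g"
      using bd by (intro integrableI_bounded) (auto intro: order.strict_trans1)
    have "ennreal (LINT x|lborel. norm (?g x)) \<le> ennreal (C * ?p)"
      using bd nn_integral_eq_integral[OF integrable_norm[OF gi]] by simp
    then have g_le: "(LINT x|lborel. norm (?g x)) \<le> C * multiplier_norm_Z 1 \<phi>"
      using p C0 by (subst (asm) ennreal_le_iff) (auto intro!: mult_nonneg_nonneg integral_nonneg_AE intro: order_trans mult_left_mono)
    have ae: "AE \<xi> in lborel. W \<phi> \<Lambda> \<xi> = fourier ?g \<xi>"
    proof -
      have "AE \<xi> in lborel. \<forall>n::int. \<Lambda> (\<xi> - of_int n) = fourier f (\<xi> - of_int n)"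
        unfolding AE_all_countable using AE_lborel_translate[OF \<Lambda>f, of "- of_int n" for n] by simp
      then show ?thesis
      proof eventually_elim
        case (elim \<xi>)
        have "W \<phi> \<Lambda> \<xi> = (\<Sum>n\<in>?A. \<phi> n * \<Lambda> (\<xi> - of_int n))" using A by (rule W_finite) simp
        also have "\<dots> = fourier ?g \<xi>" unfolding fourier_sum_mult_cis[OF A fi] using elim by simp
        finally show ?case .
      qed
    qed
    have Wm: "W \<phi> \<Lambda> \<in> borel_measurable lebesgue" by (rule borel_measurable_W[OF Am])
    obtain T where T: "extends_multiplier_R 1 (W \<phi> \<Lambda>) T" "Lp_onorm 1 lebesgue T \<le> (LINT x|lborel. norm (?g x))"
      using extends_multiplier_R_L1[OF gi Wm ae] by blast
    have "AE \<xi> in lebesgue. norm (W \<phi> \<Lambda> \<xi>) \<le> (LINT x|lborel. norm (?g x))"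
      using AE_completion[OF ae] by eventually_elim (simp only: norm_fourier_le[OF gi])
    then have "W \<phi> \<Lambda> \<in> multipliers_R 1"
      using T(1) Wm by (auto simp: multipliers_R_def Linfty_space_def)
    moreover have "multiplier_norm_R 1 (W \<phi> \<Lambda>) \<le> C * multiplier_norm_Z 1 \<phi>"
      using multiplier_norm_R_le[OF T] g_le by (rule order_trans)
    ultimately show ?thesis ..
  qed
  with Linf show ?thesis unfolding summability_kernels0_def by blast
qed

lemma borel_measurable_fejer_coeff [measurable]: "(\<lambda>b. fejer_coeff N b n) \<in> borel_measurable borel"
  unfolding fejer_coeff_def by measurable

section \<open>Summability kernels for exponent 1\<close>

definition fejer_W :: "(real \<Rightarrow> complex) \<Rightarrow> nat \<Rightarrow> real \<Rightarrow> real \<Rightarrow> complex" where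
  "fejer_W \<Lambda> N b \<xi> = (\<Sum>n = - int N..int N. fejer_coeff N b n * \<Lambda> (\<xi> - of_int n))"

lemma borel_measurable_fejer_W [measurable]:
  assumes [measurable]: "\<Lambda> \<in> borel_measurable borel"
  shows "fejer_W \<Lambda> N b \<in> borel_measurable borel"
  unfolding fejer_W_def[abs_def] by measurable

lemma norm_fejer_W_le:
  assumes "\<And>\<xi>. norm (\<Lambda> \<xi>) \<le> B"
  shows "norm (fejer_W \<Lambda> N b \<xi>) \<le> (\<Sum>n = - int N..int N. norm (fejer_coeff N b n)) * B"
  unfolding fejer_W_def sum_distrib_right
  by (rule order_trans[OF norm_sum], intro sum_mono) (simp only: norm_mult, intro mult_left_mono assms, simp)

lemma integral_norm_wave_packet:
  assumes "s > 0"
  shows "(LINT x|lborel. norm (wave_packet s \<eta> x)) = 1"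
  using assms by (simp add: wave_packet_def norm_mult)

lemma integrable_bounded_mult_gauss_hat:
  assumes [measurable]: "u \<in> borel_measurable borel" and B: "\<And>\<xi>. norm (u \<xi>) \<le> B" and "s > 0"
  shows "integrable lborel (\<lambda>\<xi>. u \<xi> * complex_of_real (gauss_hat s \<xi>))"
proof (rule Bochner_Integration.integrable_bound)
  show "integrable lborel (\<lambda>\<xi>. B * gauss_hat s \<xi>)"
    using integrable_gauss_hat[OF \<open>s > 0\<close>] by auto
  show "AE \<xi> in lborel. norm (u \<xi> * complex_of_real (gauss_hat s \<xi>)) \<le> norm (B * gauss_hat s \<xi>)"
    using order_trans[OF norm_ge_zero B] by (auto simp: norm_mult abs_mult intro!: mult_right_mono B)
qed measurable

text \<open>The Fejer polynomial has L1 norm 1, which bounds its multiplier norm, and the Gaussian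
  \<open>wave_packet s 0\<close> has norm 1 as well. The operator norm therefore bounds the output
  uniformly in \<open>N\<close>, \<open>b\<close> and \<open>s\<close>.\<close>

lemma summability_kernels0_1_fejer_bound:
  assumes C: "\<And>\<phi>. \<phi> \<in> multipliers_Z 1 \<Longrightarrow> finite {n. \<phi> n \<noteq> 0} \<Longrightarrow> W \<phi> \<Lambda> \<in> multipliers_R 1 \<and>
        multiplier_norm_R 1 (W \<phi> \<Lambda>) \<le> C * multiplier_norm_Z 1 \<phi>"
    and l [measurable]: "l \<in> borel_measurable borel" and lB: "\<And>\<xi>. norm (l \<xi>) \<le> B"
    and ae: "AE \<xi> in lborel. \<Lambda> \<xi> = l \<xi>" and "N > 0" and s: "s > 0"
  shows "(\<integral>\<^sup>+x. ennreal (norm (fourier (\<lambda>\<xi>. fejer_W l N b \<xi> * gauss_hat s \<xi>) x)) \<partial>lborel) \<le> ennreal \<bar>C\<bar>"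
proof -
  let ?A = "{- int N..int N}"
  let ?\<phi> = "\<lambda>n. if n \<in> ?A then fejer_coeff N b n else 0"
  let ?f = "wave_packet s 0" and ?u = "\<lambda>\<xi>. fejer_W l N b \<xi> * complex_of_real (gauss_hat s \<xi>)"
  have fin: "finite {n. ?\<phi> n \<noteq> 0}" by (rule finite_subset[of _ ?A]) auto
  have eqP: "trig_poly ?A ?\<phi> = fejer_poly N b" by (rule ext) (simp add: trig_poly_def)
  have \<phi>: "?\<phi> \<in> multipliers_Z 1" by (rule trig_poly_L1_multiplier[of ?A]) auto
  have "multiplier_norm_Z 1 ?\<phi> \<le> (LINT x|torus. norm (trig_poly ?A ?\<phi> x))"
    by (rule trig_poly_L1_multiplier) auto
  then have \<phi>_le: "multiplier_norm_Z 1 ?\<phi> \<le> 1"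
    unfolding eqP integral_norm_fejer[OF \<open>N > 0\<close>] .
  have "C * multiplier_norm_Z 1 ?\<phi> \<le> \<bar>C\<bar> * 1"
    using \<phi>_le multiplier_norm_Z_nonneg[OF \<phi>] by (intro mult_mono) auto
  then have W: "W ?\<phi> \<Lambda> \<in> multipliers_R 1" "multiplier_norm_R 1 (W ?\<phi> \<Lambda>) \<le> \<bar>C\<bar>"
    using C[OF \<phi> fin] by auto
  from W(1) have ne: "{T. extends_multiplier_R 1 (W ?\<phi> \<Lambda>) T} \<noteq> {}" and Wm: "W ?\<phi> \<Lambda> \<in> borel_measurable lebesgue"
    by (auto simp: multipliers_R_def Linfty_space_def)
  have Wae: "AE \<xi> in lborel. W ?\<phi> \<Lambda> \<xi> = fejer_W l N b \<xi>"
  proof -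
    have "AE \<xi> in lborel. \<forall>n::int. \<Lambda> (\<xi> - of_int n) = l (\<xi> - of_int n)"
      unfolding AE_all_countable using AE_lborel_translate[OF ae, of "- of_int n" for n] by simp
    then show ?thesis
    proof eventually_elim
      case (elim \<xi>)
      have "W ?\<phi> \<Lambda> \<xi> = (\<Sum>n\<in>?A. ?\<phi> n * \<Lambda> (\<xi> - of_int n))" by (rule W_finite) auto
      then show ?case using elim by (simp add: fejer_W_def)
    qed
  qed
  have f: "?f \<in> schwartz" using s by (rule wave_packet_schwartz)
  have fi: "integrable lborel ?f" using schwartz_integrable[OF f, of 0] by simp
  then have fL: "?f \<in> Lp_space 1 lebesgue"
    by (simp add: Lp_space_1 integrable_completion)
  have four_f: "fourier ?f \<xi> = gauss_hat s \<xi>" for \<xi> using fourier_wave_packet[OF s, of 0 \<xi>] by simp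
  have ui: "integrable lborel ?u"
    by (rule integrable_bounded_mult_gauss_hat[OF _ norm_fejer_W_le[OF lB] s]) measurable
  have um: "fourier ?u \<in> borel_measurable borel" using ui by (rule borel_measurable_fourier)
  have eq: "fourier (\<lambda>\<xi>. W ?\<phi> \<Lambda> \<xi> * fourier ?f \<xi>) = fourier ?u"
    unfolding four_f
  proof (rule fourier_cong_AE)
    show "?u \<in> borel_measurable lebesgue" by (rule borel_measurable_lebesgueI) measurable
    show "(\<lambda>\<xi>. W ?\<phi> \<Lambda> \<xi> * complex_of_real (gauss_hat s \<xi>)) \<in> borel_measurable lebesgue"
      by (intro borel_measurable_times Wm borel_measurable_lebesgueI) measurable
    show "AE \<xi> in lborel. W ?\<phi> \<Lambda> \<xi> * complex_of_real (gauss_hat s \<xi>) = ?u \<xi>"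
      using Wae by eventually_elim simp
  qed
  \<comment> \<open>The slack \<open>e\<close> allows an operator to be picked from the infimum; it
    is removed at the end.\<close>
  have bound: "(\<integral>\<^sup>+x. ennreal (norm (fourier ?u x)) \<partial>lborel) \<le> ennreal (\<bar>C\<bar> + e)" if "e > 0" for e
  proof -
    have "multiplier_norm_R 1 (W ?\<phi> \<Lambda>) < \<bar>C\<bar> + e" using W(2) that by simp
    then obtain T where T: "extends_multiplier_R 1 (W ?\<phi> \<Lambda>) T" "Lp_onorm 1 lebesgue T < \<bar>C\<bar> + e"
      unfolding multiplier_norm_R_def cINF_less_iff[OF ne bdd_below_multiplier_norms(1)] by blast
    then have Tb: "bounded_Lp_operator 1 lebesgue T" by (simp add: extends_multiplier_R_def)
    have Ti: "integrable lebesgue (T ?f)"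
      using Tb fL by (auto simp: bounded_Lp_operator_def Lp_space_1)
    have "AE x in lebesgue. T ?f x = inv_fourier (\<lambda>\<xi>. W ?\<phi> \<Lambda> \<xi> * fourier ?f \<xi>) x"
      using T(1) f unfolding extends_multiplier_R_def by blast
    then have Tae: "AE x in lebesgue. T ?f x = fourier ?u (- x)"
      unfolding inv_fourier_eq eq .
    have "(\<integral>\<^sup>+x. ennreal (norm (fourier ?u x)) \<partial>lborel) = (\<integral>\<^sup>+x. ennreal (norm (fourier ?u (- x))) \<partial>lborel)"
      using nn_integral_real_affine[of "\<lambda>x. ennreal (norm (fourier ?u x))" "- 1" 0] um by simp
    also have "\<dots> = (\<integral>\<^sup>+x. ennreal (norm (fourier ?u (- x))) \<partial>lebesgue)"
      by (simp add: nn_integral_completion)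
    also have "\<dots> = (\<integral>\<^sup>+x. ennreal (norm (T ?f x)) \<partial>lebesgue)"
      using Tae by (intro nn_integral_cong_AE) (auto elim: eventually_mono)
    also have "\<dots> = ennreal (LINT x|lebesgue. norm (T ?f x))"
      using Ti by (intro nn_integral_eq_integral) auto
    also have "\<dots> \<le> ennreal (\<bar>C\<bar> + e)"
    proof (rule ennreal_leI)
      have "(LINT x|lebesgue. norm (?f x)) = 1"
        using fi integral_norm_wave_packet[OF s, of 0] by (subst integral_completion) auto
      then show "(LINT x|lebesgue. norm (T ?f x)) \<le> \<bar>C\<bar> + e"
        using Lp_onorm_bound[OF Tb fL] T(2) by (simp add: Lp_norm_1)
    qed
    finally show ?thesis .
  qed
  show ?thesis
  proof (rule ennreal_le_epsilon)
    fix e :: real assume "e > 0"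
    then show "(\<integral>\<^sup>+x. ennreal (norm (fourier ?u x)) \<partial>lborel) \<le> ennreal \<bar>C\<bar> + ennreal e"
      using bound[of e] by (simp add: ennreal_plus)
  qed
qed

section \<open>Transforms of reflections, translates and sums\<close>

lemma fourier_reflect:
  assumes "f \<in> borel_measurable borel"
  shows "fourier (\<lambda>x. f (- x)) \<xi> = fourier f (- \<xi>)"
proof -
  have [measurable]: "f \<in> borel_measurable borel" by fact
  show ?thesis
    using lborel_integral_real_affine[of "- 1" "\<lambda>x. f (- x) * cis (- 2 * pi * \<xi> * x)" 0]
    by (simp add: fourier_lborel)
qed

lemma fourier_translate:
  assumes "u \<in> borel_measurable borel"
  shows "fourier (\<lambda>\<xi>. u (\<xi> - a)) x = cis (- 2 * pi * a * x) * fourier u x"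
proof -
  have [measurable]: "u \<in> borel_measurable borel" by fact
  have "fourier (\<lambda>\<xi>. u (\<xi> - a)) x = (LINT \<xi>|lborel. u (\<xi> - a) * cis (- 2 * pi * x * \<xi>))"
    by (rule fourier_lborel) measurable
  also have "\<dots> = (LINT \<xi>|lborel. cis (- 2 * pi * a * x) * (u (\<xi> - a) * cis (- 2 * pi * x * (\<xi> - a))))"
  proof (intro Bochner_Integration.integral_cong refl)
    fix \<xi>
    have "cis (- 2 * pi * x * \<xi>) = cis (- 2 * pi * a * x) * cis (- 2 * pi * x * (\<xi> - a))"
      by (simp add: cis_mult algebra_simps)
    then show "u (\<xi> - a) * cis (- 2 * pi * x * \<xi>) = cis (- 2 * pi * a * x) * (u (\<xi> - a) * cis (- 2 * pi * x * (\<xi> - a)))"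
      by (simp only: mult.left_commute)
  qed
  also have "\<dots> = cis (- 2 * pi * a * x) * (LINT \<xi>|lborel. u (\<xi> - a) * cis (- 2 * pi * x * (\<xi> - a)))"
    by (rule integral_mult_right_zero)
  also have "(LINT \<xi>|lborel. u (\<xi> - a) * cis (- 2 * pi * x * (\<xi> - a))) = (LINT \<xi>|lborel. u \<xi> * cis (- 2 * pi * x * \<xi>))"
    by (rule integral_translate)
  also have "\<dots> = fourier u x" by (rule fourier_lborel[symmetric]) measurable
  finally show ?thesis .
qed

lemma fourier_sum:
  assumes "\<And>n. n \<in> A \<Longrightarrow> integrable lborel (f n)"
  shows "fourier (\<lambda>\<xi>. \<Sum>n\<in>A. c n * f n \<xi>) x = (\<Sum>n\<in>A. c n * fourier (f n) x)"
proof -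
  have m: "f n \<in> borel_measurable borel" if "n \<in> A" for n using assms[OF that] by auto
  have "fourier (\<lambda>\<xi>. \<Sum>n\<in>A. c n * f n \<xi>) x = (LINT \<xi>|lborel. (\<Sum>n\<in>A. c n * (f n \<xi> * cis (- 2 * pi * x * \<xi>))))"
    by (subst fourier_lborel) (auto simp: sum_distrib_right mult.assoc intro!: borel_measurable_sum borel_measurable_times m)
  also have "\<dots> = (\<Sum>n\<in>A. LINT \<xi>|lborel. c n * (f n \<xi> * cis (- 2 * pi * x * \<xi>)))"
    by (intro Bochner_Integration.integral_sum integrable_mult_right integrable_mult_cis assms) auto
  also have "\<dots> = (\<Sum>n\<in>A. c n * fourier (f n) x)"
    by (intro sum.cong refl) (simp add: fourier_lborel m)
  finally show ?thesis .
qed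

lemma fourier_gauss_hat_tendsto:
  fixes V :: "real \<Rightarrow> complex"
  assumes V: "integrable lborel V"
  shows "(\<lambda>n. fourier (\<lambda>\<xi>. V \<xi> * gauss_hat (inverse (real (Suc n))) \<xi>) x) \<longlonglongrightarrow> fourier V x"
proof -
  have [measurable]: "V \<in> borel_measurable borel" using V by auto
  let ?g = "\<lambda>n \<xi>. complex_of_real (gauss_hat (inverse (real (Suc n))) \<xi>)"
  have "(\<lambda>n. LINT \<xi>|lborel. V \<xi> * ?g n \<xi> * cis (- 2 * pi * x * \<xi>)) \<longlonglongrightarrow> (LINT \<xi>|lborel. V \<xi> * complex_of_real 1 * cis (- 2 * pi * x * \<xi>))"
  proof (rule integral_dominated_convergence)
    show "integrable lborel (\<lambda>\<xi>. norm (V \<xi>))" using V by auto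
    show "AE \<xi> in lborel. (\<lambda>n. V \<xi> * ?g n \<xi> * cis (- 2 * pi * x * \<xi>)) \<longlonglongrightarrow> V \<xi> * complex_of_real 1 * cis (- 2 * pi * x * \<xi>)"
      by (intro always_eventually allI tendsto_intros gauss_hat_tendsto inverse_Suc_tendsto)
    show "AE \<xi> in lborel. norm (V \<xi> * ?g n \<xi> * cis (- 2 * pi * x * \<xi>)) \<le> norm (V \<xi>)" for n
      by (auto simp: norm_mult intro!: mult_left_le)
  qed auto
  then show ?thesis by (simp add: fourier_lborel)
qed

section \<open>Concentration of Fejer kernels at their centre\<close>

lemma norm_fejer_poly_le:
  assumes "N > 0" and m: "m > 0" "m \<le> norm (1 - cis (2 * pi * (x - b)))"
  shows "norm (fejer_poly N b x) \<le> 4 / (m\<^sup>2 * real N)"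
proof -
  let ?z = "cis (2 * pi * (x - b))"
  \<comment> \<open>A geometric sum: multiplied by \<open>1 - ?z\<close> it becomes
    \<open>1 - ?z ^ N\<close>, of modulus at most 2. Away from \<open>b\<close> the kernel is
    therefore of order \<open>1 / N\<close>.\<close>
  have "(\<Sum>j<N. cis (real j * (2 * pi * (x - b)))) = (\<Sum>j<N. ?z ^ j)"
    by (intro sum.cong) (simp_all only: Complex.DeMoivre)
  then have "norm (1 - ?z) * norm (\<Sum>j<N. cis (real j * (2 * pi * (x - b)))) = norm (1 - ?z ^ N)"
    by (simp only: one_diff_power_eq norm_mult)
  also have "\<dots> \<le> 2"
    using norm_triangle_ineq4[of 1 "?z ^ N"] by (simp add: norm_power)
  finally have "m * norm (\<Sum>j<N. cis (real j * (2 * pi * (x - b)))) \<le> 2"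
    using mult_right_mono[OF m(2) norm_ge_zero] order_trans by blast
  then have "(m * norm (\<Sum>j<N. cis (real j * (2 * pi * (x - b)))))\<^sup>2 \<le> 2\<^sup>2"
    using m(1) by (intro power_mono) auto
  then have "(norm (\<Sum>j<N. cis (real j * (2 * pi * (x - b)))))\<^sup>2 \<le> 4 / m\<^sup>2"
    using m(1) by (simp add: power_mult_distrib pos_le_divide_eq mult.commute)
  then have "(norm (\<Sum>j<N. cis (real j * (2 * pi * (x - b)))))\<^sup>2 / real N \<le> 4 / m\<^sup>2 / real N"
    by (rule divide_right_mono) simp
  moreover have "norm (fejer_poly N b x) = (norm (\<Sum>j<N. cis (real j * (2 * pi * (x - b)))))\<^sup>2 / real N"
    unfolding trig_poly_fejer[OF \<open>N > 0\<close>] norm_of_real by (rule abs_of_nonneg) simp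
  ultimately show ?thesis by simp
qed

lemma cis_neq_1:
  assumes "0 < \<bar>y\<bar>" "\<bar>y\<bar> < 1"
  shows "cis (2 * pi * y) \<noteq> 1"
proof
  assume "cis (2 * pi * y) = 1"
  then have "cos (2 * (pi * y)) = 1" by (simp add: complex_eq_iff mult.assoc)
  then have "sin (pi * y) = 0" by (simp add: cos_double_sin)
  then have "sin (pi * \<bar>y\<bar>) = 0" by (auto simp: abs_if)
  moreover have "sin (pi * \<bar>y\<bar>) > 0" using assms by (intro sin_gt_zero) auto
  ultimately show False by simp
qed

text \<open>Near \<open>b\<close> the function exceeds any given \<open>c < u b\<close>, and the
  kernel has total mass 1 with only a part of order \<open>1 / N\<close> elsewhere, so the integral
  is at least \<open>c\<close> up to such an error. Away from \<open>b\<close> the estimate relies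
  on \<open>u x \<ge> 0\<close> alone, so no control from above enters.\<close>

lemma fejer_approximate_identity:
  fixes u :: "real \<Rightarrow> real"
  assumes u [measurable]: "u \<in> borel_measurable borel" and u0: "\<And>x. u x \<ge> 0" and cont: "isCont u b" and b: "0 < b" "b < 1"
    and D: "\<And>N. N > 0 \<Longrightarrow> (\<integral>\<^sup>+x. ennreal (norm (fejer_poly N b x)) * ennreal (u x) \<partial>torus) \<le> ennreal D" and "D \<ge> 0"
  shows "u b \<le> D"
proof (rule ccontr)
  assume "\<not> u b \<le> D"
  then obtain c where c: "D < c" "c < u b" using dense[of D "u b"] by auto
  with \<open>D \<ge> 0\<close> have c0: "c > 0" by simp
  have "u b - c > 0" using c(2) by simp
  then obtain \<rho> where \<rho>0: "\<rho> > 0" "\<And>x. dist x b < \<rho> \<Longrightarrow> dist (u x) (u b) < u b - c"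
    using cont unfolding continuous_at_eps_delta by blast
  have \<rho>: "u x > c" if "dist x b < \<rho>" for x
    using \<rho>0(2)[of x] that unfolding dist_real_def by linarith
  \<comment> \<open>As \<open>b\<close> is interior, no other point of the closed unit interval is
    congruent to it modulo 1; compactness then keeps the exponential away from 1 outside the
    ball.\<close>
  have "\<exists>m>0. \<forall>x\<in>{0..1} - ball b \<rho>. m \<le> norm (1 - cis (2 * pi * (x - b)))"
  proof (cases "{0..1} - ball b \<rho> = {}")
    case False
    have "compact ({0..1} - ball b \<rho>)" by (intro compact_diff) auto
    moreover have "continuous_on ({0..1} - ball b \<rho>) (\<lambda>x. norm (1 - cis (2 * pi * (x - b))))"
      by (intro continuous_intros)
    ultimately obtain y where y: "y \<in> {0..1} - ball b \<rho>"
      and min: "\<And>x. x \<in> {0..1} - ball b \<rho> \<Longrightarrow> norm (1 - cis (2 * pi * (y - b))) \<le> norm (1 - cis (2 * pi * (x - b)))"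
      using continuous_attains_inf[OF _ False] by blast
    have "cis (2 * pi * (y - b)) \<noteq> 1"
      using y b \<rho>0(1) by (intro cis_neq_1) (auto simp: dist_real_def)
    then have "norm (1 - cis (2 * pi * (y - b))) > 0" by simp
    with min show ?thesis by blast
  next
    case True
    then have "\<forall>x\<in>{0..1} - ball b \<rho>. 1 \<le> norm (1 - cis (2 * pi * (x - b)))" by blast
    then show ?thesis using zero_less_one by blast
  qed
  then obtain m where m: "m > 0" "\<And>x. x \<in> {0..1} - ball b \<rho> \<Longrightarrow> m \<le> norm (1 - cis (2 * pi * (x - b)))"
    by blast
  have le: "c \<le> D + c * 4 / m\<^sup>2 * inverse (real (Suc n))" for n
  proof -
    let ?P = "\<lambda>x. norm (fejer_poly (Suc n) b x)" and ?e = "4 / (m\<^sup>2 * real (Suc n))"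
    have Pm: "fejer_poly (Suc n) b \<in> borel_measurable torus" by (rule borel_measurable_torusI) measurable
    have um: "u \<in> borel_measurable torus" by (rule borel_measurable_torusI) measurable
    have "ennreal c = ennreal c * (\<integral>\<^sup>+x. ennreal (?P x) \<partial>torus)"
    proof -
      have "(\<integral>\<^sup>+x. ennreal (?P x) \<partial>torus) = ennreal (LINT x|torus. ?P x)"
        by (intro nn_integral_eq_integral integrable_norm integrable_torus_bounded[OF Pm norm_trig_poly_le]) auto
      then show ?thesis unfolding integral_norm_fejer[OF zero_less_Suc] by simp
    qed
    also have "\<dots> = (\<integral>\<^sup>+x. ennreal c * ennreal (?P x) \<partial>torus)"
      using Pm by (intro nn_integral_cmult[symmetric]) auto
    \<comment> \<open>The summand \<open>c * ?e\<close> pays for the points outside the ball, where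
      \<open>u\<close> may be smaller than \<open>c\<close>.\<close>
    also have "\<dots> \<le> (\<integral>\<^sup>+x. ennreal (?P x) * ennreal (u x) + ennreal (c * ?e) \<partial>torus)"
    proof (rule nn_integral_mono)
      fix x assume "x \<in> space torus"
      then have x: "x \<in> {0..1}" by (auto simp: space_torus)
      have "c * ?P x \<le> ?P x * u x + c * ?e"
      proof (cases "x \<in> ball b \<rho>")
        case True
        then have "c \<le> u x" using \<rho>[of x] by (auto simp: dist_commute)
        then have "c * ?P x \<le> ?P x * u x" by (subst mult.commute) (intro mult_left_mono norm_ge_zero)
        moreover have "0 \<le> c * ?e" using c0 by (intro mult_nonneg_nonneg) auto
        ultimately show ?thesis by simp
      next
        case False
        then have "?P x \<le> ?e" using x m by (intro norm_fejer_poly_le) auto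
        then have "c * ?P x \<le> c * ?e" using c0 by (intro mult_left_mono) auto
        moreover have "0 \<le> ?P x * u x" using u0 by (intro mult_nonneg_nonneg) auto
        ultimately show ?thesis by simp
      qed
      then have "ennreal (c * ?P x) \<le> ennreal (?P x * u x + c * ?e)" by (rule ennreal_leI)
      also have "\<dots> = ennreal (?P x * u x) + ennreal (c * ?e)"
        using c0 u0 by (intro ennreal_plus mult_nonneg_nonneg) auto
      finally show "ennreal c * ennreal (?P x) \<le> ennreal (?P x) * ennreal (u x) + ennreal (c * ?e)"
        using c0 u0[of x] by (simp only: ennreal_mult'' norm_ge_zero)
    qed
    also have "\<dots> = (\<integral>\<^sup>+x. ennreal (?P x) * ennreal (u x) \<partial>torus) + ennreal (c * ?e)"
      using Pm um torus.emeasure_space_1 by (subst nn_integral_add) auto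
    also have "\<dots> \<le> ennreal D + ennreal (c * ?e)"
      by (intro add_right_mono D) simp
    also have "\<dots> = ennreal (D + c * ?e)"
      using c0 \<open>D \<ge> 0\<close> by (intro ennreal_plus[symmetric] mult_nonneg_nonneg) auto
    finally have "c \<le> D + c * ?e"
      using c0 \<open>D \<ge> 0\<close> by (subst (asm) ennreal_le_iff) (intro add_nonneg_nonneg mult_nonneg_nonneg, auto)
    then show ?thesis by (simp add: divide_inverse mult.assoc)
  qed
  have "(\<lambda>n. D + c * 4 / m\<^sup>2 * inverse (real (Suc n))) \<longlonglongrightarrow> D + c * 4 / m\<^sup>2 * 0"
    by (intro tendsto_intros inverse_Suc_tendsto)
  then have "c \<le> D + c * 4 / m\<^sup>2 * 0"
    by (rule tendsto_lowerbound[OF _ always_eventually[OF allI[OF le]]]) simp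
  with c show False by simp
qed

text \<open>Splitting \<open>x\<close> into its floor and \<open>frac x\<close> turns its translates
  into translates of a point of the open unit interval; the larger range absorbs the shift of
  indices. Integers are excluded because \<open>D\<close> is given for interior points.\<close>

lemma sum_translates_le:
  fixes h :: "real \<Rightarrow> real"
  assumes h: "\<And>x. h x \<ge> 0" and D: "\<And>b M. 0 < b \<Longrightarrow> b < 1 \<Longrightarrow> (\<Sum>k = - int M..int M. h (b + of_int k)) \<le> D"
    and x: "x \<notin> \<int>"
  shows "(\<Sum>n = - int M..int M. h (x - of_int n)) \<le> D"
proof -
  let ?M = "M + nat \<bar>\<lfloor>x\<rfloor>\<bar>"
  have "(\<Sum>n = - int M..int M. h (x - of_int n)) = (\<Sum>k\<in>(\<lambda>n. \<lfloor>x\<rfloor> - n) ` {- int M..int M}. h (frac x + of_int k))"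
    by (subst sum.reindex) (auto simp: inj_on_def frac_def intro!: sum.cong)
  also have "\<dots> \<le> (\<Sum>k = - int ?M..int ?M. h (frac x + of_int k))"
    by (intro sum_mono2) (auto simp: h)
  also have "\<dots> \<le> D"
    using x by (intro D) (auto simp: frac_gt_0_iff frac_lt_1)
  finally show ?thesis .
qed

lemma AE_not_Ints: "AE x in lborel. (x :: real) \<notin> \<int>"
  by (intro AE_not_in countable_imp_null_set_lborel) (simp add: Ints_def)

text \<open>For \<open>\<Lambda> = F^\<close> the function \<open>fejer_W \<Lambda> N b\<close> is the Fourier transform of the product of \<open>F\<close> and the Fejer
  kernel of order \<open>N\<close> centred at \<open>b\<close>; the bound thus says that these products are bounded in \<open>L\<^sup>1\<close>.\<close>

locale fejer_bounded =
  fixes l :: "real \<Rightarrow> complex" and B D :: real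
  assumes l [measurable]: "l \<in> borel_measurable borel" and lB: "\<And>\<xi>. norm (l \<xi>) \<le> B" and D0: "D \<ge> 0"
    and fejer_bound: "\<And>N b s. N > 0 \<Longrightarrow> s > 0 \<Longrightarrow>
      (\<integral>\<^sup>+x. ennreal (norm (fourier (\<lambda>\<xi>. fejer_W l N b \<xi> * gauss_hat s \<xi>) x)) \<partial>lborel) \<le> ennreal D"
begin

section \<open>Regularized kernels and their uniform bounds\<close>

definition smoothed :: "real \<Rightarrow> real \<Rightarrow> complex" where
  "smoothed s \<xi> = l \<xi> * complex_of_real (gauss_hat s \<xi>)"

lemma smoothed_integrable: "s > 0 \<Longrightarrow> integrable lborel (smoothed s)"
  unfolding smoothed_def[abs_def] using lB by (intro integrable_bounded_mult_gauss_hat[where B = B]) auto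

lemma smoothed_measurable [measurable]: "smoothed s \<in> borel_measurable borel"
  unfolding smoothed_def[abs_def] by measurable

lemma fourier_smoothed_measurable: "s > 0 \<Longrightarrow> fourier (smoothed s) \<in> borel_measurable borel"
  by (intro borel_measurable_fourier smoothed_integrable)

text \<open>Translates become modulations. The argument of the kernel is reflected because the
  forward transform is taken where the inverse one is meant; \<open>regularized\<close> undoes
  this.\<close>

lemma fourier_fejer_smoothed:
  assumes "s > 0"
  shows "fourier (fejer_W (smoothed s) N b) x = fejer_poly N b (- x) * fourier (smoothed s) x"
proof -
  have "fourier (fejer_W (smoothed s) N b) x = (\<Sum>n = - int N..int N. fejer_coeff N b n * fourier (\<lambda>\<xi>. smoothed s (\<xi> - of_int n)) x)"
    unfolding fejer_W_def[abs_def] using smoothed_integrable[OF assms] by (intro fourier_sum integrable_translate)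
  also have "\<dots> = (\<Sum>n = - int N..int N. fejer_coeff N b n * cis (2 * pi * of_int n * (- x)) * fourier (smoothed s) x)"
    by (simp add: fourier_translate mult.assoc mult.left_commute)
  also have "\<dots> = fejer_poly N b (- x) * fourier (smoothed s) x"
    unfolding trig_poly_def sum_distrib_right ..
  finally show ?thesis .
qed

text \<open>The Gaussian factor inside \<open>smoothed s\<close> is an average of modulations, and modulating
  \<open>l\<close> only moves the centre \<open>b\<close> of the Fejer kernel.\<close>

lemma nn_integral_fourier_fejer_smoothed_regularized:
  assumes "N > 0" "s > 0" "r > 0"
  shows "(\<integral>\<^sup>+x. ennreal (norm (fourier (\<lambda>\<xi>. fejer_W (smoothed s) N b \<xi> * gauss_hat r \<xi>) x)) \<partial>lborel) \<le> ennreal D"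
proof -
  let ?A = "{- int N..int N}"
  let ?u = "\<lambda>n \<xi>. l (\<xi> - of_int n) * complex_of_real (gauss_hat r \<xi>)"
  define q where "q n = fourier (?u n)" for n
  let ?Q = "\<lambda>b y. \<Sum>n\<in>?A. fejer_coeff N b n * q n y"
  have ui: "integrable lborel (?u n)" for n
    using lB \<open>r > 0\<close> by (intro integrable_bounded_mult_gauss_hat[where B = B]) auto
  have qm [measurable]: "q n \<in> borel_measurable borel" for n
    unfolding q_def using ui by (rule borel_measurable_fourier)
  have Q: "?Q b y = fourier (\<lambda>\<xi>. fejer_W l N b \<xi> * gauss_hat r \<xi>) y" for b y
    unfolding fejer_W_def sum_distrib_right mult.assoc q_def by (rule fourier_sum[OF ui, symmetric])
  have wi: "integrable lborel (wave_packet s \<eta>)" for \<eta>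
    using schwartz_integrable[OF wave_packet_schwartz[OF \<open>s > 0\<close>], of 0] by simp
  \<comment> \<open>The translated Gaussian is the transform of a wave packet with frequency
    \<open>n\<close>; the multiplication formula replaces it by an average of translates of
    \<open>q n\<close>.\<close>
  have piece: "fourier (\<lambda>\<xi>. smoothed s (\<xi> - of_int n) * gauss_hat r \<xi>) x
      = (LINT t|lborel. wave_packet s (of_int n) t * q n (t + x))"
    and piece_int: "integrable lborel (\<lambda>\<xi>. smoothed s (\<xi> - of_int n) * gauss_hat r \<xi>)"
    and piece_int2: "integrable lborel (\<lambda>t. wave_packet s (of_int n) t * q n (t + x))" for n x
  proof -
    let ?v = "\<lambda>\<xi>. ?u n \<xi> * cis (2 * pi * \<xi> * (- x))"
    have vi: "integrable lborel ?v" by (intro integrable_mult_cis ui) measurable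
    have sB: "norm (smoothed s \<xi>) \<le> B" for \<xi>
      using order_trans[OF norm_ge_zero lB] mult_mono[OF lB[of \<xi>] gauss_hat_le_1[of s \<xi>]] by (simp add: smoothed_def norm_mult)
    show "integrable lborel (\<lambda>\<xi>. smoothed s (\<xi> - of_int n) * gauss_hat r \<xi>)"
      using sB \<open>r > 0\<close> by (intro integrable_bounded_mult_gauss_hat[where B = B]) auto
    have "fourier (\<lambda>\<xi>. smoothed s (\<xi> - of_int n) * gauss_hat r \<xi>) x
        = (LINT \<xi>|lborel. smoothed s (\<xi> - of_int n) * gauss_hat r \<xi> * cis (- 2 * pi * x * \<xi>))"
      by (rule fourier_lborel) measurable
    also have "\<dots> = (LINT \<xi>|lborel. fourier (wave_packet s (of_int n)) \<xi> * ?v \<xi>)"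
      by (intro Bochner_Integration.integral_cong refl) (simp add: smoothed_def fourier_wave_packet \<open>s > 0\<close> mult_ac)
    also have "\<dots> = (LINT t|lborel. wave_packet s (of_int n) t * fourier ?v t)"
      by (rule integral_fourier_mult[OF wi vi])
    also have "\<dots> = (LINT t|lborel. wave_packet s (of_int n) t * q n (t + x))"
      by (simp only: fourier_mult_cis diff_minus_eq_add q_def)
    finally show "fourier (\<lambda>\<xi>. smoothed s (\<xi> - of_int n) * gauss_hat r \<xi>) x
      = (LINT t|lborel. wave_packet s (of_int n) t * q n (t + x))" .
    have [measurable]: "wave_packet s (of_int n) \<in> borel_measurable borel" using wi by auto
    have "integrable lborel (\<lambda>t. (LINT \<xi>|lborel. norm (?u n \<xi>)) * norm (wave_packet s (of_int n) t))"
      using wi by auto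
    then show "integrable lborel (\<lambda>t. wave_packet s (of_int n) t * q n (t + x))"
    proof (rule Bochner_Integration.integrable_bound)
      show "AE t in lborel. norm (wave_packet s (of_int n) t * q n (t + x)) \<le> norm ((LINT \<xi>|lborel. norm (?u n \<xi>)) * norm (wave_packet s (of_int n) t))"
      proof (intro always_eventually allI)
        fix t
        have "norm (wave_packet s (of_int n) t * q n (t + x)) \<le> (LINT \<xi>|lborel. norm (?u n \<xi>)) * norm (wave_packet s (of_int n) t)"
          unfolding norm_mult q_def by (subst mult.commute) (intro mult_right_mono norm_fourier_le[OF ui, unfolded norm_mult] norm_ge_zero)
        then show "norm (wave_packet s (of_int n) t * q n (t + x)) \<le> norm ((LINT \<xi>|lborel. norm (?u n \<xi>)) * norm (wave_packet s (of_int n) t))"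
          unfolding real_norm_def by (rule order_trans[OF _ abs_ge_self])
      qed
    qed measurable
  qed
  have H: "fourier (\<lambda>\<xi>. fejer_W (smoothed s) N b \<xi> * gauss_hat r \<xi>) x
      = (LINT t|lborel. complex_of_real (normal_density 0 s t) * ?Q (b - t) (t + x))" for x
  proof -
    have "fourier (\<lambda>\<xi>. fejer_W (smoothed s) N b \<xi> * gauss_hat r \<xi>) x
        = (\<Sum>n\<in>?A. fejer_coeff N b n * fourier (\<lambda>\<xi>. smoothed s (\<xi> - of_int n) * gauss_hat r \<xi>) x)"
      unfolding fejer_W_def sum_distrib_right mult.assoc by (rule fourier_sum[OF piece_int])
    also have "\<dots> = (LINT t|lborel. (\<Sum>n\<in>?A. fejer_coeff N b n * (wave_packet s (of_int n) t * q n (t + x))))"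
      unfolding piece
      by (subst Bochner_Integration.integral_sum) (auto intro!: integrable_mult_right piece_int2)
    also have "\<dots> = (LINT t|lborel. complex_of_real (normal_density 0 s t) * ?Q (b - t) (t + x))"
    proof (intro Bochner_Integration.integral_cong refl)
      fix t
      \<comment> \<open>The phase of the packet and that of the Fejer coefficient combine, moving
        the centre from \<open>b\<close> to \<open>b - t\<close>.\<close>
      have eq: "cis (- 2 * pi * of_int n * b) * cis (2 * pi * of_int n * t) = cis (- 2 * pi * of_int n * (b - t))" for n
        by (simp add: cis_mult algebra_simps)
      have "fejer_coeff N b n * (wave_packet s (of_int n) t * q n (t + x))
          = complex_of_real (normal_density 0 s t) * (fejer_coeff N (b - t) n * q n (t + x))" for n
        unfolding wave_packet_def fejer_coeff_def eq[symmetric] by (simp only: mult_ac)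
      then show "(\<Sum>n\<in>?A. fejer_coeff N b n * (wave_packet s (of_int n) t * q n (t + x)))
          = complex_of_real (normal_density 0 s t) * ?Q (b - t) (t + x)"
        unfolding sum_distrib_left by (simp only:)
    qed
    finally show ?thesis .
  qed
  have "(\<integral>\<^sup>+x. ennreal (norm (fourier (\<lambda>\<xi>. fejer_W (smoothed s) N b \<xi> * gauss_hat r \<xi>) x)) \<partial>lborel)
      \<le> (\<integral>\<^sup>+x. \<integral>\<^sup>+t. ennreal (normal_density 0 s t) * ennreal (norm (?Q (b - t) (t + x))) \<partial>lborel \<partial>lborel)"
  proof (rule nn_integral_mono)
    fix x
    have "ennreal (norm (LINT t|lborel. complex_of_real (normal_density 0 s t) * ?Q (b - t) (t + x)))
      \<le> (\<integral>\<^sup>+t. ennreal (norm (complex_of_real (normal_density 0 s t) * ?Q (b - t) (t + x))) \<partial>lborel)"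
    proof (cases "integrable lborel (\<lambda>t. complex_of_real (normal_density 0 s t) * ?Q (b - t) (t + x))")
      case True
      then show ?thesis by (rule integral_norm_bound_ennreal)
    next
      case False
      show ?thesis unfolding not_integrable_integral_eq[OF False] by simp
    qed
    then show "ennreal (norm (fourier (\<lambda>\<xi>. fejer_W (smoothed s) N b \<xi> * gauss_hat r \<xi>) x))
      \<le> (\<integral>\<^sup>+t. ennreal (normal_density 0 s t) * ennreal (norm (?Q (b - t) (t + x))) \<partial>lborel)"
      unfolding H norm_mult by (simp add: ennreal_mult'')
  qed
  also have "\<dots> = (\<integral>\<^sup>+t. \<integral>\<^sup>+x. ennreal (normal_density 0 s t) * ennreal (norm (?Q (b - t) (t + x))) \<partial>lborel \<partial>lborel)"
    by (rule lborel_pair.Fubini'[symmetric]) measurable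
  also have "\<dots> \<le> (\<integral>\<^sup>+t. ennreal (normal_density 0 s t) * ennreal D \<partial>lborel)"
  proof (rule nn_integral_mono)
    fix t
    have "(\<integral>\<^sup>+x. ennreal (norm (?Q (b - t) (t + x))) \<partial>lborel) = (\<integral>\<^sup>+x. ennreal (norm (?Q (b - t) x)) \<partial>lborel)"
      using nn_integral_translate[of "\<lambda>x. ennreal (norm (?Q (b - t) x))" "- t"] by (simp add: add.commute)
    also have "\<dots> \<le> ennreal D"
      unfolding Q using assms by (intro fejer_bound)
    finally have "ennreal (normal_density 0 s t) * (\<integral>\<^sup>+x. ennreal (norm (?Q (b - t) (t + x))) \<partial>lborel) \<le> ennreal (normal_density 0 s t) * ennreal D"
      by (rule mult_left_mono) simp
    then show "(\<integral>\<^sup>+x. ennreal (normal_density 0 s t) * ennreal (norm (?Q (b - t) (t + x))) \<partial>lborel) \<le> ennreal (normal_density 0 s t) * ennreal D"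
      by (subst nn_integral_cmult) measurable
  qed
  also have "\<dots> = ennreal D"
    using \<open>s > 0\<close> by (simp add: nn_integral_multc nn_integral_eq_integral)
  finally show ?thesis .
qed

text \<open>The outer Gaussian came from the test function. With the inner one in place the sum is
  integrable, so Fatou's lemma lets the outer parameter tend to 0.\<close>

lemma nn_integral_fourier_fejer_smoothed:
  assumes "N > 0" "s > 0"
  shows "(\<integral>\<^sup>+x. ennreal (norm (fejer_poly N b (- x) * fourier (smoothed s) x)) \<partial>lborel) \<le> ennreal D"
proof -
  let ?V = "fejer_W (smoothed s) N b"
  let ?f = "\<lambda>n. fourier (\<lambda>\<xi>. ?V \<xi> * gauss_hat (inverse (real (Suc n))) \<xi>)"
  have V: "integrable lborel ?V"
    unfolding fejer_W_def using smoothed_integrable[OF \<open>s > 0\<close>]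
    by (intro Bochner_Integration.integrable_sum integrable_mult_right integrable_translate)
  have Vm [measurable]: "?V \<in> borel_measurable borel" by measurable
  have fi: "integrable lborel (\<lambda>\<xi>. ?V \<xi> * complex_of_real (gauss_hat r \<xi>))" for r
    by (rule Bochner_Integration.integrable_bound[OF V]) (auto simp: norm_mult intro!: mult_left_le)
  have [measurable]: "?f n \<in> borel_measurable borel" for n by (rule borel_measurable_fourier[OF fi])
  have "(\<integral>\<^sup>+x. ennreal (norm (fourier ?V x)) \<partial>lborel) = (\<integral>\<^sup>+x. liminf (\<lambda>n. ennreal (norm (?f n x))) \<partial>lborel)"
  proof (intro nn_integral_cong)
    fix x
    have "(\<lambda>n. ennreal (norm (?f n x))) \<longlonglongrightarrow> ennreal (norm (fourier ?V x))"
      by (intro tendsto_ennrealI tendsto_norm) (rule fourier_gauss_hat_tendsto[OF V])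
    then show "ennreal (norm (fourier ?V x)) = liminf (\<lambda>n. ennreal (norm (?f n x)))"
      by (rule lim_imp_Liminf[OF sequentially_bot, symmetric])
  qed
  also have "\<dots> \<le> liminf (\<lambda>n. \<integral>\<^sup>+x. ennreal (norm (?f n x)) \<partial>lborel)"
    by (rule nn_integral_liminf) measurable
  also have "\<dots> \<le> limsup (\<lambda>n. \<integral>\<^sup>+x. ennreal (norm (?f n x)) \<partial>lborel)"
    by (rule Liminf_le_Limsup) simp
  also have "\<dots> \<le> ennreal D"
    using assms by (intro Limsup_bounded always_eventually allI nn_integral_fourier_fejer_smoothed_regularized) auto
  finally show ?thesis unfolding fourier_fejer_smoothed[OF \<open>s > 0\<close>] .
qed

definition regularized :: "real \<Rightarrow> real \<Rightarrow> complex" where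
  "regularized s x = fourier (smoothed s) (- x)"

lemma continuous_regularized:
  assumes "s > 0"
  shows "isCont (regularized s) x"
proof -
  have "isCont (fourier (smoothed s)) (- x)"
    using continuous_fourier[OF smoothed_integrable[OF assms]] by (simp add: continuous_on_eq_continuous_at)
  then show ?thesis
    unfolding regularized_def[abs_def] by (rule isCont_o2[rotated]) (intro continuous_intros)
qed

lemma regularized_measurable:
  assumes "s > 0"
  shows "regularized s \<in> borel_measurable borel"
  by (rule borel_measurable_continuous_onI)
     (simp add: continuous_at_imp_continuous_on continuous_regularized[OF assms])

lemma nn_integral_fejer_regularized:
  assumes "N > 0" "s > 0"
  shows "(\<integral>\<^sup>+x. ennreal (norm (fejer_poly N b x)) * ennreal (norm (regularized s x)) \<partial>lborel) \<le> ennreal D"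
proof -
  note [measurable] = regularized_measurable[OF \<open>s > 0\<close>]
  have "(\<integral>\<^sup>+x. ennreal (norm (fejer_poly N b x)) * ennreal (norm (regularized s x)) \<partial>lborel)
      = (\<integral>\<^sup>+x. ennreal (norm (fejer_poly N b (- x))) * ennreal (norm (regularized s (- x))) \<partial>lborel)"
    using nn_integral_real_affine[of "\<lambda>x. ennreal (norm (fejer_poly N b x)) * ennreal (norm (regularized s x))" "- 1" 0] by simp
  also have "\<dots> = (\<integral>\<^sup>+x. ennreal (norm (fejer_poly N b (- x) * fourier (smoothed s) x)) \<partial>lborel)"
    by (simp add: regularized_def norm_mult ennreal_mult'')
  also have "\<dots> \<le> ennreal D" by (rule nn_integral_fourier_fejer_smoothed[OF assms])
  finally show ?thesis .
qed

text \<open>The Fejer kernel of order 1 is the constant 1, which makes the unweighted bound a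
  special case.\<close>

lemma nn_integral_regularized:
  assumes "s > 0"
  shows "(\<integral>\<^sup>+x. ennreal (norm (regularized s x)) \<partial>lborel) \<le> ennreal D"
proof -
  have one: "norm (fejer_poly 1 0 x) = 1" for x
    unfolding trig_poly_fejer[OF zero_less_one] by simp
  show ?thesis
    using nn_integral_fejer_regularized[OF zero_less_one assms, of 0]
    unfolding one ennreal_1 mult_1_left .
qed

lemma regularized_integrable:
  assumes "s > 0"
  shows "integrable lborel (regularized s)"
  using regularized_measurable[OF assms] order.strict_trans1[OF nn_integral_regularized[OF assms] ennreal_less_top]
  by (intro integrableI_bounded) auto

text \<open>Finite partial sums of the periodization are continuous, as \<open>regularized s\<close>
  is, so the concentration of Fejer kernels gives the bound at each \<open>b\<close> rather than
  almost everywhere. Unfolding the torus integral to the line supplies the bound on the weighted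
  integrals.\<close>

lemma sum_regularized_le:
  assumes "s > 0" and b: "0 < b" "b < 1"
  shows "(\<Sum>k = - int M..int M. norm (regularized s (b + of_int k))) \<le> D"
proof (rule fejer_approximate_identity[where u = "\<lambda>x. \<Sum>k = - int M..int M. norm (regularized s (x + of_int k))"])
  note [measurable] = regularized_measurable[OF \<open>s > 0\<close>]
  show "(\<lambda>x. \<Sum>k = - int M..int M. norm (regularized s (x + of_int k))) \<in> borel_measurable borel" by measurable
  show "0 \<le> (\<Sum>k = - int M..int M. norm (regularized s (x + of_int k)))" for x by (rule sum_nonneg) simp
  show "isCont (\<lambda>x. \<Sum>k = - int M..int M. norm (regularized s (x + of_int k))) b"
  proof -
    have "isCont (\<lambda>x. regularized s (x + of_int k)) b" for k
      by (rule isCont_o2[OF _ continuous_regularized[OF \<open>s > 0\<close>]]) (intro continuous_intros)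
    then show ?thesis by (intro continuous_sum continuous_norm)
  qed
  fix N :: nat assume "N > 0"
  have "(\<integral>\<^sup>+x. ennreal (norm (fejer_poly N b x)) * ennreal (\<Sum>k = - int M..int M. norm (regularized s (x + of_int k))) \<partial>torus)
      \<le> (\<integral>\<^sup>+x. ennreal (norm (fejer_poly N b x)) * (\<Sum>\<^sub>\<infinity>k\<in>UNIV. ennreal (norm (regularized s (x + of_int k)))) \<partial>torus)"
  proof (intro nn_integral_mono mult_left_mono)
    fix x
    have "ennreal (\<Sum>k = - int M..int M. norm (regularized s (x + of_int k))) = (\<Sum>k = - int M..int M. ennreal (norm (regularized s (x + of_int k))))"
      by (simp add: sum_ennreal)
    also have "\<dots> \<le> (\<Sum>\<^sub>\<infinity>k\<in>UNIV. ennreal (norm (regularized s (x + of_int k))))"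
      unfolding infsum_int_ennreal by (rule SUP_upper) simp
    finally show "ennreal (\<Sum>k = - int M..int M. norm (regularized s (x + of_int k))) \<le> (\<Sum>\<^sub>\<infinity>k\<in>UNIV. ennreal (norm (regularized s (x + of_int k))))" .
  qed simp
  also have "\<dots> = (\<integral>\<^sup>+x. ennreal (norm (fejer_poly N b x)) * ennreal (norm (regularized s x)) \<partial>lborel)"
    by (rule nn_integral_mult_periodic[symmetric]) measurable
  also have "\<dots> \<le> ennreal D" by (rule nn_integral_fejer_regularized[OF \<open>N > 0\<close> \<open>s > 0\<close>])
  finally show "(\<integral>\<^sup>+x. ennreal (norm (fejer_poly N b x)) * ennreal (\<Sum>k = - int M..int M. norm (regularized s (x + of_int k))) \<partial>torus) \<le> ennreal D" .
qed (fact b D0)+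

lemma sum_regularized_translates_le:
  assumes "s > 0" "x \<notin> \<int>"
  shows "(\<Sum>n = - int M..int M. norm (regularized s (x - of_int n))) \<le> D"
  by (rule sum_translates_le[OF norm_ge_zero sum_regularized_le[OF assms(1)] assms(2)])

lemma sqnorm_regularized_le:
  assumes "s > 0"
  shows "sqnorm lborel (regularized s) \<le> ennreal (D * D)"
proof -
  note [measurable] = regularized_measurable[OF assms]
  have "sqnorm lborel (regularized s) \<le> (\<integral>\<^sup>+x. ennreal D * ennreal (norm (regularized s x)) \<partial>lborel)"
    unfolding sqnorm_def
  proof (intro nn_integral_mono_AE, use AE_not_Ints in eventually_elim)
    case (elim x)
    \<comment> \<open>The sum with \<open>M = 0\<close> is a single term, so the bound applies to
      the function itself.\<close>
    have "norm (regularized s x) \<le> D"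
      using sum_regularized_translates_le[OF assms elim, of 0] by simp
    then show ?case
      using D0 by (simp add: power2_eq_square ennreal_mult[symmetric] mult_right_mono ennreal_leI)
  qed
  also have "\<dots> = ennreal D * (\<integral>\<^sup>+x. ennreal (norm (regularized s x)) \<partial>lborel)"
    by (rule nn_integral_cmult) measurable
  also have "\<dots> \<le> ennreal D * ennreal D"
    by (intro mult_left_mono nn_integral_regularized assms) simp
  also have "\<dots> = ennreal (D * D)" using D0 by (simp add: ennreal_mult)
  finally show ?thesis .
qed

text \<open>As \<open>l\<close> may be discontinuous, inversion is used in its almost everywhere
  form; it applies because the L1 bound on \<open>regularized s\<close> makes the transform of
  \<open>smoothed s\<close> integrable.\<close>

lemma fourier_regularized:
  assumes "s > 0"
  shows "AE \<xi> in lborel. fourier (regularized s) \<xi> = smoothed s \<xi>"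
proof -
  have i: "integrable lborel (fourier (smoothed s))"
    using lborel_integrable_real_affine[OF regularized_integrable[OF assms], of "- 1" 0] by (simp add: regularized_def)
  have "fourier (regularized s) \<xi> = fourier (fourier (smoothed s)) (- \<xi>)" for \<xi>
    unfolding regularized_def[abs_def] by (rule fourier_reflect[OF fourier_smoothed_measurable[OF assms]])
  then show ?thesis
    using fourier_inversion_AE[OF smoothed_integrable[OF assms] i] by (auto elim: eventually_mono)
qed

lemma smoothed_tendsto: "(\<lambda>n. smoothed (inverse (real (Suc n))) \<xi>) \<longlonglongrightarrow> l \<xi>"
proof -
  have "(\<lambda>n. smoothed (inverse (real (Suc n))) \<xi>) \<longlonglongrightarrow> l \<xi> * complex_of_real 1"
    unfolding smoothed_def by (intro tendsto_intros gauss_hat_tendsto inverse_Suc_tendsto)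
  then show ?thesis by simp
qed

text \<open>Each smoothed function is almost everywhere the transform of a regularized one, so the
  contraction property carries the uniform L2 bound over to it, and Fatou's lemma carries it to
  \<open>l\<close>.\<close>

lemma sqnorm_l_le: "sqnorm lborel l \<le> ennreal (D * D)"
proof (rule sqnorm_tendsto_le[where a = "\<lambda>n. smoothed (inverse (real (Suc n)))" and N = 0])
  show "smoothed (inverse (real (Suc n))) \<in> borel_measurable lborel" for n by measurable
  show "AE \<xi> in lborel. (\<lambda>n. smoothed (inverse (real (Suc n))) \<xi>) \<longlonglongrightarrow> l \<xi>"
    by (intro always_eventually allI smoothed_tendsto)
  fix n
  let ?s = "inverse (real (Suc n))"
  have "sqnorm lborel (smoothed ?s) = sqnorm lborel (fourier (regularized ?s))"
    using fourier_regularized[of ?s] by (intro sqnorm_cong_AE) (auto elim: eventually_mono)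
  also have "\<dots> \<le> sqnorm lborel (regularized ?s)"
    using fourier_L2_le[OF regularized_integrable[of ?s]] by (simp add: sqnorm_def)
  also have "\<dots> \<le> ennreal (D * D)" by (rule sqnorm_regularized_le) simp
  finally show "sqnorm lborel (smoothed ?s) \<le> ennreal (D * D)" .
qed

text \<open>Square integrability of \<open>l\<close>, just obtained, supplies the majorant for
  dominated convergence.\<close>

lemma smoothed_L2_tendsto: "(\<lambda>n. sqnorm lborel (\<lambda>\<xi>. smoothed (inverse (real (Suc n))) \<xi> - l \<xi>)) \<longlonglongrightarrow> 0"
proof -
  have "(\<lambda>n. sqnorm lborel (\<lambda>\<xi>. smoothed (inverse (real (Suc n))) \<xi> - l \<xi>)) \<longlonglongrightarrow> (\<integral>\<^sup>+x. 0 \<partial>(lborel :: real measure))"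
    unfolding sqnorm_def
  proof (rule nn_integral_dominated_convergence[where w = "\<lambda>\<xi>. ennreal ((norm (l \<xi>))\<^sup>2)"])
    show "AE \<xi> in lborel. ennreal ((norm (smoothed (inverse (real (Suc n))) \<xi> - l \<xi>))\<^sup>2) \<le> ennreal ((norm (l \<xi>))\<^sup>2)" for n
    proof (intro always_eventually allI ennreal_leI power_mono norm_ge_zero)
      fix \<xi>
      let ?g = "gauss_hat (inverse (real (Suc n))) \<xi>"
      have "norm (smoothed (inverse (real (Suc n))) \<xi> - l \<xi>) = norm (l \<xi> * complex_of_real (?g - 1))"
        by (simp add: smoothed_def algebra_simps)
      also have "\<dots> = norm (l \<xi>) * \<bar>?g - 1\<bar>" by (simp only: norm_mult norm_of_real)
      also have "\<dots> \<le> norm (l \<xi>)"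
        using gauss_hat_nonneg[of "inverse (real (Suc n))" \<xi>] gauss_hat_le_1[of "inverse (real (Suc n))" \<xi>] by (intro mult_left_le norm_ge_zero) linarith
      finally show "norm (smoothed (inverse (real (Suc n))) \<xi> - l \<xi>) \<le> norm (l \<xi>)" .
    qed
    show "AE \<xi> in lborel. (\<lambda>n. ennreal ((norm (smoothed (inverse (real (Suc n))) \<xi> - l \<xi>))\<^sup>2)) \<longlonglongrightarrow> 0"
    proof (intro always_eventually allI)
      fix \<xi>
      have "(\<lambda>n. ennreal ((norm (smoothed (inverse (real (Suc n))) \<xi> - l \<xi>))\<^sup>2)) \<longlonglongrightarrow> ennreal ((norm (l \<xi> - l \<xi>))\<^sup>2)"
        by (intro tendsto_ennrealI tendsto_intros smoothed_tendsto)
      then show "(\<lambda>n. ennreal ((norm (smoothed (inverse (real (Suc n))) \<xi> - l \<xi>))\<^sup>2)) \<longlonglongrightarrow> 0" by simp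
    qed
    show "(\<integral>\<^sup>+\<xi>. ennreal ((norm (l \<xi>))\<^sup>2) \<partial>lborel) < \<infinity>"
      using order.strict_trans1[OF sqnorm_l_le ennreal_less_top] by (simp add: sqnorm_def)
  qed auto
  then show ?thesis by simp
qed

text \<open>Convergence in L2 identifies the transform of the limit, while the almost everywhere
  convergent subsequence carries the L1 bound and the periodization bound over to
  \<open>F\<close>.\<close>

lemma fourier_representation:
  obtains F where "integrable lborel F" "AE \<xi> in lborel. l \<xi> = fourier F \<xi>"
    "AE x in lborel. \<forall>M. (\<Sum>n = - int M..int M. norm (F (x - of_int n))) \<le> D"
proof -
  let ?s = "\<lambda>n. inverse (real (Suc n))"
  let ?F = "\<lambda>n. regularized (?s n)"
  have Fm [measurable]: "?F n \<in> borel_measurable borel" for n by (rule regularized_measurable) simp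
  have Fi: "integrable lborel (?F n)" for n by (rule regularized_integrable) simp
  \<comment> \<open>Up to reflection this difference is the transform of a difference of smoothed
    functions.\<close>
  have dist: "sqnorm lborel (\<lambda>x. ?F m x - ?F n x) \<le> sqnorm lborel (\<lambda>\<xi>. smoothed (?s m) \<xi> - smoothed (?s n) \<xi>)" for m n
  proof -
    let ?d = "\<lambda>x. fourier (smoothed (?s m)) x - fourier (smoothed (?s n)) x"
    have [measurable]: "fourier (smoothed (?s k)) \<in> borel_measurable borel" for k
      by (rule fourier_smoothed_measurable) simp
    have "sqnorm lborel (\<lambda>x. ?F m x - ?F n x) = sqnorm lborel (\<lambda>x. ?d (- x))" by (simp add: regularized_def)
    also have "\<dots> = sqnorm lborel ?d" by (rule sqnorm_reflect) measurable
    also have "\<dots> \<le> sqnorm lborel (\<lambda>\<xi>. smoothed (?s m) \<xi> - smoothed (?s n) \<xi>)"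
      by (intro sqnorm_fourier_diff_le smoothed_integrable) auto
    finally show ?thesis .
  qed
  obtain F r where Fmeas: "F \<in> borel_measurable lborel" and r: "strict_mono (r :: nat \<Rightarrow> nat)"
    and lim: "AE x in lborel. (\<lambda>k. ?F (r k) x) \<longlonglongrightarrow> F x" and L2: "(\<lambda>n. sqnorm lborel (\<lambda>x. ?F n x - F x)) \<longlonglongrightarrow> 0"
  proof (rule L2_complete[of ?F lborel])
    show "?F n \<in> borel_measurable lborel" for n using Fm[of n] by simp
  next
    fix e :: real assume "e > 0"
    then have "\<forall>\<^sub>F n in sequentially. sqnorm lborel (\<lambda>\<xi>. smoothed (?s n) \<xi> - l \<xi>) < ennreal (e / 4)"
      by (intro order_tendstoD[OF smoothed_L2_tendsto]) simp
    then obtain N where N: "\<And>n. n \<ge> N \<Longrightarrow> sqnorm lborel (\<lambda>\<xi>. smoothed (?s n) \<xi> - l \<xi>) < ennreal (e / 4)"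
      by (auto simp: eventually_sequentially)
    have "sqnorm lborel (\<lambda>x. ?F m x - ?F n x) \<le> ennreal e" if "m \<ge> N" "n \<ge> N" for m n
    proof -
      note dist
      also have "sqnorm lborel (\<lambda>\<xi>. smoothed (?s m) \<xi> - smoothed (?s n) \<xi>)
          \<le> 2 * sqnorm lborel (\<lambda>\<xi>. l \<xi> - smoothed (?s m) \<xi>) + 2 * sqnorm lborel (\<lambda>\<xi>. l \<xi> - smoothed (?s n) \<xi>)"
        by (intro sqnorm_diff_le) auto
      also have "\<dots> \<le> 2 * ennreal (e / 4) + 2 * ennreal (e / 4)"
        unfolding sqnorm_diff_commute[of lborel l]
        by (intro add_mono mult_left_mono less_imp_le N that) auto
      also have "\<dots> = ennreal e"
        using \<open>e > 0\<close> by (simp add: ennreal_mult'[symmetric] ennreal_plus[symmetric] ennreal_numeral[symmetric] del: ennreal_plus ennreal_numeral)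
      finally show ?thesis .
    qed
    then show "\<exists>N. \<forall>m\<ge>N. \<forall>n\<ge>N. sqnorm lborel (\<lambda>x. ?F m x - ?F n x) \<le> ennreal e" by blast
  qed auto
  have [measurable]: "F \<in> borel_measurable borel" using Fmeas by simp
  have "(\<integral>\<^sup>+x. ennreal (norm (F x)) \<partial>lborel) = (\<integral>\<^sup>+x. liminf (\<lambda>k. ennreal (norm (?F (r k) x))) \<partial>lborel)"
  proof (intro nn_integral_cong_AE, use lim in eventually_elim)
    case (elim x)
    then have "(\<lambda>k. ennreal (norm (?F (r k) x))) \<longlonglongrightarrow> ennreal (norm (F x))"
      by (intro tendsto_ennrealI tendsto_norm)
    then show ?case by (rule lim_imp_Liminf[OF sequentially_bot, symmetric])
  qed
  also have "\<dots> \<le> liminf (\<lambda>k. \<integral>\<^sup>+x. ennreal (norm (?F (r k) x)) \<partial>lborel)"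
    by (rule nn_integral_liminf) measurable
  also have "\<dots> \<le> limsup (\<lambda>k. \<integral>\<^sup>+x. ennreal (norm (?F (r k) x)) \<partial>lborel)"
    by (rule Liminf_le_Limsup) simp
  also have "\<dots> \<le> ennreal D"
    by (intro Limsup_bounded always_eventually allI nn_integral_regularized) simp
  finally have Fint: "integrable lborel F"
    by (intro integrableI_bounded) (auto intro: order.strict_trans1)
  \<comment> \<open>Both \<open>l\<close> and \<open>fourier F\<close> are L2 limits of the smoothed
    functions.\<close>
  have "AE \<xi> in lborel. l \<xi> = fourier F \<xi>"
  proof (rule sqnorm_limit_unique[OF _ _ _ smoothed_L2_tendsto])
    have "sqnorm lborel (\<lambda>\<xi>. smoothed (?s n) \<xi> - fourier F \<xi>) \<le> sqnorm lborel (\<lambda>x. ?F n x - F x)" for n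
    proof -
      have "sqnorm lborel (\<lambda>\<xi>. smoothed (?s n) \<xi> - fourier F \<xi>) = sqnorm lborel (\<lambda>\<xi>. fourier (?F n) \<xi> - fourier F \<xi>)"
        using fourier_regularized[of "?s n"] by (intro sqnorm_cong_AE) (auto elim: eventually_mono)
      also have "\<dots> \<le> sqnorm lborel (\<lambda>x. ?F n x - F x)" by (rule sqnorm_fourier_diff_le[OF Fi Fint])
      finally show ?thesis .
    qed
    then show "(\<lambda>n. sqnorm lborel (\<lambda>\<xi>. smoothed (?s n) \<xi> - fourier F \<xi>)) \<longlonglongrightarrow> 0"
      by (intro tendsto_sandwich[OF _ _ tendsto_const[of 0] L2] always_eventually allI) auto
  qed (use borel_measurable_fourier[OF Fint] in auto)
  moreover have "AE x in lborel. \<forall>M. (\<Sum>n = - int M..int M. norm (F (x - of_int n))) \<le> D"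
  proof -
    have "AE x in lborel. \<forall>n::int. (\<lambda>k. ?F (r k) (x - of_int n)) \<longlonglongrightarrow> F (x - of_int n)"
      unfolding AE_all_countable using AE_lborel_translate[OF lim, of "- of_int n" for n] by simp
    then show ?thesis
      using AE_not_Ints
    proof (eventually_elim, intro allI)
      fix x :: real and M
      assume lim: "\<forall>n::int. (\<lambda>k. ?F (r k) (x - of_int n)) \<longlonglongrightarrow> F (x - of_int n)" and x: "x \<notin> \<int>"
      have "(\<lambda>k. \<Sum>n = - int M..int M. norm (?F (r k) (x - of_int n))) \<longlonglongrightarrow> (\<Sum>n = - int M..int M. norm (F (x - of_int n)))"
        by (intro tendsto_sum tendsto_norm lim[rule_format])
      then show "(\<Sum>n = - int M..int M. norm (F (x - of_int n))) \<le> D"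
        by (rule tendsto_upperbound)
           (auto intro!: always_eventually sum_regularized_translates_le x)
    qed
  qed
  ultimately show thesis using that Fint by blast
qed

end

section \<open>Representation of the kernels for exponent 1\<close>

lemma fourier_if_summability_kernels0_1:
  assumes "\<Lambda> \<in> summability_kernels0 1"
  shows "\<exists>F\<in>Lp_space 1 lebesgue. periodization_bound F < \<infinity> \<and> (AE \<xi> in lebesgue. \<Lambda> \<xi> = fourier F \<xi>)"
proof -
  from assms obtain C where L: "\<Lambda> \<in> Linfty_space lebesgue"
    and C: "\<And>\<phi>. \<phi> \<in> multipliers_Z 1 \<Longrightarrow> finite {n. \<phi> n \<noteq> 0} \<Longrightarrow> W \<phi> \<Lambda> \<in> multipliers_R 1 \<and>
        multiplier_norm_R 1 (W \<phi> \<Lambda>) \<le> C * multiplier_norm_Z 1 \<phi>"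
    unfolding summability_kernels0_def by blast
  from L obtain B where Lm: "\<Lambda> \<in> borel_measurable lebesgue" and "AE \<xi> in lebesgue. norm (\<Lambda> \<xi>) \<le> B"
    by (auto simp: Linfty_space_def)
  then have B: "AE \<xi> in lborel. norm (\<Lambda> \<xi>) \<le> B" by (simp add: AE_completion_iff)
  obtain l0 where [measurable]: "l0 \<in> borel_measurable borel" and l0: "AE \<xi> in lborel. \<Lambda> \<xi> = l0 \<xi>"
    using lebesgue_borel_rep[OF Lm] by blast
  \<comment> \<open>A version bounded everywhere, as the locale requires; with
    \<open>\<bar>B\<bar>\<close> the value 0 obeys the bound too.\<close>
  define l where "l \<xi> = (if norm (l0 \<xi>) \<le> \<bar>B\<bar> then l0 \<xi> else 0)" for \<xi>
  have l [measurable]: "l \<in> borel_measurable borel" unfolding l_def[abs_def] by measurable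
  have lB: "norm (l \<xi>) \<le> \<bar>B\<bar>" for \<xi> by (auto simp: l_def)
  have ae: "AE \<xi> in lborel. \<Lambda> \<xi> = l \<xi>" using l0 B by eventually_elim (auto simp: l_def)
  \<comment> \<open>The locale constant \<open>D\<close> becomes \<open>\<bar>C\<bar>\<close>, the
    sign of the kernel constant \<open>C\<close> being unknown.\<close>
  obtain F where F: "integrable lborel F" "AE \<xi> in lborel. l \<xi> = fourier F \<xi>"
    "AE x in lborel. \<forall>M. (\<Sum>n = - int M..int M. norm (F (x - of_int n))) \<le> \<bar>C\<bar>"
    using fejer_bounded.fourier_representation[OF fejer_bounded.intro[OF l lB abs_ge_zero[of C] summability_kernels0_1_fejer_bound[OF C l lB ae]]] by blast
  have [measurable]: "F \<in> borel_measurable borel" using F(1) by auto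
  have "F \<in> Lp_space 1 lebesgue" using F(1) by (simp add: Lp_space_1 integrable_completion)
  moreover have "periodization_bound F < \<infinity>"
    using F(3) abs_ge_zero[of C]
    by (intro iffD2[OF periodization_bound_finite_iff] borel_measurable_lebesgueI) (measurable, blast)
  moreover have "AE \<xi> in lborel. \<Lambda> \<xi> = fourier F \<xi>"
    using ae F(2) by eventually_elim simp
  ultimately show ?thesis using AE_completion by blast
qed

theorem theorem2p1:
  shows "(summability_kernels0 2 = summability_kernels 2 \<and>
          summability_kernels 2 =
            {\<Lambda> \<in> Linfty_space lebesgue. periodization_bound \<Lambda> < \<infinity>}) \<and>
         summability_kernels0 1 =
           {\<Lambda>. \<exists>F\<in>Lp_space 1 lebesgue. periodization_bound F < \<infinity> \<and>
                  (AE \<xi> in lebesgue. \<Lambda> \<xi> = fourier F \<xi>)}"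
  using summability_kernels_2_eq fourier_if_summability_kernels0_1 summability_kernels0_1_if_fourier by blast

end
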